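(* Let $d\ge1$, let $r=(r_1,\dots,r_d)$ and $s=(s_1,\dots,s_d)$ have positive entries, let $\gamma_i:=1/r_i-1/(r_i+s_i)$, and put $\theta_i:=\sqrt{\lambda_i/\gamma_i}$, $i=1,\dots,d$. Let $f:[0,\infty)^d\to[0,\infty]$ be measurable, not a.e. zero, with $F(z,t)<\infty$ for all $z\in\mathbb{N}^d$, $t\in(0,\infty)^d$ ($F$ is defined in the context). 1) Suppose that for every $z\in\mathbb{N}^d$ and every $t=(t_1,\dots,t_d)\in(0,\infty)^d$ (with $\gamma_1,\dots,\gamma_d$ held fixed), $$\sum_{i=1}^d \gamma_it_iz_i\bigl\{F(z,t)-F(z-\delta_i,t)\bigr\}+\sum_{i=1}^d \gamma_it_i(z_i+1/2)\bigl\{F(z,t)-F(z+\delta_i,t)\bigr\}\ge 0, \qquad ( * )$$ where $\delta_i$ is the $i$th standard unit vector of $\mathbb{R}^d$ and $F(z-\delta_i,t):=1$ if $z_i=0$. Then the Bayesian predictive distribution $p_{f,\mathrm J}(y\mid x)$ weakly dominates the Bayesian predictive distribution $p_{\mathrm J}(y\mid x)$. Furthermore, if $F(z,r)$ is not a constant function of $z$ on $\mathbb{N}^d$, then $p_{f,\mathrm J}(y\mid x)$ dominates $p_{\mathrm J}(y\mid x)$. 2) Condition $( * )$ (for every $z\in\mathbb{N}^d$, $t\in(0,\infty)^d$) is satisfied if $f\in\mathcal{C}^2([0,\infty)^d)$ satisfies, for every $z\in\mathbb{N}^d$, every scalar $\rho>0$ and every $i\in\{1,\dots,d\}$, the regularity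 conditions $$\int f(\theta)\prod_{j=1}^d\theta_j^{2z_j}e^{-\rho\theta_j^2}\,\mathrm{d}\theta<\infty,\quad \int\Bigl|\frac{\partial f}{\partial\theta_i}(\theta)\Bigr|\prod_{j=1}^d\theta_j^{2z_j}e^{-\rho\theta_j^2}\,\mathrm{d}\theta<\infty,\quad \int\Bigl|\frac{\partial^2 f}{\partial\theta_i^2}(\theta)\Bigr|\prod_{j=1}^d\theta_j^{2z_j}e^{-\rho\theta_j^2}\,\mathrm{d}\theta<\infty$$ (integrals over $[0,\infty)^d$), and in addition $$\sum_{i=1}^d\frac{\partial^2 f}{\partial\theta_i^2}(\theta)\le 0\quad\text{for all }\theta,\qquad\text{and}\qquad \frac{\partial f}{\partial\theta_i}(\theta)\Big|_{\theta_i=0}\le 0\quad\text{for every } i.$$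
   Context: $\mathbb{N}=\{0,1,2,\dots\}$. Model (different durations): for unknown $\lambda\in(0,\infty)^d$ and known $r_i,s_i>0$, $x$ and $y$ are independent with $p(x\mid\lambda)=\prod_{i=1}^d (r_i\lambda_i)^{x_i}e^{-r_i\lambda_i}/x_i!$ and $p(y\mid\lambda)=\prod_{i=1}^d (s_i\lambda_i)^{y_i}e^{-s_i\lambda_i}/y_i!$, $x,y\in\mathbb{N}^d$. For a (possibly improper) prior density $\pi(\lambda)$, the Bayesian predictive distribution is $p_\pi(y\mid x)=\int p(x\mid\lambda)p(y\mid\lambda)\pi(\lambda)\,\mathrm{d}\lambda\big/\int p(x\mid\lambda)\pi(\lambda)\,\mathrm{d}\lambda$. The Jeffreys prior is $\pi_{\mathrm J}(\lambda)\propto\prod_{i=1}^d\lambda_i^{-1/2}$, with predictive distribution $p_{\mathrm J}$. For nonnegative $f$ on $[0,\infty)^d$, $\pi_{f,\mathrm J}(\lambda)\propto f(\theta_1,\dots,\theta_d)\prod_{i=1}^d\lambda_i^{-1/2}$ with $\theta_i=\sqrt{\lambda_i/\gamma_i}$, and $p_{f,\mathrm J}$ is the corresponding predictive distribution. The Kullback–Leibler (K-L) risk of a predictive distribution $q(y\mid x)$ at $\lambda$ is $\sum_x p(x\mid\lambda)\sum_y p(y\mid\lambda)\log\frac{p(y\mid\lambda)}{q(y\mid x)}$. $q_1$ weakly dominates $q_2$ if the K-L risk of $q_1$ is at most that of $q_2$ at every $\lambda$; $q_1$ dominates $q_2$ if moreover the inequality is strict for some $\lambda$. For $z\in\mathbb{N}^d$,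 $t\in(0,\infty)^d$, $$F(z,t)=\int_{(0,\infty)^d} f\bigl(\sqrt{\lambda_1/\gamma_1},\dots,\sqrt{\lambda_d/\gamma_d}\bigr)\prod_{i=1}^d\frac{t_i^{z_i+1/2}\lambda_i^{z_i-1/2}e^{-t_i\lambda_i}}{\Gamma(z_i+1/2)}\,\mathrm{d}\lambda .$$ *)

theory Defs
  imports "HOL-Probability.Probability"
begin

definition orthant :: "(real ^ 'n) set" where
  "orthant = {\<theta>. \<forall>i. 0 \<le> \<theta> $ i}"

definition pos_orthant :: "(real ^ 'n) set" where
  "pos_orthant = {l. \<forall>i. 0 < l $ i}"

definition poisson_prob :: "real ^ 'n \<Rightarrow> real ^ 'n \<Rightarrow> ('n::finite \<Rightarrow> nat) \<Rightarrow> real" where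
  "poisson_prob c l x = (\<Prod>i\<in>UNIV. (c $ i * l $ i) ^ x i * exp (- (c $ i * l $ i)) / fact (x i))"

definition jeffreys_prior :: "real ^ 'n::finite \<Rightarrow> ennreal" where
  "jeffreys_prior l = ennreal (\<Prod>i\<in>UNIV. (l $ i) powr (- 1 / 2))"

definition scaled_root :: "real ^ 'n \<Rightarrow> real ^ 'n \<Rightarrow> real ^ 'n::finite" where
  "scaled_root \<gamma> l = (\<chi> i. sqrt (l $ i / \<gamma> $ i))"

definition weighted_prior ::
    "(real ^ 'n \<Rightarrow> ennreal) \<Rightarrow> real ^ 'n \<Rightarrow> real ^ 'n::finite \<Rightarrow> ennreal" where
  "weighted_prior f \<gamma> l = f (scaled_root \<gamma> l) * jeffreys_prior l"

text \<open>Prior densities may be improper and are given up to a constant factor, which cancels in the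
  quotient. In \<open>predictive r s \<pi> y x\<close> the second outcome argument \<open>x\<close> is the observed one.\<close>

definition predictive ::
    "real ^ 'n \<Rightarrow> real ^ 'n \<Rightarrow> (real ^ 'n \<Rightarrow> ennreal) \<Rightarrow> ('n::finite \<Rightarrow> nat) \<Rightarrow> ('n \<Rightarrow> nat) \<Rightarrow> real" where
  "predictive r s \<pi> y x = enn2real
     ((\<integral>\<^sup>+ l\<in>pos_orthant. ennreal (poisson_prob r l x) * ennreal (poisson_prob s l y) * \<pi> l \<partial>lebesgue) /
      (\<integral>\<^sup>+ l\<in>pos_orthant. ennreal (poisson_prob r l x) * \<pi> l \<partial>lebesgue))"

text \<open>Sum of extended reals of either sign: the sum of the positive parts minus the sum of the
  negative parts. In the risk below the negative parts have a finite sum whenever \<open>q\<close> is a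
  probability distribution, so the risk is then a well-defined element of \<open>[0, \<infinity>]\<close>.\<close>

definition ext_sum :: "('a \<Rightarrow> ereal) \<Rightarrow> ereal" where
  "ext_sum g = enn2ereal (\<integral>\<^sup>+ a. e2ennreal (g a) \<partial>count_space UNIV)
             - enn2ereal (\<integral>\<^sup>+ a. e2ennreal (- g a) \<partial>count_space UNIV)"

definition kl_term :: "real \<Rightarrow> real \<Rightarrow> ereal" where
  "kl_term p q = (if p = 0 then 0 else if q = 0 then \<infinity> else ereal (p * ln (p / q)))"

definition kl_risk ::
    "real ^ 'n \<Rightarrow> real ^ 'n \<Rightarrow> (('n::finite \<Rightarrow> nat) \<Rightarrow> ('n \<Rightarrow> nat) \<Rightarrow> real) \<Rightarrow> real ^ 'n \<Rightarrow> ereal" where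
  "kl_risk r s q l =
     ext_sum (\<lambda>x. ereal (poisson_prob r l x) * ext_sum (\<lambda>y. kl_term (poisson_prob s l y) (q y x)))"

definition weakly_dominates ::
    "real ^ 'n \<Rightarrow> real ^ 'n \<Rightarrow> (('n::finite \<Rightarrow> nat) \<Rightarrow> ('n \<Rightarrow> nat) \<Rightarrow> real) \<Rightarrow>
     (('n \<Rightarrow> nat) \<Rightarrow> ('n \<Rightarrow> nat) \<Rightarrow> real) \<Rightarrow> bool" where
  "weakly_dominates r s q1 q2 \<longleftrightarrow> (\<forall>l\<in>pos_orthant. kl_risk r s q1 l \<le> kl_risk r s q2 l)"

definition dominates ::
    "real ^ 'n \<Rightarrow> real ^ 'n \<Rightarrow> (('n::finite \<Rightarrow> nat) \<Rightarrow> ('n \<Rightarrow> nat) \<Rightarrow> real) \<Rightarrow>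
     (('n \<Rightarrow> nat) \<Rightarrow> ('n \<Rightarrow> nat) \<Rightarrow> real) \<Rightarrow> bool" where
  "dominates r s q1 q2 \<longleftrightarrow>
     weakly_dominates r s q1 q2 \<and> (\<exists>l\<in>pos_orthant. kl_risk r s q1 l < kl_risk r s q2 l)"

definition gamma_mean ::
    "(real ^ 'n \<Rightarrow> ennreal) \<Rightarrow> real ^ 'n \<Rightarrow> ('n::finite \<Rightarrow> nat) \<Rightarrow> real ^ 'n \<Rightarrow> ennreal" where
  "gamma_mean f \<gamma> z t =
     (\<integral>\<^sup>+ l\<in>pos_orthant. f (scaled_root \<gamma> l) *
        ennreal (\<Prod>i\<in>UNIV. (t $ i) powr (real (z i) + 1 / 2) * (l $ i) powr (real (z i) - 1 / 2)
                   * exp (- (t $ i * l $ i)) / Gamma (real (z i) + 1 / 2)) \<partial>lebesgue)"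

text \<open>Meaningful only where \<open>gamma_mean\<close> is finite, as \<open>enn2real\<close> maps \<open>\<infinity>\<close> to 0.\<close>

definition star_condition :: "(real ^ 'n::finite \<Rightarrow> ennreal) \<Rightarrow> real ^ 'n \<Rightarrow> bool" where
  "star_condition f \<gamma> \<longleftrightarrow>
     (\<forall>z. \<forall>t\<in>pos_orthant.
        (let F = (\<lambda>z. enn2real (gamma_mean f \<gamma> z t)) in
          (\<Sum>i\<in>UNIV. \<gamma> $ i * t $ i * real (z i) *
             (F z - (if z i = 0 then 1 else F (z(i := z i - 1)))))
        + (\<Sum>i\<in>UNIV. \<gamma> $ i * t $ i * (real (z i) + 1 / 2) * (F z - F (z(i := z i + 1)))) \<ge> 0))"

text \<open>Partial derivatives on the closed orthant; one-sided where \<open>\<theta> $ i = 0\<close>.\<close>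

definition coord_line :: "(real ^ 'n \<Rightarrow> real) \<Rightarrow> 'n \<Rightarrow> real ^ 'n::finite \<Rightarrow> real \<Rightarrow> real" where
  "coord_line g i \<theta> u = g (\<chi> j. if j = i then u else \<theta> $ j)"

definition partial :: "'n \<Rightarrow> (real ^ 'n \<Rightarrow> real) \<Rightarrow> real ^ 'n::finite \<Rightarrow> real" where
  "partial i g \<theta> = vector_derivative (coord_line g i \<theta>) (at (\<theta> $ i) within {0..})"

definition C1_orthant :: "(real ^ 'n::finite \<Rightarrow> real) \<Rightarrow> bool" where
  "C1_orthant g \<longleftrightarrow> continuous_on orthant g \<and>
     (\<forall>i. (\<forall>\<theta>\<in>orthant. coord_line g i \<theta> differentiable (at (\<theta> $ i) within {0..})) \<and>
          continuous_on orthant (partial i g))"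

definition C2_orthant :: "(real ^ 'n::finite \<Rightarrow> real) \<Rightarrow> bool" where
  "C2_orthant g \<longleftrightarrow> C1_orthant g \<and> (\<forall>i. C1_orthant (partial i g))"

definition weighted_integrable :: "(real ^ 'n::finite \<Rightarrow> real) \<Rightarrow> bool" where
  "weighted_integrable h \<longleftrightarrow>
     (\<forall>z :: 'n \<Rightarrow> nat. \<forall>\<rho>>0.
        (\<integral>\<^sup>+ \<theta>\<in>orthant.
           ennreal (\<bar>h \<theta>\<bar> * (\<Prod>j\<in>UNIV. (\<theta> $ j) ^ (2 * z j) * exp (- \<rho> * (\<theta> $ j)\<^sup>2))) \<partial>lebesgue) < \<infinity>)"

end

theory Submission
  imports Defs
begin

text \<open>Up to the factor \<open>F(x + y, r + s) / F(x, r)\<close> the two predictive distributions agree, so the risk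
  difference is the increase of \<open>E ln F(z, t)\<close>, \<open>z\<close> Poisson with mean \<open>t \<lambda>\<close>, as \<open>t\<close> moves from \<open>r\<close> to
  \<open>r + s\<close>. Move along the curve on which \<open>1 / t\<^sub>i\<close> decreases linearly with slope \<open>\<gamma>\<^sub>i\<close>. Since
  \<open>t\<^sub>i \<partial>F/\<partial>t\<^sub>i = (z\<^sub>i + 1/2) (F(z) - F(z + \<delta>\<^sub>i))\<close> and Poisson variables satisfy
  \<open>E (t\<^sub>i \<lambda>\<^sub>i h(z)) = E (z\<^sub>i h(z - \<delta>\<^sub>i))\<close>, the bound \<open>ln a - ln b \<ge> (a - b) / a\<close> shows that the
  derivative is at least the expectation of the left-hand side of the condition divided by \<open>F\<close>.
  In the coordinates \<open>\<theta>\<close> the function \<open>F(z, t)\<close> is the integral of \<open>f\<close> against a product \<open>K\<^sub>z\<close>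
  of densities for which \<open>\<partial>\<^sub>i\<^sup>2 K\<^sub>z\<close> is the combination of \<open>K\<^sub>z\<close> and its neighbours occurring in the condition,
  and Green's identity moves the Laplacian to \<open>f\<close>.\<close>

text \<open>Differentiating E ln F under the sum over z needs a bound on the neighbour ratios F(z +
  delta_i, t) / F(z, t), uniform along the path. The available moment bounds would permit factorial
  growth. The condition itself provides the bound: every F is positive, so discarding the terms with
  F(z - delta_i, t) bounds the weighted ratios by an expression linear in z. The condition is thus
  used twice, for domination and for the sign. Everything else that is summed grows at most
  quadratically in z, which Poisson weights absorb. The slope gamma_i is the total drop of 1/t_i
  from r_i to r_i + s_i, so the path takes unit time. On it t_i has derivative gamma_i t_i^2: one
  factor t_i turns the partial derivative in t_i into the logarithmic one, and the other leaves the
  weight gamma_i t_i of the condition. Jeffreys' prior is the case f = 1, where F = 1 and the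
  increment vanishes, so one risk formula serves both predictive distributions. In the coordinates
  theta the Jacobian cancels the Jeffreys factor. Only even powers of theta_i then remain, which is
  why the normal derivative of the densities vanishes on the faces.\<close>

no_notation Infinite_Sum.abs_summable_on (infixr \<open>abs'_summable'_on\<close> 46)

section \<open>Differentiation under the integral sign, and sums of either sign\<close>

lemma has_real_derivative_lebesgue_integral:
  fixes h h' :: "real \<Rightarrow> 'a \<Rightarrow> real"
  assumes int: "\<And>u. u \<in> {a..b} \<Longrightarrow> integrable M (h u)"
    and deriv: "\<And>u x. u \<in> {a..b} \<Longrightarrow> x \<in> space M \<Longrightarrow>
      ((\<lambda>u. h u x) has_real_derivative h' u x) (at u within {a..b})"
    and meas: "\<And>u. u \<in> {a..b} \<Longrightarrow> h' u \<in> borel_measurable M"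
    and bound: "\<And>u x. u \<in> {a..b} \<Longrightarrow> x \<in> space M \<Longrightarrow> \<bar>h' u x\<bar> \<le> B x"
    and B: "integrable M B" and u: "u \<in> {a..b}"
  shows "((\<lambda>u. \<integral>x. h u x \<partial>M) has_real_derivative (\<integral>x. h' u x \<partial>M)) (at u within {a..b})"
  unfolding has_field_derivative_iff tendsto_at_iff_sequentially
proof (intro allI impI)
  fix X :: "nat \<Rightarrow> real"
  assume X: "\<forall>i. X i \<in> {a..b} - {u}" and lim: "X \<longlonglongrightarrow> u"
  have Xi: "X i \<in> {a..b}" "X i \<noteq> u" for i
    using X by auto
  have "(\<lambda>i. \<integral>x. (h (X i) x - h u x) / (X i - u) \<partial>M) \<longlonglongrightarrow> (\<integral>x. h' u x \<partial>M)"
  proof (rule integral_dominated_convergence[where w = B])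
    show "h' u \<in> borel_measurable M" using meas u by simp
    show "(\<lambda>x. (h (X i) x - h u x) / (X i - u)) \<in> borel_measurable M" for i
      using int[OF Xi(1)] int[OF u] by (intro borel_measurable_divide borel_measurable_diff) auto
    show "AE x in M. (\<lambda>i. (h (X i) x - h u x) / (X i - u)) \<longlonglongrightarrow> h' u x"
    proof (rule AE_I2)
      fix x assume "x \<in> space M"
      from deriv[OF u this] X lim show "(\<lambda>i. (h (X i) x - h u x) / (X i - u)) \<longlonglongrightarrow> h' u x"
        unfolding has_field_derivative_iff tendsto_at_iff_sequentially comp_def by blast
    qed
    \<comment> \<open>The mean value inequality turns the bound on the derivative into the same
      bound on every difference quotient, so one function dominates the whole sequence.\<close>
    show "AE x in M. norm ((h (X i) x - h u x) / (X i - u)) \<le> B x" for i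
    proof (rule AE_I2)
      fix x assume x: "x \<in> space M"
      have "norm (h (X i) x - h u x) \<le> B x * norm (X i - u)"
        by (rule field_differentiable_bound[where S = "{a..b}" and f' = "\<lambda>v. h' v x"])
          (use x deriv bound Xi u in auto)
      then show "norm ((h (X i) x - h u x) / (X i - u)) \<le> B x"
        using Xi(2)[of i] by (simp add: divide_le_eq)
    qed
  qed (use B in auto)
  moreover
  have "(\<integral>x. (h (X i) x - h u x) / (X i - u) \<partial>M) =
      ((\<integral>x. h (X i) x \<partial>M) - (\<integral>x. h u x \<partial>M)) / (X i - u)" for i
    by (simp add: Bochner_Integration.integral_diff[OF int[OF Xi(1)] int[OF u]])
  then have "(\<lambda>i. \<integral>x. (h (X i) x - h u x) / (X i - u) \<partial>M) =
      (\<lambda>i. ((\<integral>x. h (X i) x \<partial>M) - (\<integral>x. h u x \<partial>M)) / (X i - u))" by (rule ext)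
  ultimately show "((\<lambda>y. ((\<integral>x. h y x \<partial>M) - (\<integral>x. h u x \<partial>M)) / (y - u)) \<circ> X)
      \<longlonglongrightarrow> (\<integral>x. h' u x \<partial>M)"
    by (simp add: comp_def)
qed

text \<open>Absolute summability makes the sums of the positive and of the negative parts finite, so
  the extended difference is an ordinary one. This takes the risk from extended reals to real
  sums.\<close>

lemma ext_sum_ereal:
  assumes "h abs_summable_on UNIV"
  shows "ext_sum (\<lambda>a. ereal (h a)) = ereal (infsetsum h UNIV)"
proof -
  have i: "integrable (count_space UNIV) h"
    using assms by (simp add: abs_summable_on_def)
  have i': "integrable (count_space UNIV) (\<lambda>a. - h a)"
    using i by simp
  have fin: "(\<integral>\<^sup>+ a. ennreal (h a) \<partial>count_space UNIV) < \<infinity>"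
    "(\<integral>\<^sup>+ a. ennreal (- h a) \<partial>count_space UNIV) < \<infinity>"
    using integrableD(2)[OF i] integrableD(2)[OF i'] by (auto simp: top.not_eq_extremum)
  have fin': "(\<integral>\<^sup>+ a. ennreal (h a) \<partial>count_space UNIV) \<noteq> top"
    "(\<integral>\<^sup>+ a. ennreal (- h a) \<partial>count_space UNIV) \<noteq> top"
    using fin by auto
  have "infsetsum h UNIV = enn2real (\<integral>\<^sup>+ a. ennreal (h a) \<partial>count_space UNIV)
      - enn2real (\<integral>\<^sup>+ a. ennreal (- h a) \<partial>count_space UNIV)"
    unfolding infsetsum_def by (rule real_lebesgue_integral_def[OF i])
  moreover have e: "e2ennreal (ereal x) = ennreal x" for x
    by simp
  ultimately show ?thesis
    using fin' unfolding ext_sum_def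
    by (cases "\<integral>\<^sup>+ a. ennreal (h a) \<partial>count_space UNIV";
        cases "\<integral>\<^sup>+ a. ennreal (- h a) \<partial>count_space UNIV")
      (auto simp: e)
qed

section \<open>Exponentially bounded functions\<close>

text \<open>A growth class closed under sums, products and bounded index shifts, yet summable
  against Poisson weights. The size \<open>m\<close> is a parameter so that the class also covers
  pairs of outcomes and families indexed by a point of the path, where it expresses uniformity.
  Bases \<open>K\<close> below 1 are excluded so that the bound increases with
  \<open>m\<close>.\<close>

definition exp_bounded :: "('a \<Rightarrow> nat) \<Rightarrow> 'a set \<Rightarrow> ('a \<Rightarrow> real) \<Rightarrow> bool" where
  "exp_bounded m S h \<longleftrightarrow> (\<exists>C K. 0 \<le> C \<and> 1 \<le> K \<and> (\<forall>a\<in>S. \<bar>h a\<bar> \<le> C * K ^ m a))"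

lemma exp_boundedI:
  assumes "0 \<le> C" "1 \<le> K" "\<And>a. a \<in> S \<Longrightarrow> \<bar>h a\<bar> \<le> C * K ^ m a"
  shows "exp_bounded m S h"
  using assms unfolding exp_bounded_def by blast

lemma exp_bounded_mono:
  assumes "exp_bounded m S h'" "\<And>a. a \<in> S \<Longrightarrow> \<bar>h a\<bar> \<le> \<bar>h' a\<bar>"
  shows "exp_bounded m S h"
  using assms unfolding exp_bounded_def by (meson order_trans)

lemma exp_bounded_const: "exp_bounded m S (\<lambda>a. c)"
  by (rule exp_boundedI[of "\<bar>c\<bar>" 1]) auto

lemma exp_bounded_add:
  assumes "exp_bounded m S h" "exp_bounded m S h'"
  shows "exp_bounded m S (\<lambda>a. h a + h' a)"
proof -
  obtain C K where 1: "0 \<le> C" "1 \<le> K" "\<And>a. a \<in> S \<Longrightarrow> \<bar>h a\<bar> \<le> C * K ^ m a"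
    using assms(1) unfolding exp_bounded_def by blast
  obtain C' K' where 2: "0 \<le> C'" "1 \<le> K'" "\<And>a. a \<in> S \<Longrightarrow> \<bar>h' a\<bar> \<le> C' * K' ^ m a"
    using assms(2) unfolding exp_bounded_def by blast
  show ?thesis
  proof (rule exp_boundedI[of "C + C'" "max K K'"])
    fix a assume a: "a \<in> S"
    have "C * K ^ m a \<le> C * max K K' ^ m a" "C' * K' ^ m a \<le> C' * max K K' ^ m a"
      using 1 2 by (auto intro!: mult_left_mono power_mono)
    then show "\<bar>h a + h' a\<bar> \<le> (C + C') * max K K' ^ m a"
      using 1(3)[OF a] 2(3)[OF a] unfolding distrib_right by linarith
  qed (use 1 2 in auto)
qed

lemma exp_bounded_mult:
  assumes "exp_bounded m S h" "exp_bounded m S h'"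
  shows "exp_bounded m S (\<lambda>a. h a * h' a)"
proof -
  obtain C K where 1: "0 \<le> C" "1 \<le> K" "\<And>a. a \<in> S \<Longrightarrow> \<bar>h a\<bar> \<le> C * K ^ m a"
    using assms(1) unfolding exp_bounded_def by blast
  obtain C' K' where 2: "0 \<le> C'" "1 \<le> K'" "\<And>a. a \<in> S \<Longrightarrow> \<bar>h' a\<bar> \<le> C' * K' ^ m a"
    using assms(2) unfolding exp_bounded_def by blast
  show ?thesis
  proof (rule exp_boundedI[of "C * C'" "K * K'"])
    show "1 \<le> K * K'" using mult_mono[of 1 K 1 K'] 1 2 by simp
    fix a assume a: "a \<in> S"
    show "\<bar>h a * h' a\<bar> \<le> C * C' * (K * K') ^ m a"
      using mult_mono[OF 1(3)[OF a] 2(3)[OF a]] 1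
      by (simp add: abs_mult power_mult_distrib mult_ac)
  qed (use 1 2 in auto)
qed

lemma exp_bounded_minus: "exp_bounded m S h \<Longrightarrow> exp_bounded m S (\<lambda>a. - h a)"
  by (erule exp_bounded_mono) simp

lemma exp_bounded_diff:
  "exp_bounded m S h \<Longrightarrow> exp_bounded m S h' \<Longrightarrow> exp_bounded m S (\<lambda>a. h a - h' a)"
  using exp_bounded_add[OF _ exp_bounded_minus, of m S h h'] by simp

lemma exp_bounded_sum:
  "(\<And>i. i \<in> I \<Longrightarrow> exp_bounded m S (h i)) \<Longrightarrow> exp_bounded m S (\<lambda>a. \<Sum>i\<in>I. h i a)"
  by (induction I rule: infinite_finite_induct) (auto intro: exp_bounded_const exp_bounded_add)

lemma exp_bounded_of_nat:
  assumes "\<And>a. a \<in> S \<Longrightarrow> k a \<le> m a"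
  shows "exp_bounded m S (\<lambda>a. real (k a))"
proof (rule exp_boundedI[of 1 2])
  fix a assume "a \<in> S"
  have "real (k a) \<le> real (m a)" using assms \<open>a \<in> S\<close> by simp
  also have "\<dots> \<le> 2 ^ m a" by (rule of_nat_less_two_power[THEN less_imp_le])
  finally show "\<bar>real (k a)\<bar> \<le> 1 * 2 ^ m a" by simp
qed auto

text \<open>A size increase of at most \<open>c\<close> costs only the constant factor
  \<open>K ^ c\<close>. The typical substitutions are the shift by a unit vector, restriction to a
  slice and addition of two outcomes.\<close>

lemma exp_bounded_compose:
  assumes "exp_bounded m S h" "\<And>a. a \<in> S' \<Longrightarrow> f a \<in> S"
    and "\<And>a. a \<in> S' \<Longrightarrow> m (f a) \<le> m' a + c"
  shows "exp_bounded m' S' (\<lambda>a. h (f a))"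
proof -
  obtain C K where 1: "0 \<le> C" "1 \<le> K" "\<And>a. a \<in> S \<Longrightarrow> \<bar>h a\<bar> \<le> C * K ^ m a"
    using assms(1) unfolding exp_bounded_def by blast
  show ?thesis
  proof (rule exp_boundedI[of "C * K ^ c" K])
    fix a assume a: "a \<in> S'"
    have "\<bar>h (f a)\<bar> \<le> C * K ^ m (f a)" using 1 assms(2) a by blast
    also have "\<dots> \<le> C * K ^ (m' a + c)"
      using 1 assms(3)[OF a] by (intro mult_left_mono power_increasing) auto
    finally show "\<bar>h (f a)\<bar> \<le> C * K ^ c * K ^ m' a" by (simp add: power_add mult_ac)
  qed (use 1 in auto)
qed

text \<open>By the recurrence of Gamma, one step from n to n + 1 adds ln (n + 1/2), of modulus at
  most n + 1; hence quadratic growth. Absolute values are needed because Gamma drops below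
  1.\<close>

lemma exp_bounded_ln_Gamma:
  assumes "\<And>a. a \<in> S \<Longrightarrow> k a \<le> m a"
  shows "exp_bounded m S (\<lambda>a. ln (Gamma (real (k a) + 1 / 2)))"
proof -
  have *: "\<bar>ln (Gamma (real n + 1 / 2))\<bar> \<le> \<bar>ln (Gamma (1 / 2))\<bar> + real n * (real n + 1)" for n :: nat
  proof (induction n)
    case (Suc n)
    have G: "Gamma (real (Suc n) + 1 / 2) = (real n + 1 / 2) * Gamma (real n + 1 / 2)"
      using Gamma_plus1[of "real n + 1 / 2"] by (auto simp: add_ac nonpos_Ints_def field_simps)
    have L: "ln (Gamma (real (Suc n) + 1 / 2)) = ln (real n + 1 / 2) + ln (Gamma (real n + 1 / 2))"
      unfolding G by (rule ln_mult_pos) (auto intro: Gamma_real_pos)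
    have "ln (real n + 1 / 2) \<le> real n + 1 / 2 - 1" by (rule ln_le_minus_one) simp
    moreover have "- ln (real n + 1 / 2) \<le> 1"
    proof -
      have "- ln (real n + 1 / 2) = ln (1 / (real n + 1 / 2))" by (simp add: ln_div)
      also have "\<dots> \<le> 1 / (real n + 1 / 2) - 1" by (rule ln_le_minus_one) simp
      also have "\<dots> \<le> 1" by (simp add: divide_le_eq)
      finally show ?thesis .
    qed
    ultimately have "\<bar>ln (real n + 1 / 2)\<bar> \<le> real n + 1" by linarith
    then have "\<bar>ln (Gamma (real (Suc n) + 1 / 2))\<bar>
        \<le> real n + 1 + (\<bar>ln (Gamma (1 / 2))\<bar> + real n * (real n + 1))"
      unfolding L using Suc by linarith
    also have "\<dots> \<le> \<bar>ln (Gamma (1 / 2))\<bar> + real (Suc n) * (real (Suc n) + 1)"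
      by (simp add: algebra_simps)
    finally show ?case .
  qed auto
  have "exp_bounded m S (\<lambda>a. \<bar>ln (Gamma (1 / 2))\<bar> + real (k a) * (real (k a) + 1))"
    by (intro exp_bounded_add exp_bounded_mult exp_bounded_const exp_bounded_of_nat assms)
  then show ?thesis by (rule exp_bounded_mono) (use * in auto)
qed

section \<open>Sums over multi-indices against Poisson weights\<close>

definition total_count :: "('n::finite \<Rightarrow> nat) \<Rightarrow> nat" where
  "total_count z = (\<Sum>i\<in>UNIV. z i)"

lemma le_total: "z i \<le> total_count z"
  unfolding total_count_def by (rule member_le_sum) auto

lemma total_upd: "total_count (z(i := k)) + z i = total_count z + k"
proof -
  have "total_count z = z i + sum z (UNIV - {i})" "total_count (z(i := k)) = k + sum (z(i := k)) (UNIV - {i})"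
    unfolding total_count_def by (simp_all add: sum.remove[of _ i])
  moreover have "sum (z(i := k)) (UNIV - {i}) = sum z (UNIV - {i})"
    by (rule sum.cong) auto
  ultimately show ?thesis by simp
qed

lemma abs_summable_prod_exp_series:
  "(\<lambda>z :: 'n::finite \<Rightarrow> nat. \<Prod>i\<in>UNIV. a i ^ z i / fact (z i) :: real) abs_summable_on UNIV"
proof -
  have "(\<lambda>z :: 'n \<Rightarrow> nat. \<Prod>i\<in>UNIV. a i ^ z i / fact (z i) :: real) abs_summable_on PiE UNIV (\<lambda>_. UNIV)"
  proof (rule abs_summable_on_prod_PiE)
    fix i
    show "(\<lambda>n. a i ^ n / fact n) abs_summable_on UNIV"
      using summable_norm_exp[of "a i"] by (simp add: abs_summable_on_nat_iff' divide_inverse mult.commute)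
  qed auto
  then show ?thesis by (simp add: PiE_UNIV_domain)
qed

lemma poisson_prob_alt:
  "poisson_prob c l z = exp (- (\<Sum>i\<in>UNIV. c $ i * l $ i)) * (\<Prod>i\<in>UNIV. (c $ i * l $ i) ^ z i / fact (z i))"
proof -
  have "poisson_prob c l z
      = (\<Prod>i\<in>UNIV. exp (- (c $ i * l $ i)) * ((c $ i * l $ i) ^ z i / fact (z i)))"
    unfolding poisson_prob_def by (intro prod.cong) auto
  also have "\<dots> = (\<Prod>i\<in>UNIV. exp (- (c $ i * l $ i))) * (\<Prod>i\<in>UNIV. (c $ i * l $ i) ^ z i / fact (z i))"
    by (rule prod.distrib)
  finally show ?thesis by (simp add: exp_sum[symmetric] sum_negf)
qed

lemma poisson_prob_pos: "(\<And>i. 0 < c $ i) \<Longrightarrow> l \<in> pos_orthant \<Longrightarrow> 0 < poisson_prob c l z"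
  unfolding poisson_prob_def pos_orthant_def by (intro prod_pos) auto

lemma poisson_prob_nonneg: "(\<And>i. 0 < c $ i) \<Longrightarrow> l \<in> pos_orthant \<Longrightarrow> 0 \<le> poisson_prob c l z"
  using poisson_prob_pos less_imp_le by blast

lemma power_total: "K ^ total_count z = (\<Prod>i\<in>UNIV. K ^ z i)"
  unfolding total_count_def by (simp add: power_sum)

text \<open>The factor \<open>K ^ total_count z\<close> splits over the coordinates and merely
  rescales each \<open>a i\<close> to \<open>K * a i\<close>, which gives an exponential series
  again.\<close>

lemma abs_summable_exp_series_exp_bounded:
  fixes h :: "('n::finite \<Rightarrow> nat) \<Rightarrow> real"
  assumes "exp_bounded total_count UNIV h"
  shows "(\<lambda>z. (\<Prod>i\<in>UNIV. a i ^ z i / fact (z i)) * h z) abs_summable_on UNIV"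
proof -
  obtain C K where K: "0 \<le> C" "1 \<le> K" "\<And>z. \<bar>h z\<bar> \<le> C * K ^ total_count z"
    using assms unfolding exp_bounded_def by auto
  have "(\<lambda>z. C * (\<Prod>i\<in>UNIV. (K * a i) ^ z i / fact (z i))) abs_summable_on UNIV"
    by (intro abs_summable_on_cmult_right abs_summable_prod_exp_series)
  then show ?thesis
  proof (rule abs_summable_on_comparison_test)
    fix z :: "'n \<Rightarrow> nat"
    have "norm ((\<Prod>i\<in>UNIV. a i ^ z i / fact (z i)) * h z)
        \<le> \<bar>\<Prod>i\<in>UNIV. a i ^ z i / fact (z i)\<bar> * (C * K ^ total_count z)"
      using K(3) by (simp add: abs_mult mult_left_mono)
    also have "\<dots> = norm (C * (\<Prod>i\<in>UNIV. (K * a i) ^ z i / fact (z i)))"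
      using K(1,2) unfolding power_total
      by (simp add: abs_mult abs_prod prod.distrib[symmetric] power_mult_distrib mult_ac prod_dividef)
    finally show "norm ((\<Prod>i\<in>UNIV. a i ^ z i / fact (z i)) * h z)
      \<le> norm (C * (\<Prod>i\<in>UNIV. (K * a i) ^ z i / fact (z i)))" .
  qed
qed

lemma poisson_abs_summable:
  assumes "exp_bounded total_count UNIV h"
  shows "(\<lambda>z. poisson_prob c l z * h z) abs_summable_on UNIV"
  unfolding poisson_prob_alt mult.assoc
  by (intro abs_summable_on_cmult_right abs_summable_exp_series_exp_bounded assms)

lemma poisson_sum_1:
  "(\<lambda>z. poisson_prob c l z) abs_summable_on UNIV" "infsetsum (poisson_prob c l) UNIV = 1"
proof -
  show "(\<lambda>z. poisson_prob c l z) abs_summable_on UNIV"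
    using poisson_abs_summable[OF exp_bounded_const[of _ _ 1]] by simp
  have s: "(\<lambda>n. a ^ n / fact n) abs_summable_on UNIV" for a :: real
    using summable_norm_exp[of a] by (simp add: abs_summable_on_nat_iff' divide_inverse mult.commute)
  have e: "infsetsum (\<lambda>n. a ^ n / fact n) UNIV = exp a" for a :: real
    using infsetsum_nat'[OF s] by (simp add: exp_def divide_inverse mult.commute)
  have "infsetsum (\<lambda>z. \<Prod>i\<in>UNIV. (c $ i * l $ i) ^ z i / fact (z i)) (PiE UNIV (\<lambda>_. UNIV))
      = (\<Prod>i\<in>UNIV. exp (c $ i * l $ i))"
    by (subst infsetsum_prod_PiE) (use s e in auto)
  then show "infsetsum (poisson_prob c l) UNIV = 1"
    unfolding poisson_prob_alt[abs_def]
    by (subst infsetsum_cmult_right)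
      (use abs_summable_prod_exp_series in \<open>auto simp: PiE_UNIV_domain exp_sum[symmetric] exp_add[symmetric]\<close>)
qed

text \<open>The Chen-Stein identity in one coordinate: z_i times the weight at z equals the mean
  times the weight at z - delta_i, and reindexing by the shift moves it onto
  \<open>h\<close>.\<close>

lemma poisson_shift:
  fixes h :: "('n::finite \<Rightarrow> nat) \<Rightarrow> real"
  assumes h: "exp_bounded total_count UNIV h"
  shows "infsetsum (\<lambda>z. poisson_prob c l z * (real (z i) * h z)) UNIV
    = c $ i * l $ i * infsetsum (\<lambda>z. poisson_prob c l z * h (z(i := z i + 1))) UNIV"
proof -
  let ?s = "\<lambda>z :: 'n \<Rightarrow> nat. z(i := z i + 1)"
  have inj: "inj ?s"
    by (rule inj_on_inverseI[where g = "\<lambda>z. z(i := z i - 1)"]) auto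
  have img: "range ?s = {z. 0 < z i}"
  proof safe
    fix z :: "'n \<Rightarrow> nat" assume "0 < z i"
    then have "z = ?s (z(i := z i - 1))" by auto
    then show "z \<in> range ?s" by blast
  qed auto
  have p: "poisson_prob c l (?s z) * real (?s z i) = c $ i * l $ i * poisson_prob c l z" for z
  proof -
    define k where "k = (\<lambda>j n. (c $ j * l $ j) ^ n * exp (- (c $ j * l $ j)) / fact n)"
    have "poisson_prob c l z = k i (z i) * (\<Prod>j\<in>UNIV - {i}. k j (z j))"
      unfolding poisson_prob_def k_def by (rule prod.remove) auto
    moreover have "poisson_prob c l (?s z) = k i (z i + 1) * (\<Prod>j\<in>UNIV - {i}. k j (z j))"
      unfolding poisson_prob_def k_def by (subst prod.remove[of _ i]) auto
    moreover have "k i (z i + 1) * real (z i + 1) = c $ i * l $ i * k i (z i)"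
    proof -
      have "(a :: real) / (x * y) * x = a / y" if "x \<noteq> 0" for a x y using that by simp
      note * = this[of "real (z i + 1)" _ "fact (z i)"]
      show ?thesis unfolding k_def by (simp only: Suc_eq_plus1[symmetric] fact_Suc of_nat_mult)
          (simp add: * mult_ac del: of_nat_Suc)
    qed
    ultimately have "poisson_prob c l (?s z) * real (?s z i)
        = (k i (z i + 1) * real (z i + 1)) * (\<Prod>j\<in>UNIV - {i}. k j (z j))"
      and "poisson_prob c l z = k i (z i) * (\<Prod>j\<in>UNIV - {i}. k j (z j))"
      and "k i (z i + 1) * real (z i + 1) = c $ i * l $ i * k i (z i)"
      by simp_all
    then show ?thesis by (simp only: mult.assoc)
  qed
  \<comment> \<open>Outside the range of the shift \<open>z i\<close> is 0, and the summand
    vanishes.\<close>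
  have "infsetsum (\<lambda>z. poisson_prob c l z * (real (z i) * h z)) UNIV
      = infsetsum (\<lambda>z. poisson_prob c l z * (real (z i) * h z)) (range ?s)"
    by (rule infsetsum_cong_neutral) (auto simp: img[simplified])
  also have "\<dots> = infsetsum (\<lambda>z. poisson_prob c l (?s z) * (real (?s z i) * h (?s z))) UNIV"
    by (rule infsetsum_reindex[OF inj])
  also have "\<dots> = infsetsum (\<lambda>z. c $ i * l $ i * (poisson_prob c l z * h (?s z))) UNIV"
    by (rule infsetsum_cong) (auto simp only: p mult.assoc[symmetric])
  also have "\<dots> = c $ i * l $ i * infsetsum (\<lambda>z. poisson_prob c l z * h (z(i := z i + 1))) UNIV"
  proof (rule infsetsum_cmult_right)
    have "exp_bounded total_count UNIV (\<lambda>z. h (?s z))"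
      by (rule exp_bounded_compose[OF h, where c = 1]) (use total_upd[of _ i] in \<open>auto, metis Suc_leI add_Suc_right add_left_cancel lessI less_or_eq_imp_le add.commute\<close>)
    then show "(\<lambda>z. poisson_prob c l z * h (?s z)) abs_summable_on UNIV"
      by (rule poisson_abs_summable)
  qed
  finally show ?thesis .
qed

definition total_count2 :: "('n::finite \<Rightarrow> nat) \<times> ('n \<Rightarrow> nat) \<Rightarrow> nat" where
  "total_count2 p = total_count (fst p) + total_count (snd p)"

text \<open>Since \<open>total_count2\<close> is additive, the bound factors into a function of x
  and a function of y, and the double sum is dominated by a product of two single sums.\<close>

lemma poisson_pair_abs_summable:
  fixes h :: "('n::finite \<Rightarrow> nat) \<times> ('n \<Rightarrow> nat) \<Rightarrow> real"
  assumes "exp_bounded total_count2 UNIV h"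
  shows "(\<lambda>(x, y). poisson_prob r l x * (poisson_prob s l y * h (x, y))) abs_summable_on (UNIV \<times> UNIV)"
proof -
  obtain C K where K: "0 \<le> C" "1 \<le> K" "\<And>p. \<bar>h p\<bar> \<le> C * K ^ total_count2 p"
    using assms unfolding exp_bounded_def by auto
  have eb: "exp_bounded total_count UNIV (\<lambda>z :: 'n \<Rightarrow> nat. K ^ total_count z)"
    by (rule exp_boundedI[of 1 K]) (use K in auto)
  define A where "A = (\<lambda>c (z :: 'n \<Rightarrow> nat). poisson_prob c l z * K ^ total_count z)"
  have A: "A c abs_summable_on UNIV" for c
    unfolding A_def by (rule poisson_abs_summable[OF eb])
  have "(\<lambda>(x, y). A r x * A s y) abs_summable_on (UNIV \<times> UNIV)"
  proof (subst abs_summable_on_Sigma_iff, goal_cases)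
    case 3
    have n: "(\<lambda>y. norm (A c y)) abs_summable_on UNIV" for c
      using A by (rule abs_summable_on_normI)
    have "infsetsum (\<lambda>y. norm (A r x * A s y)) UNIV = norm (A r x) * infsetsum (\<lambda>y. norm (A s y)) UNIV" for x
      unfolding norm_mult by (rule infsetsum_cmult_right) (rule n)
    then show ?case
      using A n by (auto intro!: abs_summable_on_cmult_left abs_summable_on_cmult_right simp del: real_norm_def)
  qed auto
  then have "(\<lambda>p. C * (\<lambda>(x, y). A r x * A s y) p) abs_summable_on (UNIV \<times> UNIV)"
    by (rule abs_summable_on_cmult_right)
  then show ?thesis
  proof (rule abs_summable_on_comparison_test)
    fix p :: "('n \<Rightarrow> nat) \<times> ('n \<Rightarrow> nat)"
    obtain x y where p: "p = (x, y)" by force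
    have "norm (poisson_prob r l x * (poisson_prob s l y * h (x, y)))
      \<le> \<bar>poisson_prob r l x\<bar> * (\<bar>poisson_prob s l y\<bar> * (C * K ^ total_count2 (x, y)))"
      using K(3) by (simp add: abs_mult mult_left_mono)
    also have "\<dots> = norm (C * (A r x * A s y))"
      using K unfolding A_def total_count2_def by (simp add: abs_mult power_add mult_ac)
    finally show "norm (case p of (x, y) \<Rightarrow> poisson_prob r l x * (poisson_prob s l y * h (x, y)))
      \<le> norm (C * (case p of (x, y) \<Rightarrow> A r x * A s y))" by (simp add: p)
  qed
qed

text \<open>The sum of independent Poisson vectors is Poisson with added rates. Pairs are grouped by
  z = x + y; each group is a finite box of values x, over which the sum factors into one binomial
  expansion per coordinate.\<close>

lemma poisson_convolution:
  fixes h :: "('n::finite \<Rightarrow> nat) \<Rightarrow> real"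
  assumes h: "exp_bounded total_count UNIV h"
  shows "infsetsum (\<lambda>(x, y). poisson_prob r l x * (poisson_prob s l y * h (\<lambda>i. x i + y i))) (UNIV \<times> UNIV)
    = infsetsum (\<lambda>z. poisson_prob (r + s) l z * h z) UNIV"
proof -
  define S where "S = (SIGMA z : (UNIV :: ('n \<Rightarrow> nat) set). {x. \<forall>i. x i \<le> z i})"
  \<comment> \<open>The truncated difference is a true one on \<open>S\<close>, where x is at most z
    in each coordinate.\<close>
  define T where "T = (\<lambda>(z :: 'n \<Rightarrow> nat, x :: 'n \<Rightarrow> nat). (x, \<lambda>i. z i - x i))"
  define f where "f = (\<lambda>(x, y). poisson_prob r l x * (poisson_prob s l y * h (\<lambda>i. x i + y i)))"
  have h2: "exp_bounded total_count2 UNIV (\<lambda>p. h (\<lambda>i. fst p i + snd p i))"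
    by (rule exp_bounded_compose[OF h, where c = 0]) (auto simp: total_count2_def total_count_def sum.distrib)
  have f: "f abs_summable_on (UNIV \<times> UNIV)"
    unfolding f_def using poisson_pair_abs_summable[OF h2, of r l s] by simp
  have bij: "bij_betw T S (UNIV \<times> UNIV)"
    by (rule bij_betw_byWitness[where f' = "\<lambda>(x, y). (\<lambda>i. x i + y i, x)"]) (auto simp: S_def T_def)
  have fin: "finite {x. \<forall>i. x i \<le> z i}" and PiE: "{x. \<forall>i. x i \<le> z i} = PiE UNIV (\<lambda>i. {..z i})"
    for z :: "'n \<Rightarrow> nat"
  proof -
    show "{x. \<forall>i. x i \<le> z i} = PiE UNIV (\<lambda>i. {..z i})" by (auto simp: PiE_UNIV_domain)
    then show "finite {x. \<forall>i. x i \<le> z i}" by (simp add: finite_PiE)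
  qed
  have conv: "(\<Sum>x\<in>{x. \<forall>i. x i \<le> z i}. poisson_prob r l x * poisson_prob s l (\<lambda>i. z i - x i))
      = poisson_prob (r + s) l z" for z
  proof -
    define k where "k = (\<lambda>a n. a ^ n * exp (- a) / fact n :: real)"
    have "(\<Sum>x\<in>{x. \<forall>i. x i \<le> z i}. poisson_prob r l x * poisson_prob s l (\<lambda>i. z i - x i))
      = (\<Sum>x\<in>PiE UNIV (\<lambda>i. {..z i}). \<Prod>i\<in>UNIV. k (r $ i * l $ i) (x i) * k (s $ i * l $ i) (z i - x i))"
      unfolding PiE poisson_prob_def k_def prod.distrib ..
    also have "\<dots> = (\<Prod>i\<in>UNIV. \<Sum>j\<le>z i. k (r $ i * l $ i) j * k (s $ i * l $ i) (z i - j))"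
      by (subst prod_sum_PiE) auto
    also have "\<dots> = (\<Prod>i\<in>UNIV. k ((r + s) $ i * l $ i) (z i))"
    proof (rule prod.cong)
      fix i :: 'n
      let ?a = "r $ i * l $ i" and ?b = "s $ i * l $ i" and ?n = "z i"
      have "(\<Sum>j\<le>?n. k ?a j * k ?b (?n - j))
        = (\<Sum>j\<le>?n. exp (- (?a + ?b)) / fact ?n * (of_nat (?n choose j) * ?a ^ j * ?b ^ (?n - j)))"
      proof (rule sum.cong)
        fix j assume "j \<in> {..?n}"
        then have "of_nat (?n choose j) = (fact ?n / (fact j * fact (?n - j)) :: real)"
          by (intro binomial_fact) auto
        moreover have "exp (- (?a + ?b)) = exp (- ?a) * exp (- ?b)"
          by (simp add: exp_add[symmetric])
        ultimately show "k ?a j * k ?b (?n - j)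
            = exp (- (?a + ?b)) / fact ?n * (of_nat (?n choose j) * ?a ^ j * ?b ^ (?n - j))"
          unfolding k_def by (simp only:) simp
      qed auto
      also have "\<dots> = k (?a + ?b) ?n"
        unfolding k_def sum_distrib_left[symmetric] by (simp add: binomial_ring mult.commute)
      finally show "(\<Sum>j\<le>?n. k ?a j * k ?b (?n - j)) = k ((r + s) $ i * l $ i) ?n"
        by (simp add: distrib_right)
    qed auto
    finally show ?thesis unfolding poisson_prob_def k_def .
  qed
  have fT: "(\<lambda>p. f (T p)) abs_summable_on S"
    using f by (simp add: abs_summable_on_reindex_bij_betw[OF bij])
  have "infsetsum f (UNIV \<times> UNIV) = infsetsum (\<lambda>p. f (T p)) S"
    by (rule infsetsum_reindex_bij_betw[OF bij, symmetric])
  also have "\<dots> = infsetsum (\<lambda>z. infsetsum (\<lambda>x. f (T (z, x))) {x. \<forall>i. x i \<le> z i}) UNIV"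
    unfolding S_def by (rule infsetsum_Sigma) (use fT in \<open>auto simp: S_def\<close>)
  also have "\<dots> = infsetsum (\<lambda>z. poisson_prob (r + s) l z * h z) UNIV"
  proof (rule infsetsum_cong)
    fix z :: "'n \<Rightarrow> nat"
    have "infsetsum (\<lambda>x. f (T (z, x))) {x. \<forall>i. x i \<le> z i}
      = (\<Sum>x\<in>{x. \<forall>i. x i \<le> z i}. poisson_prob r l x * poisson_prob s l (\<lambda>i. z i - x i) * h z)"
      unfolding infsetsum_finite[OF fin] by (intro sum.cong) (auto simp: f_def T_def)
    also have "\<dots> = poisson_prob (r + s) l z * h z"
      using conv[of z] by (simp add: sum_distrib_right[symmetric])
    finally show "infsetsum (\<lambda>x. f (T (z, x))) {x. \<forall>i. x i \<le> z i} = poisson_prob (r + s) l z * h z" .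
  qed auto
  finally show ?thesis unfolding f_def .
qed

section \<open>Gamma moments of a weight measure\<close>

text \<open>The gamma density without its normalisation and without the factor l_i to the power
  -1/2, which is counted with the prior. Extension by 0 keeps it nonnegative and Borel on the whole
  space.\<close>

definition kern :: "('n \<Rightarrow> nat) \<Rightarrow> real ^ 'n \<Rightarrow> real ^ 'n::finite \<Rightarrow> real" where
  "kern z t l = (if l \<in> pos_orthant then (\<Prod>i\<in>UNIV. (l $ i) ^ z i) * exp (- (\<Sum>i\<in>UNIV. t $ i * l $ i)) else 0)"

lemma open_pos_orthant: "open (pos_orthant :: (real ^ 'n::finite) set)"
proof -
  have "(pos_orthant :: (real ^ 'n) set) = (\<Inter>i\<in>UNIV. {l. 0 < l $ i})"
    by (auto simp: pos_orthant_def)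
  moreover have "open (\<Inter>i\<in>UNIV. {l :: real ^ 'n. 0 < l $ i})"
    by (intro open_INT ballI finite open_Collect_less continuous_intros)
  ultimately show ?thesis by (simp only:)
qed

lemma pos_orthant_borel [measurable]: "pos_orthant \<in> sets borel"
  by (rule borel_open) (rule open_pos_orthant)

lemma kern_borel [measurable]: "kern z t \<in> borel_measurable borel"
  unfolding kern_def by measurable

lemma kern_nonneg: "0 \<le> kern z t l"
  unfolding kern_def pos_orthant_def by (auto intro!: mult_nonneg_nonneg prod_nonneg simp: less_imp_le)

lemma kern_pos: "l \<in> pos_orthant \<Longrightarrow> 0 < kern z t l"
  unfolding kern_def pos_orthant_def by (auto intro!: mult_pos_pos prod_pos)

lemma kern_antimono:
  assumes "\<And>i. t $ i \<le> t' $ i"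
  shows "kern z t' l \<le> kern z t l"
  unfolding kern_def pos_orthant_def
  by (auto intro!: mult_left_mono prod_nonneg sum_mono mult_right_mono assms simp: less_imp_le)

lemma kern_upd: "kern (z(i := z i + 1)) t l = l $ i * kern z t l"
proof -
  have "(\<Prod>j\<in>UNIV. (l $ j) ^ (z(i := z i + 1)) j) = l $ i * (\<Prod>j\<in>UNIV. (l $ j) ^ z j)"
    by (simp add: prod.remove[of _ i])
  then show ?thesis by (simp add: kern_def)
qed

text \<open>Normalising constant of the product of gamma densities with shapes z_i + 1/2 and rates
  t_i.\<close>

definition gamma_norm :: "('n \<Rightarrow> nat) \<Rightarrow> real ^ 'n::finite \<Rightarrow> real" where
  "gamma_norm z t = (\<Prod>i\<in>UNIV. t $ i powr (real (z i) + 1 / 2) / Gamma (real (z i) + 1 / 2))"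

lemma gamma_norm_pos: "t \<in> pos_orthant \<Longrightarrow> 0 < gamma_norm z t"
  unfolding gamma_norm_def pos_orthant_def
  by (intro prod_pos ballI divide_pos_pos Gamma_real_pos) (auto simp: less_imp_neq[symmetric])

lemma ln_gamma_norm:
  assumes "t \<in> pos_orthant"
  shows "ln (gamma_norm z t) = (\<Sum>i\<in>UNIV. (real (z i) + 1 / 2) * ln (t $ i) - ln (Gamma (real (z i) + 1 / 2)))"
proof -
  have t: "0 < t $ i" for i using assms by (simp add: pos_orthant_def)
  have G: "0 < Gamma (real (z i) + 1 / 2)" for i by (intro Gamma_real_pos) auto
  have p: "0 < t $ i powr (real (z i) + 1 / 2) / Gamma (real (z i) + 1 / 2)" for i
    using t[of i] G[of i] by simp
  have "ln (gamma_norm z t) = (\<Sum>i\<in>UNIV. ln (t $ i powr (real (z i) + 1 / 2) / Gamma (real (z i) + 1 / 2)))"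
    unfolding gamma_norm_def by (rule ln_prod[OF finite]) (metis less_irrefl p)
  also have "\<dots> = (\<Sum>i\<in>UNIV. (real (z i) + 1 / 2) * ln (t $ i) - ln (Gamma (real (z i) + 1 / 2)))"
  proof (rule sum.cong)
    fix i
    show "ln (t $ i powr (real (z i) + 1 / 2) / Gamma (real (z i) + 1 / 2))
      = (real (z i) + 1 / 2) * ln (t $ i) - ln (Gamma (real (z i) + 1 / 2))"
      using t[of i] G[of i] by (subst ln_divide_pos) (auto simp: ln_powr)
  qed simp
  finally show ?thesis .
qed

text \<open>The recurrence of Gamma is the source of the weight z_i + 1/2 in the condition:
  multiplied by it, the normalisation at z + delta_i becomes t_i times the one at z.\<close>

lemma gamma_norm_Suc:
  assumes t: "t \<in> pos_orthant"
  shows "(real (z i) + 1 / 2) * gamma_norm (z(i := z i + 1)) t = t $ i * gamma_norm z t"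
proof -
  let ?c = "\<lambda>j n. t $ j powr (real n + 1 / 2) / Gamma (real n + 1 / 2)"
  have ti: "0 < t $ i" using t by (simp add: pos_orthant_def)
  have 1: "gamma_norm z t = ?c i (z i) * (\<Prod>j\<in>UNIV - {i}. ?c j (z j))"
    unfolding gamma_norm_def by (subst prod.remove[of _ i]) auto
  have 2: "gamma_norm (z(i := z i + 1)) t = ?c i (z i + 1) * (\<Prod>j\<in>UNIV - {i}. ?c j (z j))"
    unfolding gamma_norm_def by (subst prod.remove[of _ i]) auto
  have "Gamma (real (z i + 1) + 1 / 2) = (real (z i) + 1 / 2) * Gamma (real (z i) + 1 / 2)"
    using Gamma_plus1[of "real (z i) + 1 / 2"] by (auto simp: add_ac nonpos_Ints_def field_simps)
  moreover have "t $ i powr (real (z i + 1) + 1 / 2) = t $ i * t $ i powr (real (z i) + 1 / 2)"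
    using ti powr_add[of "t $ i" 1 "real (z i) + 1 / 2"] by (simp add: add_ac)
  moreover have "(k :: real) * (a * p / (k * g)) = a * (p / g)" if "k \<noteq> 0" for k a p g using that by simp
  ultimately have "(real (z i) + 1 / 2) * ?c i (z i + 1) = t $ i * ?c i (z i)"
    by (simp only:)
  then show ?thesis unfolding 1 2 by (simp only: mult.assoc[symmetric])
qed

text \<open>Only the positive moments of the prior matter for the path argument, so the prior is an
  abstract measure \<open>\<nu>\<close>. The locale is instantiated twice, with the weight f and
  with the weight 1. Nonzero mass on the positive orthant makes every moment positive, hence its
  logarithm meaningful.\<close>

locale poisson_path =
  fixes r s \<gamma> :: "real ^ 'n::finite" and \<nu> :: "(real ^ 'n) measure"
  assumes r_pos: "\<And>i. 0 < r $ i" and s_pos: "\<And>i. 0 < s $ i"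
    and gamma: "\<And>i. \<gamma> $ i = 1 / r $ i - 1 / (r $ i + s $ i)"
    and sets_nu [measurable_cong]: "sets \<nu> = sets borel"
    and AE_pos: "AE l in \<nu>. l \<in> pos_orthant"
    and nonzero: "emeasure \<nu> UNIV \<noteq> 0"
    and integrable_kern: "\<And>z t. t \<in> pos_orthant \<Longrightarrow> integrable \<nu> (kern z t)"
begin

definition moment :: "('n \<Rightarrow> nat) \<Rightarrow> real ^ 'n \<Rightarrow> real" where
  "moment z t = (\<integral>l. kern z t l \<partial>\<nu>)"

definition F :: "('n \<Rightarrow> nat) \<Rightarrow> real ^ 'n \<Rightarrow> real" where
  "F z t = gamma_norm z t * moment z t"

lemma space_nu: "space \<nu> = UNIV"
  using sets_eq_imp_space_eq[OF sets_nu] by simp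

lemma r_in: "r \<in> pos_orthant" and rs_in: "r + s \<in> pos_orthant"
  using r_pos s_pos by (auto simp: pos_orthant_def intro: add_pos_pos)

lemma gamma_pos: "0 < \<gamma> $ i"
  unfolding gamma using r_pos[of i] s_pos[of i] by (simp add: frac_less2)

lemma moment_pos:
  assumes "t \<in> pos_orthant"
  shows "0 < moment z t"
proof -
  have "moment z t \<noteq> 0"
  proof
    assume "moment z t = 0"
    then have "AE l in \<nu>. kern z t l = 0"
      unfolding moment_def
      by (subst (asm) integral_nonneg_eq_0_iff_AE) (auto simp: integrable_kern[OF assms] kern_nonneg)
    with AE_pos have "AE l in \<nu>. False"
      by eventually_elim (use kern_pos in \<open>metis less_irrefl\<close>)
    then have "emeasure \<nu> (space \<nu>) = 0" by (simp add: AE_iff_measurable[OF _ refl])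
    then show False using nonzero space_nu by simp
  qed
  moreover have "0 \<le> moment z t"
    unfolding moment_def by (rule Bochner_Integration.integral_nonneg) (rule kern_nonneg)
  ultimately show ?thesis by simp
qed

lemma moment_antimono:
  assumes "t \<in> pos_orthant" "t' \<in> pos_orthant" "\<And>i. t $ i \<le> t' $ i"
  shows "moment z t' \<le> moment z t"
  unfolding moment_def
  by (intro integral_mono integrable_kern assms kern_antimono)

lemma F_pos: "t \<in> pos_orthant \<Longrightarrow> 0 < F z t"
  unfolding F_def by (intro mult_pos_pos gamma_norm_pos moment_pos)

lemma ln_F:
  assumes "t \<in> pos_orthant"
  shows "ln (F z t) = (\<Sum>i\<in>UNIV. (real (z i) + 1 / 2) * ln (t $ i) - ln (Gamma (real (z i) + 1 / 2))) + ln (moment z t)"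
  unfolding F_def ln_gamma_norm[OF assms, symmetric]
  by (intro ln_mult_pos gamma_norm_pos moment_pos assms)

text \<open>Half of the exponential decay pays for the power: with x = t_i l_i / 2, x^n is at most
  n! e^x, which compares \<open>kern z t\<close> with \<open>kern\<close> at exponent 0 and the
  halved rate \<open>t2\<close>. Finally ln n! is at most n^2.\<close>

lemma moment_upper:
  assumes t: "t \<in> pos_orthant"
  shows "\<exists>C. \<forall>z. ln (moment z t) \<le> C + (\<Sum>i\<in>UNIV. real (z i) * ln (2 / t $ i) + real (z i) * real (z i))"
proof -
  have ti: "0 < t $ i" for i using t by (simp add: pos_orthant_def)
  define t2 where "t2 = (\<chi> i. t $ i / 2)"
  have t2: "t2 \<in> pos_orthant" using ti by (simp add: t2_def pos_orthant_def)
  have "ln (moment z t) \<le> ln (moment (\<lambda>_. 0) t2) + (\<Sum>i\<in>UNIV. real (z i) * ln (2 / t $ i) + real (z i) * real (z i))"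
    for z
  proof -
    define P where "P = (\<Prod>i\<in>UNIV. (2 / t $ i) ^ z i * fact (z i))"
    have P: "0 < P" unfolding P_def using ti by (intro prod_pos) auto
    have "kern z t l \<le> P * kern (\<lambda>_. 0) t2 l" for l
    proof (cases "l \<in> pos_orthant")
      case True
      then have l: "0 < l $ i" for i by (simp add: pos_orthant_def)
      have "kern z t l = (\<Prod>i\<in>UNIV. l $ i ^ z i * exp (- (t $ i * l $ i)))"
        unfolding prod.distrib using True by (simp add: kern_def exp_sum[symmetric] sum_negf)
      also have "\<dots> \<le> (\<Prod>i\<in>UNIV. ((2 / t $ i) ^ z i * fact (z i)) * exp (- (t2 $ i * l $ i)))"
      proof (rule prod_mono, safe)
        fix i
        show "0 \<le> l $ i ^ z i * exp (- (t $ i * l $ i))" using l[of i] by simp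
        define x where "x = t $ i * l $ i / 2"
        have x: "0 \<le> x" unfolding x_def using ti[of i] l[of i] by simp
        have "x ^ z i / fact (z i) \<le> exp x"
          using sum_le_suminf[OF summable_exp_generic[of x], of "{z i}"] x
          by (simp add: exp_def divide_inverse mult.commute)
        then have "x ^ z i \<le> fact (z i) * exp x" by (simp add: divide_le_eq mult.commute)
        then have "x ^ z i * exp (- x) * exp (- x) \<le> fact (z i) * exp (- x)"
          by (simp add: exp_minus field_simps)
        moreover have "l $ i = 2 / t $ i * x" unfolding x_def using ti[of i] by simp
        moreover have "exp (- (t $ i * l $ i)) = exp (- x) * exp (- x)"
          unfolding x_def by (simp add: exp_add[symmetric])
        moreover have "t2 $ i * l $ i = x" unfolding x_def t2_def by simp
        moreover have "0 \<le> (2 / t $ i) ^ z i" using ti[of i] by simp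
        ultimately have "(2 / t $ i) ^ z i * (x ^ z i * exp (- x) * exp (- x)) \<le> (2 / t $ i) ^ z i * (fact (z i) * exp (- x))"
          by (intro mult_left_mono)
        moreover have "exp (- (t2 $ i * l $ i)) = exp (- x)"
          using \<open>t2 $ i * l $ i = x\<close> by simp
        moreover have "l $ i ^ z i * exp (- (t $ i * l $ i)) = (2 / t $ i) ^ z i * (x ^ z i * exp (- x) * exp (- x))"
          using \<open>l $ i = 2 / t $ i * x\<close> \<open>exp (- (t $ i * l $ i)) = exp (- x) * exp (- x)\<close>
          by (simp only: power_mult_distrib mult.assoc)
        ultimately show "l $ i ^ z i * exp (- (t $ i * l $ i)) \<le> ((2 / t $ i) ^ z i * fact (z i)) * exp (- (t2 $ i * l $ i))"
          by (simp only: mult.assoc)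
      qed
      also have "\<dots> = P * kern (\<lambda>_. 0) t2 l"
        unfolding prod.distrib P_def using True by (simp add: kern_def exp_sum[symmetric] sum_negf prod.distrib)
      finally show ?thesis .
    qed (simp add: kern_def)
    then have "moment z t \<le> P * moment (\<lambda>_. 0) t2"
      unfolding moment_def Bochner_Integration.integral_mult_right_zero[symmetric]
      by (intro integral_mono integrable_kern integrable_mult_right t t2)
    then have "ln (moment z t) \<le> ln (P * moment (\<lambda>_. 0) t2)"
      using moment_pos[OF t, of z] by (subst ln_le_cancel_iff) (auto intro: less_le_trans)
    also have "\<dots> = ln P + ln (moment (\<lambda>_. 0) t2)"
      by (rule ln_mult_pos) (auto intro: P moment_pos t2)
    also have "ln P = (\<Sum>i\<in>UNIV. ln ((2 / t $ i) ^ z i * fact (z i)))"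
      unfolding P_def by (rule ln_prod) (auto simp: ti less_imp_neq[OF ti, symmetric])
    also have "\<dots> \<le> (\<Sum>i\<in>UNIV. real (z i) * ln (2 / t $ i) + real (z i) * real (z i))"
    proof (rule sum_mono)
      fix i
      have "ln (fact (z i) :: real) \<le> real (z i) * real (z i)"
      proof (cases "z i = 0")
        case False
        have "ln (fact (z i) :: real) \<le> ln (real (z i) ^ z i)"
          using fact_le_power[of "z i"] False by (subst ln_le_cancel_iff) (auto simp: of_nat_power[symmetric] simp del: of_nat_power)
        also have "\<dots> = real (z i) * ln (real (z i))" using False by (simp add: ln_realpow)
        also have "\<dots> \<le> real (z i) * real (z i)"
          using ln_le_minus_one[of "real (z i)"] False by (intro mult_left_mono) auto
        finally show ?thesis .
      qed simp
      moreover have "ln ((2 / t $ i) ^ z i * fact (z i)) = real (z i) * ln (2 / t $ i) + ln (fact (z i))"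
        using ti[of i] by (subst ln_mult_pos) (auto simp: ln_realpow)
      ultimately show "ln ((2 / t $ i) ^ z i * fact (z i)) \<le> real (z i) * ln (2 / t $ i) + real (z i) * real (z i)"
        by simp
    qed
    finally show ?thesis by simp
  qed
  then show ?thesis by blast
qed

text \<open>Some set \<open>A n\<close>, on which every coordinate is at least a = 1/(n + 1), has
  positive mass because these sets exhaust the positive orthant. On it the monomial is at least
  \<open>a ^ total_count z\<close>, so the logarithm falls at most linearly.\<close>

lemma moment_lower:
  assumes t: "t \<in> pos_orthant"
  shows "\<exists>a m. \<forall>z. real (total_count z) * a + m \<le> ln (moment z t)"
proof -
  define A where "A = (\<lambda>n :: nat. {l :: real ^ 'n. \<forall>i. 1 / (real n + 1) \<le> l $ i})"
  have A [measurable]: "A n \<in> sets \<nu>" for n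
    unfolding A_def sets_nu by measurable
  have sub: "A n \<subseteq> pos_orthant" for n
    unfolding A_def pos_orthant_def
    by (auto intro: less_le_trans[rotated])
  have un: "pos_orthant \<subseteq> (\<Union>n. A n)"
  proof
    fix l :: "real ^ 'n" assume l: "l \<in> pos_orthant"
    define m where "m = Min (range (\<lambda>i. l $ i))"
    have m: "0 < m" "\<And>i. m \<le> l $ i"
      unfolding m_def using l by (auto simp: pos_orthant_def)
    obtain n where "1 / real (Suc n) < m" using nat_approx_posE[OF m(1)] by blast
    then have "1 / (real n + 1) \<le> l $ i" for i
      using m(2)[of i] by (simp add: add.commute)
    then have "l \<in> A n" by (simp add: A_def)
    then show "l \<in> (\<Union>n. A n)" by blast
  qed
  have "\<exists>n. emeasure \<nu> (A n) \<noteq> 0"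
  proof (rule ccontr)
    assume "\<not> ?thesis"
    then have "A n \<in> null_sets \<nu>" for n using A by (auto simp: null_sets_def)
    then have "(\<Union>n. A n) \<in> null_sets \<nu>" by blast
    then have "AE l in \<nu>. l \<notin> (\<Union>n. A n)" by (rule AE_not_in)
    with AE_pos have "AE l in \<nu>. False" by eventually_elim (use un in blast)
    then have "emeasure \<nu> (space \<nu>) = 0" by (simp add: AE_iff_measurable[OF _ refl])
    then show False using nonzero space_nu by simp
  qed
  then obtain n where n: "emeasure \<nu> (A n) \<noteq> 0" by blast
  define a where "a = 1 / (real n + 1)"
  have a: "0 < a" by (simp add: a_def)
  define h where "h = (\<lambda>l. indicator (A n) l * kern (\<lambda>_. 0) t l)"
  have h: "integrable \<nu> h" unfolding h_def
    using integrable_mult_indicator[OF A integrable_kern[OF t]] by simp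
  define m where "m = (\<integral>l. h l \<partial>\<nu>)"
  have "m \<noteq> 0"
  proof
    assume "m = 0"
    then have "AE l in \<nu>. h l = 0"
      unfolding m_def
      by (subst (asm) integral_nonneg_eq_0_iff_AE) (use h in \<open>auto simp: h_def kern_nonneg\<close>)
    then have "AE l in \<nu>. l \<notin> A n"
    proof eventually_elim
      fix l assume "h l = 0"
      then show "l \<notin> A n" using kern_pos[of l "\<lambda>_. 0" t] sub[of n] by (auto simp: h_def)
    qed
    then have "emeasure \<nu> (A n) = 0"
      by (subst (asm) AE_iff_measurable[of "A n"]) (auto simp: space_nu)
    then show False using n by simp
  qed
  moreover have "0 \<le> m" unfolding m_def h_def by (intro Bochner_Integration.integral_nonneg mult_nonneg_nonneg kern_nonneg) auto
  ultimately have m: "0 < m" by simp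
  have "real (total_count z) * ln a + ln m \<le> ln (moment z t)" for z
  proof -
    have "a ^ total_count z * h l \<le> kern z t l" for l
    proof (cases "l \<in> A n")
      case True
      then have "l \<in> pos_orthant" using sub by blast
      moreover have "a ^ total_count z \<le> (\<Prod>i\<in>UNIV. (l $ i) ^ z i)"
        unfolding power_total using True a by (intro prod_mono) (auto simp: A_def a_def intro!: power_mono)
      ultimately show ?thesis using True by (simp add: h_def kern_def)
    qed (simp add: h_def kern_nonneg)
    then have "a ^ total_count z * m \<le> moment z t"
      unfolding moment_def m_def Bochner_Integration.integral_mult_right_zero[symmetric]
      by (intro integral_mono integrable_kern integrable_mult_right t h)
    then have "ln (a ^ total_count z * m) \<le> ln (moment z t)"
      using a m by (subst ln_le_cancel_iff) (auto intro: less_le_trans[rotated])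
    moreover have "ln (a ^ total_count z * m) = real (total_count z) * ln a + ln m"
      using a m by (subst ln_mult_pos) (auto simp: ln_realpow)
    ultimately show ?thesis by simp
  qed
  then show ?thesis by blast
qed

lemma exp_bounded_ln_moment:
  assumes t: "t \<in> pos_orthant"
  shows "exp_bounded total_count UNIV (\<lambda>z. ln (moment z t))"
proof -
  obtain C where C: "\<And>z. ln (moment z t) \<le> C + (\<Sum>i\<in>UNIV. real (z i) * ln (2 / t $ i) + real (z i) * real (z i))"
    using moment_upper[OF t] by blast
  obtain a m where am: "\<And>z. real (total_count z) * a + m \<le> ln (moment z t)"
    using moment_lower[OF t] by blast
  let ?U = "\<lambda>z. C + (\<Sum>i\<in>UNIV. real (z i) * ln (2 / t $ i) + real (z i) * real (z i))"
  let ?L = "\<lambda>z. real (total_count z) * a + m"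
  have abs: "exp_bounded total_count UNIV (\<lambda>z. \<bar>h z\<bar>)" if "exp_bounded total_count UNIV h" for h :: "('n \<Rightarrow> nat) \<Rightarrow> real"
    using that by (rule exp_bounded_mono) auto
  have "exp_bounded total_count UNIV (\<lambda>z. \<bar>?U z\<bar> + \<bar>?L z\<bar>)"
    by (intro exp_bounded_add abs exp_bounded_const exp_bounded_sum exp_bounded_mult exp_bounded_of_nat le_total order_refl)
  then show ?thesis
  proof (rule exp_bounded_mono)
    fix z
    show "\<bar>ln (moment z t)\<bar> \<le> \<bar>\<bar>?U z\<bar> + \<bar>?L z\<bar>\<bar>" using C[of z] am[of z] by linarith
  qed
qed

lemma exp_bounded_ln_F:
  assumes "t \<in> pos_orthant"
  shows "exp_bounded total_count UNIV (\<lambda>z. ln (F z t))"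
  unfolding ln_F[OF assms]
  by (intro exp_bounded_add exp_bounded_sum exp_bounded_diff exp_bounded_mult exp_bounded_const
      exp_bounded_of_nat exp_bounded_ln_Gamma exp_bounded_ln_moment assms le_total)

end

section \<open>Interpolating the exposure times\<close>

text \<open>In this form the rate enters through a single exponential, so differentiating in the
  rate needs no separate treatment of the exponent \<open>z i\<close> = 0.\<close>

lemma poisson_prob_exp:
  assumes c: "\<And>i. 0 < c $ i" and l: "l \<in> pos_orthant"
  shows "poisson_prob c l z =
    exp (\<Sum>i\<in>UNIV. real (z i) * ln (c $ i * l $ i) - c $ i * l $ i) * (\<Prod>i\<in>UNIV. 1 / fact (z i))"
proof -
  have "poisson_prob c l z = (\<Prod>i\<in>UNIV. exp (real (z i) * ln (c $ i * l $ i) - c $ i * l $ i) * (1 / fact (z i)))"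
    unfolding poisson_prob_def
  proof (rule prod.cong)
    fix i
    have "0 < c $ i * l $ i" using c l by (simp add: pos_orthant_def)
    then show "(c $ i * l $ i) ^ z i * exp (- (c $ i * l $ i)) / fact (z i)
      = exp (real (z i) * ln (c $ i * l $ i) - c $ i * l $ i) * (1 / fact (z i))"
      by (simp add: exp_diff exp_minus divide_inverse exp_of_nat_mult)
  qed simp
  also have "\<dots> = exp (\<Sum>i\<in>UNIV. real (z i) * ln (c $ i * l $ i) - c $ i * l $ i) * (\<Prod>i\<in>UNIV. 1 / fact (z i))"
    unfolding prod.distrib by (simp add: exp_sum)
  finally show ?thesis .
qed

context poisson_path
begin

text \<open>The solution of t_i' = gamma_i t_i^2 started at \<open>r\<close>; by the choice of
  gamma_i it reaches \<open>r + s\<close> at time 1.\<close>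

definition curve :: "real \<Rightarrow> real ^ 'n" where
  "curve u = (\<chi> i. 1 / (1 / r $ i - u * \<gamma> $ i))"

lemma curve_0: "curve 0 = r" and curve_1: "curve 1 = r + s"
  unfolding curve_def gamma by (simp_all add: vec_eq_iff)

lemma curve_denominator:
  assumes "u \<in> {0..1}"
  shows "0 < 1 / r $ i - u * \<gamma> $ i" "1 / (r $ i + s $ i) \<le> 1 / r $ i - u * \<gamma> $ i"
proof -
  have "u * \<gamma> $ i \<le> 1 * \<gamma> $ i" using assms gamma_pos[of i] by (intro mult_right_mono) auto
  then show "1 / (r $ i + s $ i) \<le> 1 / r $ i - u * \<gamma> $ i" by (simp add: gamma)
  moreover have "0 < 1 / (r $ i + s $ i)" using r_pos[of i] s_pos[of i] by simp
  ultimately show "0 < 1 / r $ i - u * \<gamma> $ i" by linarith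
qed

lemma curve_bounds:
  assumes "u \<in> {0..1}"
  shows "r $ i \<le> curve u $ i" "curve u $ i \<le> (r + s) $ i" "0 < curve u $ i"
proof -
  have d: "0 < 1 / r $ i - u * \<gamma> $ i" "1 / (r $ i + s $ i) \<le> 1 / r $ i - u * \<gamma> $ i"
    using curve_denominator[OF assms] by auto
  show p: "0 < curve u $ i" unfolding curve_def using d by simp
  have "1 / r $ i - u * \<gamma> $ i \<le> 1 / r $ i" using assms gamma_pos[of i] by simp
  then have "1 / (1 / r $ i) \<le> 1 / (1 / r $ i - u * \<gamma> $ i)"
    using d by (intro divide_left_mono mult_pos_pos) (use r_pos[of i] in auto)
  then show "r $ i \<le> curve u $ i" by (simp add: curve_def)
  have "1 / (1 / r $ i - u * \<gamma> $ i) \<le> 1 / (1 / (r $ i + s $ i))"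
    using d by (intro divide_left_mono mult_pos_pos) (use r_pos[of i] s_pos[of i] in auto)
  then show "curve u $ i \<le> (r + s) $ i" by (simp add: curve_def)
qed

lemma curve_in: "u \<in> {0..1} \<Longrightarrow> curve u \<in> pos_orthant"
  using curve_bounds by (auto simp: pos_orthant_def)

lemma curve_deriv:
  assumes "u \<in> {0..1}"
  shows "((\<lambda>u. curve u $ i) has_real_derivative \<gamma> $ i * (curve u $ i)\<^sup>2) (at u within {0..1})"
  unfolding curve_def vec_lambda_beta
  by (rule derivative_eq_intros refl | use curve_denominator[OF assms, of i] in \<open>simp add: power2_eq_square\<close>)+

lemma kern_path_deriv:
  assumes u: "u \<in> {0..1}"
  shows "((\<lambda>u. kern z (curve u) l) has_real_derivative
    - (\<Sum>i\<in>UNIV. \<gamma> $ i * (curve u $ i)\<^sup>2 * kern (z(i := z i + 1)) (curve u) l)) (at u within {0..1})"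
proof (cases "l \<in> pos_orthant")
  case True
  have "((\<lambda>u. (\<Prod>i\<in>UNIV. (l $ i) ^ z i) * exp (- (\<Sum>i\<in>UNIV. curve u $ i * l $ i))) has_real_derivative
    (\<Prod>i\<in>UNIV. (l $ i) ^ z i) * (exp (- (\<Sum>i\<in>UNIV. curve u $ i * l $ i)) *
      - (\<Sum>i\<in>UNIV. \<gamma> $ i * (curve u $ i)\<^sup>2 * l $ i))) (at u within {0..1})"
    by (rule derivative_eq_intros curve_deriv[OF u] refl | simp)+
  then show ?thesis
    unfolding kern_upd using True by (simp add: kern_def sum_distrib_left sum_distrib_right mult_ac)
qed (simp add: kern_def)

lemma moment_path_deriv:
  assumes u: "u \<in> {0..1}"
  shows "((\<lambda>u. moment z (curve u)) has_real_derivative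
    - (\<Sum>i\<in>UNIV. \<gamma> $ i * (curve u $ i)\<^sup>2 * moment (z(i := z i + 1)) (curve u))) (at u within {0..1})"
proof -
  have int: "integrable \<nu> (kern z (curve u))" if "u \<in> {0..1}" for z u
    using that by (intro integrable_kern curve_in)
  have "((\<lambda>u. \<integral>l. kern z (curve u) l \<partial>\<nu>) has_real_derivative
    (\<integral>l. - (\<Sum>i\<in>UNIV. \<gamma> $ i * (curve u $ i)\<^sup>2 * kern (z(i := z i + 1)) (curve u) l) \<partial>\<nu>)) (at u within {0..1})"
  proof (rule has_real_derivative_lebesgue_integral
      [where B = "\<lambda>l. \<Sum>i\<in>UNIV. \<gamma> $ i * ((r + s) $ i)\<^sup>2 * kern (z(i := z i + 1)) r l"])
    fix v l assume v: "v \<in> {0..1 :: real}"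
    have "\<bar>- (\<Sum>i\<in>UNIV. \<gamma> $ i * (curve v $ i)\<^sup>2 * kern (z(i := z i + 1)) (curve v) l)\<bar>
      \<le> (\<Sum>i\<in>UNIV. \<bar>\<gamma> $ i * (curve v $ i)\<^sup>2 * kern (z(i := z i + 1)) (curve v) l\<bar>)"
      by (simp add: sum_abs)
    \<comment> \<open>The bound is uniform along the path: the curve stays between \<open>r\<close>
      and \<open>r + s\<close>, and \<open>kern\<close> decreases in the rates, so its value at
      \<open>r\<close> is the largest.\<close>
    also have "\<dots> \<le> (\<Sum>i\<in>UNIV. \<gamma> $ i * ((r + s) $ i)\<^sup>2 * kern (z(i := z i + 1)) r l)"
    proof (rule sum_mono)
      fix i
      have "\<gamma> $ i * (curve v $ i)\<^sup>2 * kern (z(i := z i + 1)) (curve v) l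
        \<le> \<gamma> $ i * ((r + s) $ i)\<^sup>2 * kern (z(i := z i + 1)) r l"
        using curve_bounds[OF v] gamma_pos[of i] less_imp_le[OF curve_bounds(3)[OF v]]
        by (intro mult_mono kern_antimono kern_nonneg power_mono) auto
      moreover have "0 \<le> \<gamma> $ i * (curve v $ i)\<^sup>2 * kern (z(i := z i + 1)) (curve v) l"
        using gamma_pos[of i] by (intro mult_nonneg_nonneg kern_nonneg) auto
      ultimately show "\<bar>\<gamma> $ i * (curve v $ i)\<^sup>2 * kern (z(i := z i + 1)) (curve v) l\<bar>
        \<le> \<gamma> $ i * ((r + s) $ i)\<^sup>2 * kern (z(i := z i + 1)) r l" by simp
    qed
    finally show "\<bar>- (\<Sum>i\<in>UNIV. \<gamma> $ i * (curve v $ i)\<^sup>2 * kern (z(i := z i + 1)) (curve v) l)\<bar>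
      \<le> (\<Sum>i\<in>UNIV. \<gamma> $ i * ((r + s) $ i)\<^sup>2 * kern (z(i := z i + 1)) r l)" .
  next
    show "integrable \<nu> (\<lambda>l. \<Sum>i\<in>UNIV. \<gamma> $ i * ((r + s) $ i)\<^sup>2 * kern (z(i := z i + 1)) r l)"
      by (intro Bochner_Integration.integrable_sum integrable_mult_right integrable_kern r_in)
  next
    show "(\<lambda>l. - (\<Sum>i\<in>UNIV. \<gamma> $ i * (curve v $ i)\<^sup>2 * kern (z(i := z i + 1)) (curve v) l))
      \<in> borel_measurable \<nu>" for v by measurable
  qed (rule int kern_path_deriv u; assumption)+
  also have "(\<integral>l. - (\<Sum>i\<in>UNIV. \<gamma> $ i * (curve u $ i)\<^sup>2 * kern (z(i := z i + 1)) (curve u) l) \<partial>\<nu>)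
    = - (\<Sum>i\<in>UNIV. \<gamma> $ i * (curve u $ i)\<^sup>2 * moment (z(i := z i + 1)) (curve u))"
    unfolding moment_def using int[OF u] by (simp add: Bochner_Integration.integral_sum)
  finally show ?thesis unfolding moment_def .
qed

definition ratio :: "('n \<Rightarrow> nat) \<Rightarrow> 'n \<Rightarrow> real ^ 'n \<Rightarrow> real" where
  "ratio z i t = F (z(i := z i + 1)) t / F z t"

lemma ratio_moment:
  assumes t: "t \<in> pos_orthant"
  shows "(real (z i) + 1 / 2) * ratio z i t = t $ i * moment (z(i := z i + 1)) t / moment z t"
proof -
  have "(real (z i) + 1 / 2) * ratio z i t
    = ((real (z i) + 1 / 2) * gamma_norm (z(i := z i + 1)) t) * moment (z(i := z i + 1)) t / (gamma_norm z t * moment z t)"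
    unfolding ratio_def F_def by (simp add: mult.assoc)
  then show ?thesis
    unfolding gamma_norm_Suc[OF t] using less_imp_neq[OF gamma_norm_pos[OF t, of z]] by simp
qed

definition score :: "('n \<Rightarrow> nat) \<Rightarrow> real \<Rightarrow> real" where
  "score z u = (\<Sum>i\<in>UNIV. \<gamma> $ i * curve u $ i * (real (z i) + 1 / 2) * (1 - ratio z i (curve u)))"

text \<open>The power of t_i in the normalisation contributes gamma_i t_i (z_i + 1/2). The logarithm
  of the moment contributes the negative of the same weight times the neighbour ratio, by
  \<open>ratio_moment\<close>.\<close>

lemma ln_F_path_deriv:
  assumes u: "u \<in> {0..1}"
  shows "((\<lambda>u. ln (F z (curve u))) has_real_derivative score z u) (at u within {0..1})"
proof -
  note t = curve_in[OF u]
  have p: "0 < curve u $ i" for i using curve_bounds(3)[OF u] .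
  have m: "0 < moment z (curve u)" by (rule moment_pos[OF t])
  have *: "((\<lambda>u. (\<Sum>i\<in>UNIV. (real (z i) + 1 / 2) * ln (curve u $ i) - ln (Gamma (real (z i) + 1 / 2)))
      + ln (moment z (curve u))) has_real_derivative
    (\<Sum>i\<in>UNIV. (real (z i) + 1 / 2) * (1 / curve u $ i * (\<gamma> $ i * (curve u $ i)\<^sup>2)))
      + 1 / moment z (curve u) * - (\<Sum>i\<in>UNIV. \<gamma> $ i * (curve u $ i)\<^sup>2 * moment (z(i := z i + 1)) (curve u)))
    (at u within {0..1})"
    by (rule derivative_eq_intros curve_deriv[OF u] moment_path_deriv[OF u] refl p m | simp add: mult_ac)+
  have "(\<Sum>i\<in>UNIV. (real (z i) + 1 / 2) * (1 / curve u $ i * (\<gamma> $ i * (curve u $ i)\<^sup>2)))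
      + 1 / moment z (curve u) * - (\<Sum>i\<in>UNIV. \<gamma> $ i * (curve u $ i)\<^sup>2 * moment (z(i := z i + 1)) (curve u))
    = (\<Sum>i\<in>UNIV. (real (z i) + 1 / 2) * (\<gamma> $ i * curve u $ i)
      - \<gamma> $ i * curve u $ i * (curve u $ i * moment (z(i := z i + 1)) (curve u) / moment z (curve u)))"
    unfolding mult_minus_right sum_distrib_left add_uminus_conv_diff sum_subtractf[symmetric]
  proof (rule sum.cong)
    fix i
    show "(real (z i) + 1 / 2) * (1 / curve u $ i * (\<gamma> $ i * (curve u $ i)\<^sup>2)) -
        1 / moment z (curve u) * (\<gamma> $ i * (curve u $ i)\<^sup>2 * moment (z(i := z i + 1)) (curve u))
      = (real (z i) + 1 / 2) * (\<gamma> $ i * curve u $ i)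
        - \<gamma> $ i * curve u $ i * (curve u $ i * moment (z(i := z i + 1)) (curve u) / moment z (curve u))"
      using p[of i] by (simp add: power2_eq_square)
  qed simp
  also have "\<dots> = score z u"
    unfolding score_def ratio_moment[OF t, symmetric]
    by (intro sum.cong) (auto simp: field_simps)
  finally have e: "(\<Sum>i\<in>UNIV. (real (z i) + 1 / 2) * (1 / curve u $ i * (\<gamma> $ i * (curve u $ i)\<^sup>2)))
      + 1 / moment z (curve u) * - (\<Sum>i\<in>UNIV. \<gamma> $ i * (curve u $ i)\<^sup>2 * moment (z(i := z i + 1)) (curve u))
    = score z u" .
  show ?thesis
  proof (rule has_field_derivative_transform_within[OF *[unfolded e] zero_less_one u])
    fix v assume "v \<in> {0..1 :: real}"
    then show "(\<Sum>i\<in>UNIV. (real (z i) + 1 / 2) * ln (curve v $ i) - ln (Gamma (real (z i) + 1 / 2)))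
      + ln (moment z (curve v)) = ln (F z (curve v))"
      by (simp add: ln_F curve_in)
  qed
qed

text \<open>The logarithmic derivative in t_i is (z_i - t_i l_i) / t_i; multiplying by the speed
  gamma_i t_i^2 of the curve gives the summands.\<close>

lemma poisson_path_deriv:
  assumes l: "l \<in> pos_orthant" and u: "u \<in> {0..1}"
  shows "((\<lambda>u. poisson_prob (curve u) l z) has_real_derivative
    poisson_prob (curve u) l z * (\<Sum>i\<in>UNIV. \<gamma> $ i * curve u $ i * (real (z i) - curve u $ i * l $ i)))
    (at u within {0..1})"
proof -
  have p: "0 < curve u $ i" for i using curve_bounds(3)[OF u] .
  have li: "0 < l $ i" for i using l by (simp add: pos_orthant_def)
  have pl: "0 < curve u $ i * l $ i" for i using p li by simp
  have pl': "0 < curve u $ i \<and> 0 < l $ i \<or> curve u $ i < 0 \<and> l $ i < 0" for i using p li by simp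
  let ?E = "\<lambda>u. exp (\<Sum>i\<in>UNIV. real (z i) * ln (curve u $ i * l $ i) - curve u $ i * l $ i)"
  let ?P = "\<Prod>i\<in>UNIV. 1 / fact (z i) :: real"
  have *: "((\<lambda>u. ?E u * ?P) has_real_derivative
     ?E u * (\<Sum>i\<in>UNIV. real (z i) * (1 / (curve u $ i * l $ i) * (\<gamma> $ i * (curve u $ i)\<^sup>2 * l $ i)) - \<gamma> $ i * (curve u $ i)\<^sup>2 * l $ i) * ?P)
     (at u within {0..1})"
    by (rule derivative_eq_intros curve_deriv[OF u] refl pl pl' | simp add: mult_ac)+
  have e: "(\<Sum>i\<in>UNIV. real (z i) * (1 / (curve u $ i * l $ i) * (\<gamma> $ i * (curve u $ i)\<^sup>2 * l $ i)) - \<gamma> $ i * (curve u $ i)\<^sup>2 * l $ i)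
    = (\<Sum>i\<in>UNIV. \<gamma> $ i * curve u $ i * (real (z i) - curve u $ i * l $ i))"
  proof (rule sum.cong)
    fix i
    show "real (z i) * (1 / (curve u $ i * l $ i) * (\<gamma> $ i * (curve u $ i)\<^sup>2 * l $ i)) - \<gamma> $ i * (curve u $ i)\<^sup>2 * l $ i
      = \<gamma> $ i * curve u $ i * (real (z i) - curve u $ i * l $ i)"
      using p[of i] li[of i] by (simp add: power2_eq_square algebra_simps)
  qed simp
  show ?thesis
  proof (rule has_field_derivative_transform_within[OF _ zero_less_one u])
    show "((\<lambda>u. ?E u * ?P) has_real_derivative
      poisson_prob (curve u) l z * (\<Sum>i\<in>UNIV. \<gamma> $ i * curve u $ i * (real (z i) - curve u $ i * l $ i)))
      (at u within {0..1})"
      using * unfolding e poisson_prob_exp[OF p l] by (simp add: mult_ac)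
    fix v assume "v \<in> {0..1 :: real}"
    then show "?E v * ?P = poisson_prob (curve v) l z"
      by (simp add: poisson_prob_exp curve_bounds l)
  qed
qed

end

section \<open>The derivative of E ln F along the path and its sign\<close>

lemma log_diff_ge:
  assumes "0 < a" "0 < (b :: real)"
  shows "(a - b) / a \<le> ln a - ln b" "a \<noteq> b \<Longrightarrow> (a - b) / a < ln a - ln b"
proof -
  have e: "ln a - ln b = - ln (b / a)" "(a - b) / a = - (b / a - 1)"
    using assms by (simp_all add: ln_div diff_divide_distrib)
  have "ln (b / a) \<le> b / a - 1" using assms by (intro ln_le_minus_one) simp
  then show "(a - b) / a \<le> ln a - ln b" unfolding e by simp
  assume "a \<noteq> b"
  \<comment> \<open>The bound ln x <= x - 1 is an equality only at x = 1; strict domination rests on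
    this.\<close>
  then have "ln (b / a) \<noteq> b / a - 1" using assms ln_eq_minus_one[of "b / a"] by auto
  with \<open>ln (b / a) \<le> b / a - 1\<close> show "(a - b) / a < ln a - ln b" unfolding e by simp
qed

lemma exp_bounded_slice:
  assumes "exp_bounded (\<lambda>a. total_count (fst a)) (UNIV \<times> {0..1 :: real}) h" "u \<in> {0..1}"
  shows "exp_bounded total_count UNIV (\<lambda>z. h (z, u))"
  by (rule exp_bounded_compose[OF assms(1), where c = 0]) (use assms(2) in auto)

context poisson_path
begin

definition star :: "('n \<Rightarrow> nat) \<Rightarrow> real ^ 'n \<Rightarrow> real" where
  "star z t = (\<Sum>i\<in>UNIV. \<gamma> $ i * t $ i * real (z i) * (F z t - (if z i = 0 then 1 else F (z(i := z i - 1)) t)))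
    + (\<Sum>i\<in>UNIV. \<gamma> $ i * t $ i * (real (z i) + 1 / 2) * (F z t - F (z(i := z i + 1)) t))"

text \<open>What the derivative integrand becomes after the Poisson shift: the mean t_i l_i has been
  traded for a logarithmic difference between neighbours, so it no longer involves the rate vector.
  At \<open>z i\<close> = 0 truncated subtraction makes that difference 0, whereas
  \<open>star\<close> puts 1 for the missing neighbour; both occur with the factor
  \<open>z i\<close>.\<close>

definition gap :: "('n \<Rightarrow> nat) \<Rightarrow> real \<Rightarrow> real" where
  "gap z u = (\<Sum>i\<in>UNIV. \<gamma> $ i * curve u $ i * (real (z i) * (ln (F z (curve u)) - ln (F (z(i := z i - 1)) (curve u))))) + score z u"

definition exp_log :: "real ^ 'n \<Rightarrow> real \<Rightarrow> real" where
  "exp_log l u = infsetsum (\<lambda>z. poisson_prob (curve u) l z * ln (F z (curve u))) UNIV"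

lemma gap_star:
  assumes u: "u \<in> {0..1}"
  shows "star z (curve u) / F z (curve u) \<le> gap z u"
    and "z i \<noteq> 0 \<Longrightarrow> F z (curve u) \<noteq> F (z(i := z i - 1)) (curve u) \<Longrightarrow>
      star z (curve u) / F z (curve u) < gap z u"
proof -
  let ?t = "curve u"
  have p: "0 < F z ?t" for z by (rule F_pos[OF curve_in[OF u]])
  have c: "0 < \<gamma> $ i * ?t $ i" for i using gamma_pos[of i] curve_bounds(3)[OF u, of i] by simp
  define L where "L = (\<lambda>i. \<gamma> $ i * ?t $ i * real (z i) * ((F z ?t - (if z i = 0 then 1 else F (z(i := z i - 1)) ?t)) / F z ?t))"
  define G where "G = (\<lambda>i. \<gamma> $ i * ?t $ i * (real (z i) * (ln (F z ?t) - ln (F (z(i := z i - 1)) ?t))))"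
  have split: "star z ?t / F z ?t = sum L UNIV + score z u"
  proof -
    have q: "(F z ?t - F (z(i := z i + 1)) ?t) / F z ?t = 1 - ratio z i ?t" for i
      using p[of z] by (simp add: ratio_def diff_divide_distrib)
    show ?thesis
      unfolding star_def L_def score_def add_divide_distrib sum_divide_distrib
      by (simp only: q times_divide_eq_right[symmetric])
  qed
  have g: "gap z u = sum G UNIV + score z u" unfolding gap_def G_def ..
  have le: "L i \<le> G i" for i
  proof (cases "z i = 0")
    case False
    have "0 \<le> \<gamma> $ i * ?t $ i * real (z i)" using c[of i] by simp
    from mult_left_mono[OF log_diff_ge(1)[OF p[of z] p[of "z(i := z i - 1)"]] this] False
    show ?thesis unfolding L_def G_def by (simp add: mult.assoc)
  qed (simp add: L_def G_def)
  show "star z ?t / F z ?t \<le> gap z u"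
    unfolding split g using le by (simp add: sum_mono)
  assume z: "z i \<noteq> 0" and ne: "F z ?t \<noteq> F (z(i := z i - 1)) ?t"
  have "0 < \<gamma> $ i * ?t $ i * real (z i)" using c[of i] z by simp
  from mult_strict_left_mono[OF log_diff_ge(2)[OF p[of z] p[of "z(i := z i - 1)"] ne] this] z
  have "L i < G i" unfolding L_def G_def by (simp add: mult.assoc)
  then have "sum L UNIV < sum G UNIV" using le by (intro sum_strict_mono_ex1) auto
  then show "star z ?t / F z ?t < gap z u" unfolding split g by simp
qed

text \<open>Collecting the terms with F(z, t) gives the weights z_j + (z_j + 1/2) = 2 z_j + 1/2. All
  neighbours enter \<open>star\<close> with a minus sign and are nonnegative, so if
  \<open>star\<close> is nonnegative, each single upper neighbour is bounded by the collected
  term.\<close>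

lemma ratio_bound:
  assumes star: "0 \<le> star z t" and t: "t \<in> pos_orthant"
  shows "\<gamma> $ i * t $ i * (real (z i) + 1 / 2) * ratio z i t
    \<le> (\<Sum>j\<in>UNIV. \<gamma> $ j * t $ j * (2 * real (z j) + 1 / 2))"
proof -
  have p: "0 < F z t" for z by (rule F_pos[OF t])
  have c: "0 < \<gamma> $ i * t $ i" for i using gamma_pos[of i] t by (simp add: pos_orthant_def)
  let ?B = "\<lambda>i. if z i = 0 then 1 else F (z(i := z i - 1)) t"
  have B: "0 \<le> \<gamma> $ i * t $ i * real (z i) * ?B i" for i
    using c[of i] p[of "z(i := z i - 1)"] by simp
  have "star z t = (\<Sum>j\<in>UNIV. \<gamma> $ j * t $ j * (2 * real (z j) + 1 / 2)) * F z t
    - (\<Sum>j\<in>UNIV. \<gamma> $ j * t $ j * real (z j) * ?B j)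
    - (\<Sum>j\<in>UNIV. \<gamma> $ j * t $ j * (real (z j) + 1 / 2) * F (z(j := z j + 1)) t)"
    unfolding star_def sum_distrib_right sum.distrib[symmetric] sum_subtractf[symmetric]
    by (intro sum.cong refl) (simp add: algebra_simps)
  moreover have "0 \<le> (\<Sum>j\<in>UNIV. \<gamma> $ j * t $ j * real (z j) * ?B j)" by (intro sum_nonneg B)
  moreover have "\<gamma> $ i * t $ i * (real (z i) + 1 / 2) * F (z(i := z i + 1)) t
      \<le> (\<Sum>j\<in>UNIV. \<gamma> $ j * t $ j * (real (z j) + 1 / 2) * F (z(j := z j + 1)) t)"
    by (rule member_le_sum) (auto intro!: mult_nonneg_nonneg[OF _ less_imp_le[OF p]] mult_nonneg_nonneg[OF less_imp_le[OF c]])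
  ultimately have "\<gamma> $ i * t $ i * (real (z i) + 1 / 2) * F (z(i := z i + 1)) t
      \<le> (\<Sum>j\<in>UNIV. \<gamma> $ j * t $ j * (2 * real (z j) + 1 / 2)) * F z t" using star by linarith
  then show ?thesis unfolding ratio_def using p[of z] by (simp add: divide_le_eq)
qed

text \<open>Uniformity in the path parameter comes from monotonicity: the moments decrease in the
  rates, so they lie between their values at \<open>r + s\<close> and \<open>r\<close>, where the
  pointwise bound applies.\<close>

lemma exp_bounded_ln_F_curve:
  "exp_bounded (\<lambda>a. total_count (fst a)) (UNIV \<times> {0..1}) (\<lambda>a. ln (F (fst a) (curve (snd a))))"
proof -
  let ?S = "(UNIV :: ('n \<Rightarrow> nat) set) \<times> {0..1 :: real}"
  let ?m = "\<lambda>a :: ('n \<Rightarrow> nat) \<times> real. total_count (fst a)"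
  have M: "exp_bounded ?m ?S (\<lambda>a. ln (moment (fst a) (curve (snd a))))"
  proof (rule exp_bounded_mono[of _ _ "\<lambda>a. \<bar>ln (moment (fst a) r)\<bar> + \<bar>ln (moment (fst a) (r + s))\<bar>"])
    have e: "exp_bounded ?m ?S (\<lambda>a. ln (moment (fst a) t))" if "t \<in> pos_orthant" for t
      by (rule exp_bounded_compose[OF exp_bounded_ln_moment[OF that], where c = 0]) auto
    have e': "exp_bounded ?m ?S (\<lambda>a. \<bar>ln (moment (fst a) t)\<bar>)" if "t \<in> pos_orthant" for t
      by (rule exp_bounded_mono[OF e[OF that]]) auto
    show "exp_bounded ?m ?S (\<lambda>a. \<bar>ln (moment (fst a) r)\<bar> + \<bar>ln (moment (fst a) (r + s))\<bar>)"
      by (intro exp_bounded_add e' r_in rs_in)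
    fix a assume "a \<in> ?S"
    then have u: "snd a \<in> {0..1}" by auto
    have "moment (fst a) (r + s) \<le> moment (fst a) (curve (snd a))" "moment (fst a) (curve (snd a)) \<le> moment (fst a) r"
      by (intro moment_antimono curve_in curve_bounds u r_in rs_in)+
    then have "ln (moment (fst a) (r + s)) \<le> ln (moment (fst a) (curve (snd a)))"
      "ln (moment (fst a) (curve (snd a))) \<le> ln (moment (fst a) r)"
      using moment_pos[OF rs_in, of "fst a"] moment_pos[OF curve_in[OF u], of "fst a"] by auto
    then show "\<bar>ln (moment (fst a) (curve (snd a)))\<bar> \<le> \<bar>\<bar>ln (moment (fst a) r)\<bar> + \<bar>ln (moment (fst a) (r + s))\<bar>\<bar>"
      by linarith
  qed
  have L: "exp_bounded ?m ?S (\<lambda>a. ln (curve (snd a) $ i))" for i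
  proof (rule exp_bounded_mono[OF exp_bounded_const[of _ _ "\<bar>ln (r $ i)\<bar> + \<bar>ln ((r + s) $ i)\<bar>"]])
    fix a assume "a \<in> ?S"
    then have u: "snd a \<in> {0..1}" by auto
    have "ln (r $ i) \<le> ln (curve (snd a) $ i)" "ln (curve (snd a) $ i) \<le> ln ((r + s) $ i)"
      using r_pos[of i] curve_bounds[OF u, of i] by (auto simp del: vector_add_component)
    then show "\<bar>ln (curve (snd a) $ i)\<bar> \<le> \<bar>\<bar>ln (r $ i)\<bar> + \<bar>ln ((r + s) $ i)\<bar>\<bar>" by linarith
  qed
  have "exp_bounded ?m ?S (\<lambda>a. (\<Sum>i\<in>UNIV. (real (fst a i) + 1 / 2) * ln (curve (snd a) $ i) - ln (Gamma (real (fst a i) + 1 / 2)))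
      + ln (moment (fst a) (curve (snd a))))"
    by (intro exp_bounded_add exp_bounded_sum exp_bounded_diff exp_bounded_mult exp_bounded_const
      exp_bounded_of_nat exp_bounded_ln_Gamma M L le_total)
  then show ?thesis
    by (rule exp_bounded_mono) (auto simp: ln_F curve_in)
qed

lemma exp_bounded_curve:
  "exp_bounded m (UNIV \<times> {0..1}) (\<lambda>a. curve (snd a) $ i)"
proof (rule exp_bounded_mono[OF exp_bounded_const[of _ _ "(r + s) $ i"]])
  fix a :: "'a \<times> real" assume "a \<in> UNIV \<times> {0..1}"
  then have "snd a \<in> {0..1}" by auto
  from curve_bounds[OF this, of i] show "\<bar>curve (snd a) $ i\<bar> \<le> \<bar>(r + s) $ i\<bar>" by linarith
qed

context
  assumes star_nonneg: "\<And>z t. t \<in> pos_orthant \<Longrightarrow> 0 \<le> star z t"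
begin

text \<open>The neighbour ratios are the only part of \<open>score\<close> not controlled by
  elementary growth bounds; \<open>ratio_bound\<close> makes them linear in z.\<close>

lemma exp_bounded_score:
  "exp_bounded (\<lambda>a. total_count (fst a)) (UNIV \<times> {0..1}) (\<lambda>a. score (fst a) (snd a))"
proof -
  let ?S = "(UNIV :: ('n \<Rightarrow> nat) set) \<times> {0..1 :: real}"
  let ?m = "\<lambda>a :: ('n \<Rightarrow> nat) \<times> real. total_count (fst a)"
  have R: "exp_bounded ?m ?S (\<lambda>a. \<gamma> $ i * curve (snd a) $ i * (real (fst a i) + 1 / 2) * ratio (fst a) i (curve (snd a)))" for i
  proof (rule exp_bounded_mono)
    show "exp_bounded ?m ?S (\<lambda>a. \<Sum>j\<in>UNIV. \<gamma> $ j * curve (snd a) $ j * (2 * real (fst a j) + 1 / 2))"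
      by (intro exp_bounded_add exp_bounded_sum exp_bounded_mult exp_bounded_const
        exp_bounded_of_nat exp_bounded_curve le_total)
    fix a assume "a \<in> ?S"
    then have u: "snd a \<in> {0..1}" by auto
    have "0 \<le> \<gamma> $ i * curve (snd a) $ i * (real (fst a i) + 1 / 2) * ratio (fst a) i (curve (snd a))"
      unfolding ratio_def
      using gamma_pos[of i] curve_bounds(3)[OF u, of i]
      by (intro mult_nonneg_nonneg divide_nonneg_nonneg less_imp_le[OF F_pos] curve_in u) auto
    moreover note ratio_bound[OF star_nonneg[OF curve_in[OF u]] curve_in[OF u], of i "fst a"]
    ultimately show "\<bar>\<gamma> $ i * curve (snd a) $ i * (real (fst a i) + 1 / 2) * ratio (fst a) i (curve (snd a))\<bar>
      \<le> \<bar>\<Sum>j\<in>UNIV. \<gamma> $ j * curve (snd a) $ j * (2 * real (fst a j) + 1 / 2)\<bar>" by linarith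
  qed
  have "exp_bounded ?m ?S (\<lambda>a. \<Sum>i\<in>UNIV. \<gamma> $ i * curve (snd a) $ i * (real (fst a i) + 1 / 2)
     - \<gamma> $ i * curve (snd a) $ i * (real (fst a i) + 1 / 2) * ratio (fst a) i (curve (snd a)))"
    by (intro exp_bounded_add exp_bounded_sum exp_bounded_mult exp_bounded_const exp_bounded_diff
        exp_bounded_of_nat exp_bounded_curve le_total R)
  then show ?thesis
    by (rule exp_bounded_mono) (simp add: score_def right_diff_distrib)
qed

lemma exp_bounded_ln_F_pred:
  assumes "t \<in> pos_orthant"
  shows "exp_bounded total_count UNIV (\<lambda>z. ln (F (z(i := z i - 1)) t))"
proof (rule exp_bounded_compose[OF exp_bounded_ln_F[OF assms], where c = 0])
  fix z :: "'n \<Rightarrow> nat"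
  show "total_count (z(i := z i - 1)) \<le> total_count z + 0"
    using total_upd[of z i "z i - 1"] by linarith
qed auto

lemma exp_bounded_gap:
  assumes "u \<in> {0..1}"
  shows "exp_bounded total_count UNIV (\<lambda>z. gap z u)"
  unfolding gap_def
  by (intro exp_bounded_add exp_bounded_sum exp_bounded_mult exp_bounded_const exp_bounded_diff
        exp_bounded_of_nat le_total exp_bounded_ln_F exp_bounded_ln_F_pred curve_in assms
        exp_bounded_slice[OF exp_bounded_score assms, unfolded fst_conv snd_conv])

text \<open>Termwise differentiation gives the weight times \<open>E\<close>. The difference between
  \<open>E\<close> and \<open>gap\<close> has mean zero by the Poisson shift, so the derivative is
  the mean of \<open>gap\<close>.\<close>

lemma exp_log_deriv:
  assumes l: "l \<in> pos_orthant" and u: "u \<in> {0..1}"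
  shows "(exp_log l has_real_derivative infsetsum (\<lambda>z. poisson_prob (curve u) l z * gap z u) UNIV)
    (at u within {0..1})"
proof -
  let ?S = "(UNIV :: ('n \<Rightarrow> nat) set) \<times> {0..1 :: real}"
  let ?m = "\<lambda>a :: ('n \<Rightarrow> nat) \<times> real. total_count (fst a)"
  \<comment> \<open>Product rule with the Poisson weight factored out: the logarithmic derivative of
    the weight times ln F, plus the derivative of ln F.\<close>
  define E where "E = (\<lambda>a. (\<Sum>i\<in>UNIV. \<gamma> $ i * curve (snd a) $ i * (real (fst a i) - curve (snd a) $ i * l $ i))
    * ln (F (fst a) (curve (snd a))) + score (fst a) (snd a))"
  have "exp_bounded ?m ?S E"
    unfolding E_def
    by (intro exp_bounded_add exp_bounded_sum exp_bounded_mult exp_bounded_const exp_bounded_diff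
        exp_bounded_of_nat exp_bounded_curve le_total exp_bounded_score exp_bounded_ln_F_curve)
  then obtain C K where K: "0 \<le> C" "1 \<le> K" "\<And>z u. u \<in> {0..1} \<Longrightarrow> \<bar>E (z, u)\<bar> \<le> C * K ^ total_count z"
    unfolding exp_bounded_def by (auto 0 3 simp: Ball_def)
  \<comment> \<open>A Poisson weight is not monotone in its rate. Hence its exponential factor is
    dropped, being at most 1, and only then are the rates raised to their largest value
    \<open>r + s\<close>.\<close>
  define B where "B = (\<lambda>z. (\<Prod>i\<in>UNIV. ((r + s) $ i * l $ i) ^ z i / fact (z i)) * (C * K ^ total_count z))"
  have li: "0 < l $ i" for i using l by (simp add: pos_orthant_def)
  have B: "B abs_summable_on UNIV" unfolding B_def
    by (intro abs_summable_exp_series_exp_bounded exp_boundedI[of C K]) (use K in auto)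
  have D: "((\<lambda>u. \<integral>z. poisson_prob (curve u) l z * ln (F z (curve u)) \<partial>count_space UNIV) has_real_derivative
    (\<integral>z. poisson_prob (curve u) l z * E (z, u) \<partial>count_space UNIV)) (at u within {0..1})"
  proof (rule has_real_derivative_lebesgue_integral[where B = B])
    fix v :: real assume v: "v \<in> {0..1}"
    show "integrable (count_space UNIV) (\<lambda>z. poisson_prob (curve v) l z * ln (F z (curve v)))"
      using poisson_abs_summable[OF exp_bounded_ln_F[OF curve_in[OF v]]] by (simp add: abs_summable_on_def)
    fix z :: "'n \<Rightarrow> nat"
    have "((\<lambda>u. poisson_prob (curve u) l z * ln (F z (curve u))) has_real_derivative
      poisson_prob (curve v) l z * (\<Sum>i\<in>UNIV. \<gamma> $ i * curve v $ i * (real (z i) - curve v $ i * l $ i)) * ln (F z (curve v))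
       + score z v * poisson_prob (curve v) l z) (at v within {0..1})"
      by (rule DERIV_mult poisson_path_deriv ln_F_path_deriv l v)+
    then show "((\<lambda>u. poisson_prob (curve u) l z * ln (F z (curve u))) has_real_derivative
      poisson_prob (curve v) l z * E (z, v)) (at v within {0..1})"
      by (simp add: E_def distrib_left mult_ac)
    have "\<bar>poisson_prob (curve v) l z * E (z, v)\<bar> = poisson_prob (curve v) l z * \<bar>E (z, v)\<bar>"
      using poisson_prob_nonneg[OF curve_bounds(3)[OF v] l] by (simp add: abs_mult)
    also have "\<dots> \<le> (\<Prod>i\<in>UNIV. ((r + s) $ i * l $ i) ^ z i / fact (z i)) * (C * K ^ total_count z)"
    proof (intro mult_mono K v)
      have "poisson_prob (curve v) l z \<le> (\<Prod>i\<in>UNIV. (curve v $ i * l $ i) ^ z i / fact (z i))"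
        unfolding poisson_prob_alt using curve_bounds(3)[OF v] li
        by (intro mult_left_le_one_le prod_nonneg) (auto intro!: sum_nonneg simp: less_imp_le)
      also have "\<dots> \<le> (\<Prod>i\<in>UNIV. ((r + s) $ i * l $ i) ^ z i / fact (z i))"
        using curve_bounds[OF v] li less_imp_le[OF curve_bounds(3)[OF v]] less_imp_le[OF li]
        by (intro prod_mono conjI divide_right_mono power_mono mult_right_mono) auto
      finally show "poisson_prob (curve v) l z \<le> (\<Prod>i\<in>UNIV. ((r + s) $ i * l $ i) ^ z i / fact (z i))" .
      show "0 \<le> (\<Prod>i\<in>UNIV. ((r + s) $ i * l $ i) ^ z i / fact (z i))"
        using r_pos s_pos li by (intro prod_nonneg) (auto intro!: divide_nonneg_nonneg zero_le_power mult_nonneg_nonneg add_nonneg_nonneg simp: less_imp_le)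
    qed auto
    finally show "\<bar>poisson_prob (curve v) l z * E (z, v)\<bar> \<le> B z" by (simp add: B_def)
  qed (use u B in \<open>auto simp: abs_summable_on_def\<close>)
  let ?p = "poisson_prob (curve u) l" and ?t = "curve u"
  note t = curve_in[OF u]
  have pred: "exp_bounded total_count UNIV (\<lambda>z. ln (F (z(i := z i - 1)) ?t))" for i
    by (rule exp_bounded_ln_F_pred[OF t])
  have sE: "(\<lambda>z. ?p z * E (z, u)) abs_summable_on UNIV"
    by (intro poisson_abs_summable exp_bounded_slice u \<open>exp_bounded ?m ?S E\<close>)
  have sG: "(\<lambda>z. ?p z * gap z u) abs_summable_on UNIV"
    by (intro poisson_abs_summable exp_bounded_gap u)
  define X where "X = (\<lambda>i z. ?p z * (real (z i) * ln (F (z(i := z i - 1)) ?t)))"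
  define Y where "Y = (\<lambda>z. ?p z * ln (F z ?t))"
  have X: "X i abs_summable_on UNIV" for i
    unfolding X_def by (intro poisson_abs_summable exp_bounded_mult exp_bounded_of_nat le_total pred)
  have Y: "Y abs_summable_on UNIV"
    unfolding Y_def by (intro poisson_abs_summable exp_bounded_ln_F t)
  \<comment> \<open>The increment produced by the shift undoes the decrement inside
    \<open>X\<close>, leaving ln F at z itself.\<close>
  have XY: "infsetsum (X i) UNIV = ?t $ i * l $ i * infsetsum Y UNIV" for i
    unfolding X_def Y_def poisson_shift[OF pred] by simp
  have "infsetsum (\<lambda>z. ?p z * E (z, u)) UNIV - infsetsum (\<lambda>z. ?p z * gap z u) UNIV
     = infsetsum (\<lambda>z. ?p z * E (z, u) - ?p z * gap z u) UNIV"
    by (rule infsetsum_diff[OF sE sG, symmetric])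
  also have "\<dots> = infsetsum (\<lambda>z. \<Sum>i\<in>UNIV. \<gamma> $ i * ?t $ i * (X i z - ?t $ i * l $ i * Y z)) UNIV"
  proof (rule infsetsum_cong)
    fix z
    \<comment> \<open>The terms \<open>score\<close> and z_i ln F(z) cancel. What remains is a
      combination of the differences whose means \<open>XY\<close> shows to vanish.\<close>
    have "E (z, u) - gap z u = (\<Sum>i\<in>UNIV. \<gamma> $ i * ?t $ i * (real (z i) * ln (F (z(i := z i - 1)) ?t) - ?t $ i * l $ i * ln (F z ?t)))"
      unfolding E_def gap_def fst_conv snd_conv sum_distrib_right add_diff_add diff_self add_0_right sum_subtractf[symmetric]
      by (intro sum.cong refl) (simp add: algebra_simps)
    then have "?p z * E (z, u) - ?p z * gap z u
      = ?p z * (\<Sum>i\<in>UNIV. \<gamma> $ i * ?t $ i * (real (z i) * ln (F (z(i := z i - 1)) ?t) - ?t $ i * l $ i * ln (F z ?t)))"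
      unfolding right_diff_distrib[symmetric] by simp
    then show "?p z * E (z, u) - ?p z * gap z u = (\<Sum>i\<in>UNIV. \<gamma> $ i * ?t $ i * (X i z - ?t $ i * l $ i * Y z))"
      unfolding X_def Y_def sum_distrib_left by (simp add: right_diff_distrib mult_ac)
  qed simp
  also have "\<dots> = (\<Sum>i\<in>UNIV. infsetsum (\<lambda>z. \<gamma> $ i * ?t $ i * (X i z - ?t $ i * l $ i * Y z)) UNIV)"
    by (intro sum_infsetsum[symmetric] abs_summable_on_cmult_right abs_summable_on_diff X Y)
  also have "\<dots> = 0"
  proof (rule sum.neutral, safe)
    fix i
    have "infsetsum (\<lambda>z. \<gamma> $ i * ?t $ i * (X i z - ?t $ i * l $ i * Y z)) UNIV
      = \<gamma> $ i * ?t $ i * (infsetsum (X i) UNIV - ?t $ i * l $ i * infsetsum Y UNIV)"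
      by (simp only: infsetsum_cmult_right infsetsum_diff abs_summable_on_diff abs_summable_on_cmult_right X Y)
    then show "infsetsum (\<lambda>z. \<gamma> $ i * ?t $ i * (X i z - ?t $ i * l $ i * Y z)) UNIV = 0"
      by (simp add: XY)
  qed
  finally have "infsetsum (\<lambda>z. ?p z * E (z, u)) UNIV = infsetsum (\<lambda>z. ?p z * gap z u) UNIV" by simp
  with D show ?thesis by (simp add: exp_log_def[abs_def] infsetsum_def)
qed

lemma gap_nonneg: "u \<in> {0..1} \<Longrightarrow> 0 \<le> gap z u"
  using gap_star(1)[of u z] star_nonneg[OF curve_in, of u z] F_pos[OF curve_in, of u z]
  by (meson divide_nonneg_pos order_trans)

lemma exp_log_deriv_nonneg:
  assumes "l \<in> pos_orthant" "u \<in> {0..1}"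
  shows "0 \<le> infsetsum (\<lambda>z. poisson_prob (curve u) l z * gap z u) UNIV"
  using assms by (intro infsetsum_nonneg mult_nonneg_nonneg gap_nonneg poisson_prob_nonneg curve_bounds) auto

lemma exp_log_mono:
  assumes l: "l \<in> pos_orthant" and uv: "0 \<le> u" "u \<le> v" "v \<le> 1"
  shows "exp_log l u \<le> exp_log l v"
proof (cases "u = v")
  case False
  have "((exp_log l) has_real_derivative infsetsum (\<lambda>z. poisson_prob (curve w) l z * gap z w) UNIV) (at w within {u..v})"
    if "u \<le> w" "w \<le> v" for w
    by (rule has_field_derivative_subset[OF exp_log_deriv[OF l]]) (use that uv in auto)
  then have "\<exists>w\<in>{u..v}. exp_log l v - exp_log l u = infsetsum (\<lambda>z. poisson_prob (curve w) l z * gap z w) UNIV * (v - u)"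
    unfolding has_field_derivative_def by (intro mvt_very_simple uv) auto
  then obtain w where w: "w \<in> {u..v}"
    "exp_log l v - exp_log l u = infsetsum (\<lambda>z. poisson_prob (curve w) l z * gap z w) UNIV * (v - u)" by blast
  have "0 \<le> infsetsum (\<lambda>z. poisson_prob (curve w) l z * gap z w) UNIV * (v - u)"
    by (intro mult_nonneg_nonneg exp_log_deriv_nonneg l) (use w(1) uv in auto)
  then show ?thesis using w(2) by linarith
qed simp

text \<open>Nonconstancy is assumed at \<open>r\<close>, the start of the path. A pair of neighbours
  with different values makes \<open>gap\<close> positive at one z, and Poisson weights are
  positive, so the derivative at time 0 is positive; afterwards the function does not
  decrease.\<close>

lemma exp_log_strict:
  assumes l: "l \<in> pos_orthant" and ne: "F z r \<noteq> F z' r"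
  shows "exp_log l 0 < exp_log l 1"
proof -
  \<comment> \<open>If F agreed across every edge of the lattice, descending one coordinate at a
    time would give every z the value at the origin.\<close>
  have "\<exists>z i. z i \<noteq> 0 \<and> F z r \<noteq> F (z(i := z i - 1)) r"
  proof (rule ccontr)
    assume "\<not> ?thesis"
    then have c: "F z r = F (z(i := z i - 1)) r" if "z i \<noteq> 0" for z i using that by blast
    have "F z r = F (\<lambda>_. 0) r" for z
    proof (induction "total_count z" arbitrary: z)
      case 0
      then have "z = (\<lambda>_. 0)" by (auto simp: total_count_def)
      then show ?case by simp
    next
      case (Suc n)
      have "\<exists>i. z i \<noteq> 0"
      proof (rule ccontr)
        assume "\<not> ?thesis"
        then show False using Suc(2) by (simp add: total_count_def)
      qed
      then obtain i where i: "z i \<noteq> 0" by blast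
      have "n = total_count (z(i := z i - 1))" using total_upd[of z i "z i - 1"] i Suc(2) by linarith
      from Suc(1)[OF this] c[of z i, OF i] show ?case by simp
    qed
    then show False using ne by metis
  qed
  then obtain z i where zi: "z i \<noteq> 0" "F z r \<noteq> F (z(i := z i - 1)) r" by blast
  have "0 < gap z 0"
    using gap_star(2)[of 0 z i] zi star_nonneg[OF r_in, of z] F_pos[OF r_in, of z] unfolding curve_0
    by (meson divide_nonneg_pos le_less_trans atLeastAtMost_iff order_refl zero_le_one)
  define h where "h = (\<lambda>z. poisson_prob r l z * gap z 0)"
  have "0 < h z" unfolding h_def using \<open>0 < gap z 0\<close> poisson_prob_pos[OF r_pos l] by simp
  also have "h z = infsetsum h {z}" by simp
  also have "\<dots> \<le> infsetsum h UNIV"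
  proof (rule infsetsum_mono_neutral_left)
    show "h abs_summable_on UNIV" unfolding h_def by (intro poisson_abs_summable exp_bounded_gap) simp
    show "0 \<le> h z" for z unfolding h_def
      by (intro mult_nonneg_nonneg gap_nonneg poisson_prob_nonneg r_pos l) auto
  qed auto
  finally have pos: "0 < infsetsum (\<lambda>z. poisson_prob (curve 0) l z * gap z 0) UNIV" unfolding h_def curve_0 .
  obtain d where d: "0 < d" "\<And>h. 0 < h \<Longrightarrow> 0 + h \<in> {0..1} \<Longrightarrow> h < d \<Longrightarrow> exp_log l 0 < exp_log l (0 + h)"
    using has_real_derivative_pos_inc_right[OF exp_log_deriv[OF l] pos] by force
  \<comment> \<open>A time inside both the unit interval and the range of strict increase.\<close>
  define e where "e = min 1 (d / 2)"
  have e: "0 < e" "e \<le> 1" "e < d" using d(1) by (auto simp: e_def)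
  have "exp_log l 0 < exp_log l e" using d(2)[of e] e by simp
  also have "\<dots> \<le> exp_log l 1" by (rule exp_log_mono[OF l]) (use e in auto)
  finally show ?thesis .
qed

end

end

section \<open>Integration on the orthant\<close>

lemma borel_measurable_vec_lambda:
  fixes f :: "'a \<Rightarrow> real ^ 'n::finite"
  assumes "\<And>i. (\<lambda>x. f x $ i) \<in> borel_measurable M"
  shows "f \<in> borel_measurable M"
  by (subst borel_measurable_euclidean_space) (auto simp: Basis_vec_def inner_axis assms)

lemma prod_Basis_vec: "(\<Prod>b\<in>(Basis :: (real ^ 'n::finite) set). h b) = (\<Prod>i\<in>UNIV. h (axis i 1))"
proof -
  have *: "(Basis :: (real ^ 'n) set) = range (\<lambda>i. axis i 1)"
    by (auto simp: Basis_vec_def)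
  have "inj (\<lambda>i :: 'n. axis i (1 :: real))"
    by (auto simp: inj_on_def axis_eq_axis)
  then show ?thesis unfolding * by (simp add: prod.reindex comp_def)
qed

lemma mem_box_vec: "x \<in> box l u \<longleftrightarrow> (\<forall>i. l $ i < x $ i \<and> x $ i < u $ i)" for x :: "real ^ 'n::finite"
  by (auto simp: mem_box Basis_vec_def inner_axis)

lemma lborel_vec_eqI:
  fixes M :: "(real ^ 'n::finite) measure"
  assumes "\<And>l u. (\<And>i. l $ i \<le> u $ i) \<Longrightarrow> emeasure M (box l u) = ennreal (\<Prod>i\<in>UNIV. u $ i - l $ i)"
    and "sets M = sets borel"
  shows "lborel = M"
proof (rule lborel_eqI)
  fix l u :: "real ^ 'n" assume "\<And>b. b \<in> Basis \<Longrightarrow> l \<bullet> b \<le> u \<bullet> b"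
  then have "l $ i \<le> u $ i" for i by (force simp: Basis_vec_def inner_axis)
  from assms(1)[OF this] show "emeasure M (box l u) = ennreal (\<Prod>b\<in>Basis. (u - l) \<bullet> b)"
    by (simp add: prod_Basis_vec inner_axis)
qed (use assms(2) in auto)

interpretation lborel_prod: product_sigma_finite "\<lambda>_ :: 'n::finite. lborel :: real measure"
  by standard

lemma measurable_vec_lambda_PiM [measurable]:
  "(\<lambda>f. \<chi> i. f i) \<in> PiM UNIV (\<lambda>_ :: 'n::finite. lborel :: real measure) \<rightarrow>\<^sub>M borel"
  by (rule borel_measurable_vec_lambda) simp

text \<open>Presents Lebesgue measure on vectors as a product of lines, so that Tonelli and Fubini
  apply one coordinate at a time.\<close>

lemma lborel_vec:
  "(lborel :: (real ^ 'n::finite) measure) = distr (PiM UNIV (\<lambda>_. lborel)) borel (\<lambda>f. \<chi> i. f i)"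
proof (rule lborel_vec_eqI)
  fix l u :: "real ^ 'n" assume le: "\<And>i. l $ i \<le> u $ i"
  have "emeasure (distr (PiM UNIV (\<lambda>_. lborel)) borel (\<lambda>f. \<chi> i. f i)) (box l u)
    = emeasure (PiM UNIV (\<lambda>_ :: 'n. lborel)) (PiE UNIV (\<lambda>i. {l $ i <..< u $ i}))"
    by (subst emeasure_distr) (auto simp: mem_box_vec space_PiM PiE_UNIV_domain Pi_iff intro!: arg_cong2[where f = emeasure])
  also have "\<dots> = (\<Prod>i\<in>UNIV. emeasure lborel {l $ i <..< u $ i})"
    by (rule lborel_prod.emeasure_PiM) auto
  also have "\<dots> = ennreal (\<Prod>i\<in>UNIV. u $ i - l $ i)"
    using le by (simp add: prod_ennreal)
  finally show "emeasure (distr (PiM UNIV (\<lambda>_. lborel)) borel (\<lambda>f. \<chi> i. f i)) (box l u)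
    = ennreal (\<Prod>i\<in>UNIV. u $ i - l $ i)" .
qed simp

lemma nn_integral_lborel_vec_prod:
  fixes h :: "'n::finite \<Rightarrow> real \<Rightarrow> ennreal"
  assumes [measurable]: "\<And>i. h i \<in> borel_measurable borel"
  shows "(\<integral>\<^sup>+ x. (\<Prod>i\<in>UNIV. h i (x $ i)) \<partial>(lborel :: (real ^ 'n) measure)) = (\<Prod>i\<in>UNIV. \<integral>\<^sup>+ u. h i u \<partial>lborel)"
proof -
  have "(\<integral>\<^sup>+ x. (\<Prod>i\<in>UNIV. h i (x $ i)) \<partial>(lborel :: (real ^ 'n) measure))
    = (\<integral>\<^sup>+ f. (\<Prod>i\<in>UNIV. h i (f i)) \<partial>PiM UNIV (\<lambda>_. lborel))"
    by (subst lborel_vec, subst nn_integral_distr) auto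
  also have "\<dots> = (\<Prod>i\<in>UNIV. \<integral>\<^sup>+ u. h i u \<partial>lborel)"
    by (rule lborel_prod.product_nn_integral_prod) auto
  finally show ?thesis .
qed

section \<open>Change of variables between the rates and their scaled square roots\<close>

lemma has_real_derivative_mult_abs: "((\<lambda>x. x * \<bar>x\<bar>) has_real_derivative 2 * \<bar>x\<bar>) (at (x :: real))"
proof -
  consider "x > 0" | "x < 0" | "x = 0" by linarith
  then show ?thesis
  proof cases
    case 1
    have "((\<lambda>x. x * x) has_real_derivative 2 * \<bar>x\<bar>) (at x)"
      by (rule derivative_eq_intros refl | use 1 in simp)+
    then show ?thesis
      by (rule has_field_derivative_transform_within_open[where S = "{0<..}"]) (use 1 in auto)
  next
    case 2
    have "((\<lambda>x. - (x * x)) has_real_derivative 2 * \<bar>x\<bar>) (at x)"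
      by (rule derivative_eq_intros refl | use 2 in simp)+
    then show ?thesis
      by (rule has_field_derivative_transform_within_open[where S = "{..<0}"]) (use 2 in auto)
  next
    case 3
    have "((\<lambda>h :: real. \<bar>h\<bar>) \<longlongrightarrow> \<bar>0\<bar>) (at 0)" by (intro tendsto_intros)
    moreover have "(\<lambda>h :: real. h * \<bar>h\<bar> / h) = (\<lambda>h. \<bar>h\<bar>)" by (rule ext) simp
    ultimately have "((\<lambda>h :: real. h * \<bar>h\<bar> / h) \<longlongrightarrow> 0) (at 0)" by simp
    then show ?thesis using 3 by (simp add: has_field_derivative_iff)
  qed
qed

lemma mult_abs_strict_mono: "x < y \<Longrightarrow> x * \<bar>x\<bar> < y * \<bar>y\<bar>" for x y :: real
proof -
  assume xy: "x < y"
  consider "0 \<le> x" | "x < 0" "0 \<le> y" | "y < 0" by linarith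
  then show ?thesis
  proof cases
    case 1 then show ?thesis using xy by (auto intro: mult_strict_mono)
  next
    case 2
    then have "x * \<bar>x\<bar> < 0" "0 \<le> y * \<bar>y\<bar>" by (auto simp: zero_less_mult_iff)
    then show ?thesis by linarith
  next
    case 3
    then have "(- y) * (- y) < (- x) * (- x)" using xy by (intro mult_strict_mono) auto
    then show ?thesis using xy 3 by simp
  qed
qed

text \<open>The density is the derivative of x -> c x |x|, an increasing bijection of the line. The
  set is therefore an interval, and the fundamental theorem gives the difference of the values at
  its ends.\<close>

lemma nn_integral_signed_square:
  assumes c: "0 < (c :: real)" and lu: "l \<le> u"
  shows "(\<integral>\<^sup>+ x. ennreal (2 * c * \<bar>x\<bar>) * indicator {x. l < c * (x * \<bar>x\<bar>) \<and> c * (x * \<bar>x\<bar>) < u} x \<partial>lborel) = ennreal (u - l)"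
proof -
  \<comment> \<open>The inverse of x -> c x |x|, which locates the ends of the interval.\<close>
  define \<rho> where "\<rho> y = sgn y * sqrt (\<bar>y\<bar> / c)" for y
  have inv: "c * (\<rho> y * \<bar>\<rho> y\<bar>) = y" for y
  proof -
    have "sqrt (\<bar>y\<bar> / c) * sqrt (\<bar>y\<bar> / c) = \<bar>y\<bar> / c" using c by simp
    moreover have "\<bar>\<rho> y\<bar> = \<bar>sgn y\<bar> * sqrt (\<bar>y\<bar> / c)" using c by (simp add: \<rho>_def abs_mult)
    ultimately have "\<rho> y * \<bar>\<rho> y\<bar> = sgn y * \<bar>sgn y\<bar> * (\<bar>y\<bar> / c)"
      unfolding \<rho>_def by (simp only: mult_ac)
    then show ?thesis using c by (auto simp: abs_sgn_eq sgn_mult_abs)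
  qed
  have lt: "c * (x * \<bar>x\<bar>) < c * (y * \<bar>y\<bar>) \<longleftrightarrow> x < y" for x y
    using c mult_abs_strict_mono[of x y] mult_abs_strict_mono[of y x] by (cases x y rule: linorder_cases) auto
  have set: "{x. l < c * (x * \<bar>x\<bar>) \<and> c * (x * \<bar>x\<bar>) < u} = {\<rho> l <..< \<rho> u}"
    using lt[of "\<rho> l"] lt[of _ "\<rho> u"] unfolding inv by auto
  have le: "\<rho> l \<le> \<rho> u" using lt[of "\<rho> u" "\<rho> l"] lu unfolding inv by linarith
  have "(\<integral>\<^sup>+ x. ennreal (2 * c * \<bar>x\<bar>) * indicator {\<rho> l <..< \<rho> u} x \<partial>lborel)
    = (\<integral>\<^sup>+ x. ennreal (2 * c * \<bar>x\<bar>) * indicator {\<rho> l .. \<rho> u} x \<partial>lborel)"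
  proof (rule nn_integral_cong_AE)
    have "AE x in lborel. x \<noteq> \<rho> l" "AE x in lborel. x \<noteq> \<rho> u" by (rule AE_lborel_singleton)+
    then show "AE x in lborel. ennreal (2 * c * \<bar>x\<bar>) * indicator {\<rho> l <..< \<rho> u} x
      = ennreal (2 * c * \<bar>x\<bar>) * indicator {\<rho> l .. \<rho> u} x"
      by eventually_elim (auto simp: indicator_def)
  qed
  also have "\<dots> = ennreal (c * (\<rho> u * \<bar>\<rho> u\<bar>) - c * (\<rho> l * \<bar>\<rho> l\<bar>))"
  proof (rule nn_integral_FTC_Icc)
    fix x
    have "((\<lambda>x. c * (x * \<bar>x\<bar>)) has_real_derivative c * (2 * \<bar>x\<bar>)) (at x)"
      by (intro DERIV_cmult has_real_derivative_mult_abs)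
    then show "((\<lambda>x. c * (x * \<bar>x\<bar>)) has_real_derivative 2 * c * \<bar>x\<bar>) (at x)" by (simp add: mult_ac)
  qed (use c le in auto)
  finally show ?thesis unfolding set inv .
qed

definition signed_square :: "real ^ 'n \<Rightarrow> real ^ 'n \<Rightarrow> real ^ 'n::finite" where
  "signed_square \<gamma> x = (\<chi> i. \<gamma> $ i * (x $ i * \<bar>x $ i\<bar>))"

lemma signed_square_measurable [measurable]: "signed_square \<gamma> \<in> borel_measurable borel"
  by (rule borel_measurable_vec_lambda) (simp add: signed_square_def)

text \<open>The library's change of variables needs a wellordered index type. Extending \<open>\<theta> \<mapsto> \<gamma> \<theta>\<^sup>2\<close> to
  an odd bijection of the whole space lets one characterise the image measure by its values on
  boxes instead.\<close>

lemma lborel_signed_square: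
  fixes \<gamma> :: "real ^ 'n::finite"
  assumes g: "\<And>i. 0 < \<gamma> $ i"
  shows "lborel = distr (density lborel (\<lambda>x. \<Prod>i\<in>UNIV. ennreal (2 * \<gamma> $ i * \<bar>x $ i\<bar>))) borel (signed_square \<gamma>)"
proof (rule lborel_vec_eqI)
  fix l u :: "real ^ 'n" assume le: "\<And>i. l $ i \<le> u $ i"
  let ?D = "\<lambda>x :: real ^ 'n. \<Prod>i\<in>UNIV. ennreal (2 * \<gamma> $ i * \<bar>x $ i\<bar>)"
  let ?I = "\<lambda>i. {x. l $ i < \<gamma> $ i * (x * \<bar>x\<bar>) \<and> \<gamma> $ i * (x * \<bar>x\<bar>) < u $ i}"
  have prod_ind: "(\<Prod>i\<in>UNIV. indicator (?I i) (x $ i) :: ennreal) = indicator (box l u) (signed_square \<gamma> x)" for x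
    by (auto simp: indicator_def mem_box_vec signed_square_def prod_zero_iff intro!: prod.neutral)
  have "emeasure (distr (density lborel ?D) borel (signed_square \<gamma>)) (box l u)
    = (\<integral>\<^sup>+ x. ?D x * indicator (box l u) (signed_square \<gamma> x) \<partial>lborel)"
  proof -
    have "emeasure (distr (density lborel ?D) borel (signed_square \<gamma>)) (box l u)
      = (\<integral>\<^sup>+ x. indicator (box l u) x \<partial>distr (density lborel ?D) borel (signed_square \<gamma>))"
      by (rule nn_integral_indicator[symmetric]) simp
    also have "\<dots> = (\<integral>\<^sup>+ x. ?D x * indicator (box l u) (signed_square \<gamma> x) \<partial>lborel)"
      by (subst nn_integral_distr, simp, simp, subst nn_integral_density) auto
    finally show ?thesis .
  qed
  also have "\<dots> = (\<integral>\<^sup>+ x. (\<Prod>i\<in>UNIV. ennreal (2 * \<gamma> $ i * \<bar>x $ i\<bar>) * indicator (?I i) (x $ i)) \<partial>lborel)"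
    unfolding prod_ind[symmetric] prod.distrib ..
  also have "\<dots> = (\<Prod>i\<in>UNIV. \<integral>\<^sup>+ x. ennreal (2 * \<gamma> $ i * \<bar>x\<bar>) * indicator (?I i) x \<partial>lborel)"
    by (rule nn_integral_lborel_vec_prod) simp
  also have "\<dots> = (\<Prod>i\<in>UNIV. ennreal (u $ i - l $ i))"
    by (intro prod.cong nn_integral_signed_square g le refl)
  also have "\<dots> = ennreal (\<Prod>i\<in>UNIV. u $ i - l $ i)" using le by (simp add: prod_ennreal)
  finally show "emeasure (distr (density lborel ?D) borel (signed_square \<gamma>)) (box l u) = ennreal (\<Prod>i\<in>UNIV. u $ i - l $ i)" .
qed simp

lemma scaled_root_borel [measurable]: "scaled_root \<gamma> \<in> borel_measurable borel"
  by (rule borel_measurable_vec_lambda) (simp add: scaled_root_def)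

lemma signed_square_pos:
  assumes g: "\<And>i. 0 < \<gamma> $ i"
  shows "signed_square \<gamma> x \<in> pos_orthant \<longleftrightarrow> x \<in> pos_orthant"
proof -
  have "0 < \<gamma> $ i * (x $ i * \<bar>x $ i\<bar>) \<longleftrightarrow> 0 < x $ i" for i
    using g[of i] by (auto simp: zero_less_mult_iff)
  then show ?thesis by (simp add: pos_orthant_def signed_square_def)
qed

lemma scaled_root_signed_square:
  assumes g: "\<And>i. 0 < \<gamma> $ i" and x: "x \<in> pos_orthant"
  shows "scaled_root \<gamma> (signed_square \<gamma> x) = x"
proof -
  have "sqrt (\<gamma> $ i * (x $ i * \<bar>x $ i\<bar>) / \<gamma> $ i) = x $ i" for i
    using g[of i] x by (auto simp: pos_orthant_def abs_of_pos real_sqrt_mult_self)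
  then show ?thesis by (simp add: scaled_root_def signed_square_def vec_eq_iff)
qed

lemma nn_integral_signed_square_vec:
  fixes h :: "real ^ 'n::finite \<Rightarrow> ennreal"
  assumes g: "\<And>i. 0 < \<gamma> $ i" and [measurable]: "h \<in> borel_measurable borel"
  shows "(\<integral>\<^sup>+ l\<in>pos_orthant. h l \<partial>lborel)
    = (\<integral>\<^sup>+ x\<in>pos_orthant. h (signed_square \<gamma> x) * (\<Prod>i\<in>UNIV. ennreal (2 * \<gamma> $ i * \<bar>x $ i\<bar>)) \<partial>lborel)"
proof -
  have "(\<integral>\<^sup>+ l. h l * indicator pos_orthant l \<partial>lborel) = (\<integral>\<^sup>+ x. (\<Prod>i\<in>UNIV. ennreal (2 * \<gamma> $ i * \<bar>x $ i\<bar>))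
      * (h (signed_square \<gamma> x) * indicator pos_orthant (signed_square \<gamma> x)) \<partial>lborel)"
    by (subst lborel_signed_square[OF g], subst nn_integral_distr, simp, simp, subst nn_integral_density) auto
  also have "\<dots> = (\<integral>\<^sup>+ x\<in>pos_orthant. h (signed_square \<gamma> x) * (\<Prod>i\<in>UNIV. ennreal (2 * \<gamma> $ i * \<bar>x $ i\<bar>)) \<partial>lborel)"
    by (intro nn_integral_cong) (auto simp: indicator_def signed_square_pos[OF g] mult_ac)
  finally show ?thesis .
qed

text \<open>The coordinate change pulls null sets back to null sets. Hence replacing f by a Borel
  function equal to it almost everywhere changes the weighted prior only on a null set.\<close>

lemma AE_scaled_root:
  assumes g: "\<And>i. 0 < \<gamma> $ i" and AE: "AE x in lborel. x \<in> pos_orthant \<longrightarrow> P x"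
  shows "AE l in lborel. l \<in> pos_orthant \<longrightarrow> P (scaled_root \<gamma> l)"
proof -
  from AE obtain N where N: "{x \<in> space lborel. \<not> (x \<in> pos_orthant \<longrightarrow> P x)} \<subseteq> N" "emeasure lborel N = 0" "N \<in> sets lborel"
    by (rule AE_E)
  have [measurable]: "N \<in> sets borel" using N(3) by simp
  have "(\<integral>\<^sup>+ l\<in>pos_orthant. indicator N (scaled_root \<gamma> l) \<partial>lborel)
    = (\<integral>\<^sup>+ x\<in>pos_orthant. indicator N (scaled_root \<gamma> (signed_square \<gamma> x)) * (\<Prod>i\<in>UNIV. ennreal (2 * \<gamma> $ i * \<bar>x $ i\<bar>)) \<partial>lborel)"
    by (rule nn_integral_signed_square_vec[OF g]) simp
  also have "\<dots> = 0"
  proof (rule nn_integral_0_iff_AE[THEN iffD2])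
    have "AE x in lborel. x \<notin> N" by (rule AE_not_in) (use N in auto)
    then show "AE x in lborel. indicator N (scaled_root \<gamma> (signed_square \<gamma> x)) * (\<Prod>i\<in>UNIV. ennreal (2 * \<gamma> $ i * \<bar>x $ i\<bar>)) * indicator pos_orthant x = 0"
      by eventually_elim (auto simp: indicator_def scaled_root_signed_square[OF g])
  qed simp
  finally have "AE l in lborel. indicator N (scaled_root \<gamma> l) * indicator pos_orthant l = (0 :: ennreal)"
    by (subst (asm) nn_integral_0_iff_AE) auto
  then show ?thesis
  proof eventually_elim
    fix l :: "real ^ 'a" assume "indicator N (scaled_root \<gamma> l) * indicator pos_orthant l = (0 :: ennreal)"
    moreover have "scaled_root \<gamma> l \<in> pos_orthant" if "l \<in> pos_orthant"
      using that g by (auto simp: pos_orthant_def scaled_root_def)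
    ultimately show "l \<in> pos_orthant \<longrightarrow> P (scaled_root \<gamma> l)" using N(1) by (auto simp: indicator_def split: if_splits)
  qed
qed

lemma AE_orthant_pos: "AE x in lborel. x \<in> orthant \<longrightarrow> x \<in> (pos_orthant :: (real ^ 'n::finite) set)"
proof -
  have "AE x in lborel. x $ i \<noteq> (0 :: real)" for i :: 'n
  proof -
    have "(axis i 1 :: real ^ 'n) \<in> Basis" by (simp add: axis_in_Basis_iff)
    from negligible_standard_hyperplane[OF this, of 0]
    have "{x :: real ^ 'n. x $ i = 0} \<in> null_sets lebesgue"
      by (simp add: negligible_iff_null_sets inner_axis)
    moreover have "{x :: real ^ 'n. x $ i = 0} \<in> sets borel" by measurable
    ultimately have "{x :: real ^ 'n. x $ i = 0} \<in> null_sets lborel"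
      by (auto simp: null_sets_def emeasure_completion)
    then have "AE x in lborel. x \<notin> {x :: real ^ 'n. x $ i = 0}" by (rule AE_not_in)
    then show ?thesis by simp
  qed
  then have "AE x in lborel. \<forall>i. (x :: real ^ 'n) $ i \<noteq> 0" by (simp add: AE_all_countable)
  then show ?thesis
    by eventually_elim (auto simp: orthant_def pos_orthant_def less_le)
qed

lemma orthant_closed: "closed (orthant :: (real ^ 'n::finite) set)"
proof -
  have *: "(orthant :: (real ^ 'n) set) = (\<Inter>i\<in>UNIV. {l. 0 \<le> l $ i})" by (auto simp: orthant_def)
  show ?thesis unfolding * by (intro closed_INT ballI closed_Collect_le continuous_intros)
qed

lemma orthant_borel [measurable]: "orthant \<in> sets borel"
  by (rule borel_closed) (rule orthant_closed)

section \<open>Predictive distributions and their risks\<close>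

text \<open>Splitting the power z_i - 1/2 as z_i plus -1/2 separates the Jeffreys prior from a gamma
  density stripped of it.\<close>

lemma gamma_kernel_eq:
  assumes "l \<in> pos_orthant"
  shows "ennreal (\<Prod>i\<in>UNIV. (t $ i) powr (real (z i) + 1 / 2) * (l $ i) powr (real (z i) - 1 / 2)
                   * exp (- (t $ i * l $ i)) / Gamma (real (z i) + 1 / 2))
    = jeffreys_prior l * (ennreal (gamma_norm z t) * ennreal (kern z t l))"
proof -
  have l: "0 < l $ i" for i using assms by (simp add: pos_orthant_def)
  have G: "0 < Gamma (real (z i) + 1 / 2)" for i by (intro Gamma_real_pos) auto
  have g: "0 \<le> gamma_norm z t" unfolding gamma_norm_def
    by (intro prod_nonneg) (use G in \<open>auto intro!: divide_nonneg_nonneg simp: less_imp_le\<close>)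
  have p: "l $ i powr (real (z i) - 1 / 2) = l $ i ^ z i * l $ i powr (- 1 / 2)" for i
    using l[of i] by (simp add: powr_realpow[symmetric] powr_add[symmetric])
  have "(\<Prod>i\<in>UNIV. (t $ i) powr (real (z i) + 1 / 2) * (l $ i) powr (real (z i) - 1 / 2)
                   * exp (- (t $ i * l $ i)) / Gamma (real (z i) + 1 / 2))
    = (\<Prod>i\<in>UNIV. l $ i powr (- 1 / 2) * ((t $ i powr (real (z i) + 1 / 2) / Gamma (real (z i) + 1 / 2)) * (l $ i ^ z i * exp (- (t $ i * l $ i)))))"
    by (intro prod.cong) (auto simp: p)
  also have "\<dots> = (\<Prod>i\<in>UNIV. l $ i powr (- 1 / 2)) * (gamma_norm z t * kern z t l)"
    unfolding prod.distrib gamma_norm_def using assms by (simp add: kern_def exp_sum[symmetric] sum_negf)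
  finally show ?thesis
    unfolding jeffreys_prior_def using g kern_nonneg[of z t l]
    by (simp add: ennreal_mult prod_nonneg)
qed

lemma gamma_mean_weighted_prior:
  "gamma_mean f \<gamma> z t
    = (\<integral>\<^sup>+ l\<in>pos_orthant. weighted_prior f \<gamma> l * (ennreal (gamma_norm z t) * ennreal (kern z t l)) \<partial>lebesgue)"
  unfolding gamma_mean_def weighted_prior_def
proof (intro nn_integral_cong)
  fix l :: "real ^ 'a"
  show "f (scaled_root \<gamma> l) * ennreal (\<Prod>i\<in>UNIV. (t $ i) powr (real (z i) + 1 / 2) * (l $ i) powr (real (z i) - 1 / 2)
        * exp (- (t $ i * l $ i)) / Gamma (real (z i) + 1 / 2)) * indicator pos_orthant l
    = f (scaled_root \<gamma> l) * jeffreys_prior l * (ennreal (gamma_norm z t) * ennreal (kern z t l)) * indicator pos_orthant l"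
  proof (cases "l \<in> pos_orthant")
    case True
    show ?thesis unfolding gamma_kernel_eq[OF True] by (simp only: mult.assoc)
  qed simp
qed

lemma jeffreys_prior_borel [measurable]: "jeffreys_prior \<in> borel_measurable borel"
  unfolding jeffreys_prior_def[abs_def] by measurable

text \<open>States that \<open>\<nu>\<close> has density \<open>\<pi>\<close> on the positive
  orthant. It is phrased through integrals of Borel functions because \<open>\<nu>\<close> is a
  Borel measure while \<open>\<pi>\<close> need only be Lebesgue measurable.\<close>

locale prior_path = poisson_path r s \<gamma> \<nu>
  for r s \<gamma> :: "real ^ 'n::finite" and \<nu> :: "(real ^ 'n) measure" +
  fixes \<pi> :: "real ^ 'n \<Rightarrow> ennreal"
  assumes nn_integral_nu: "\<And>h :: real ^ 'n \<Rightarrow> ennreal. h \<in> borel_measurable borel \<Longrightarrow>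
    (\<integral>\<^sup>+ l. h l \<partial>\<nu>) = (\<integral>\<^sup>+ l\<in>pos_orthant. \<pi> l * h l \<partial>lebesgue)"
begin

lemma nn_integral_kern:
  assumes "t \<in> pos_orthant"
  shows "(\<integral>\<^sup>+ l\<in>pos_orthant. \<pi> l * (ennreal c * ennreal (kern z t l)) \<partial>lebesgue) = ennreal c * ennreal (moment z t)"
proof -
  have "(\<integral>\<^sup>+ l\<in>pos_orthant. \<pi> l * (ennreal c * ennreal (kern z t l)) \<partial>lebesgue) = (\<integral>\<^sup>+ l. ennreal c * ennreal (kern z t l) \<partial>\<nu>)"
    by (rule nn_integral_nu[symmetric]) simp
  also have "\<dots> = ennreal c * (\<integral>\<^sup>+ l. ennreal (kern z t l) \<partial>\<nu>)"
    by (rule nn_integral_cmult) simp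
  also have "(\<integral>\<^sup>+ l. ennreal (kern z t l) \<partial>\<nu>) = ennreal (moment z t)"
    unfolding moment_def by (rule nn_integral_eq_integral) (auto simp: integrable_kern assms kern_nonneg)
  finally show ?thesis .
qed

text \<open>The likelihoods multiply to one kernel with exponents x + y and rates
  \<open>r + s\<close>, so the predictive probability is a quotient of two moments. Normalising them
  isolates the quotient of the F values, which is 1 for the Jeffreys prior.\<close>

lemma predictive_eq:
  "predictive r s \<pi> y x = (\<Prod>i\<in>UNIV. (s $ i) ^ y i / fact (y i)) * (gamma_norm x r / gamma_norm (\<lambda>i. x i + y i) (r + s))
    * (F (\<lambda>i. x i + y i) (r + s) / F x r)"
proof -
  define P where "P = (\<lambda>(c :: real ^ 'n) z. \<Prod>i\<in>UNIV. (c $ i) ^ z i / fact (z i))"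
  have P: "0 < P r x" "0 < P s y" unfolding P_def using r_pos s_pos by (auto intro!: prod_pos)
  have po: "poisson_prob c l z = P c z * kern z c l" if "l \<in> pos_orthant" for c l z
    unfolding poisson_prob_alt P_def using that
    by (simp add: kern_def power_mult_distrib prod.distrib prod_dividef)
  have 1: "(\<integral>\<^sup>+ l\<in>pos_orthant. ennreal (poisson_prob r l x) * \<pi> l \<partial>lebesgue) = ennreal (P r x) * ennreal (moment x r)"
    unfolding nn_integral_kern[OF r_in, symmetric]
    by (intro nn_integral_cong) (use P in \<open>auto simp: indicator_def po ennreal_mult kern_nonneg mult_ac\<close>)
  have k: "kern x r l * kern y s l = kern (\<lambda>i. x i + y i) (r + s) l" for l
    by (simp add: kern_def power_add prod.distrib sum.distrib distrib_left distrib_right exp_add[symmetric] mult_ac)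
  have 2: "(\<integral>\<^sup>+ l\<in>pos_orthant. ennreal (poisson_prob r l x) * ennreal (poisson_prob s l y) * \<pi> l \<partial>lebesgue)
    = ennreal (P r x * P s y) * ennreal (moment (\<lambda>i. x i + y i) (r + s))"
    unfolding nn_integral_kern[OF rs_in, symmetric]
  proof (intro nn_integral_cong)
    fix l
    have "ennreal (P r x * kern x r l) * ennreal (P s y * kern y s l) * \<pi> l
      = \<pi> l * (ennreal (P r x * P s y) * ennreal (kern x r l * kern y s l))"
      using P by (simp add: ennreal_mult kern_nonneg mult_ac)
    then show "ennreal (poisson_prob r l x) * ennreal (poisson_prob s l y) * \<pi> l * indicator pos_orthant l
      = \<pi> l * (ennreal (P r x * P s y) * ennreal (kern (\<lambda>i. x i + y i) (r + s) l)) * indicator pos_orthant l"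
      unfolding k by (auto simp: indicator_def po)
  qed
  have m: "0 < moment x r" "0 < moment (\<lambda>i. x i + y i) (r + s)" by (intro moment_pos r_in rs_in)+
  have g: "0 < gamma_norm x r" "0 < gamma_norm (\<lambda>i. x i + y i) (r + s)" by (intro gamma_norm_pos r_in rs_in)+
  have "predictive r s \<pi> y x = P r x * P s y * moment (\<lambda>i. x i + y i) (r + s) / (P r x * moment x r)"
    unfolding predictive_def 1 2 using P m
    by (simp add: ennreal_mult[symmetric] divide_ennreal)
  also have "\<dots> = P s y * (gamma_norm x r / gamma_norm (\<lambda>i. x i + y i) (r + s)) * (F (\<lambda>i. x i + y i) (r + s) / F x r)"
    unfolding F_def using P m g by (simp add: field_simps)
  finally show ?thesis unfolding P_def .
qed

lemma gamma_mean_eq: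
  assumes pi: "\<pi> = weighted_prior f g" and t: "t \<in> pos_orthant"
  shows "gamma_mean f g z t = ennreal (F z t)"
proof -
  have "gamma_mean f g z t = (\<integral>\<^sup>+ l\<in>pos_orthant. \<pi> l * (ennreal (gamma_norm z t) * ennreal (kern z t l)) \<partial>lebesgue)"
    unfolding pi by (rule gamma_mean_weighted_prior)
  also have "\<dots> = ennreal (F z t)"
    unfolding nn_integral_kern[OF t] F_def using gamma_norm_pos[OF t] moment_pos[OF t]
    by (simp add: ennreal_mult less_imp_le)
  finally show ?thesis .
qed

end

lemma weight_measure_exists:
  fixes r s \<gamma> :: "real ^ 'n::finite" and f :: "real ^ 'n \<Rightarrow> ennreal"
  assumes r_pos: "\<And>i. 0 < r $ i" and s_pos: "\<And>i. 0 < s $ i"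
    and gamma: "\<And>i. \<gamma> $ i = 1 / r $ i - 1 / (r $ i + s $ i)"
    and f_meas: "f \<in> borel_measurable (lebesgue_on orthant)"
    and f_nonzero: "\<not> (AE \<theta> in lebesgue_on orthant. f \<theta> = 0)"
    and F_finite: "\<And>z t. t \<in> pos_orthant \<Longrightarrow> gamma_mean f \<gamma> z t < \<infinity>"
  shows "\<exists>\<nu>. prior_path r s \<gamma> \<nu> (weighted_prior f \<gamma>)"
proof -
  have g: "0 < \<gamma> $ i" for i
    unfolding gamma using r_pos[of i] s_pos[of i] by (simp add: frac_less2)
  have orth: "orthant \<inter> space lebesgue \<in> sets (lebesgue :: (real ^ 'n) measure)" by simp
  have "(\<lambda>x. if x \<in> orthant then f x else 0) \<in> borel_measurable lebesgue"
    using f_meas by (subst (asm) measurable_restrict_space_iff[OF orth, of 0]) auto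
  \<comment> \<open>\<open>f\<close> is only Lebesgue measurable and given on the orthant; the
    construction uses a Borel representative of its extension by 0.\<close>
  from completion_ex_borel_measurable[OF this]
  obtain f' where [measurable]: "f' \<in> borel_measurable borel"
    and AE': "AE x in lborel. (if x \<in> orthant then f x else 0) = f' x" by auto
  have ff': "AE x in lborel. x \<in> pos_orthant \<longrightarrow> f x = f' x"
    using AE' by eventually_elim (auto simp: orthant_def pos_orthant_def less_imp_le)
  define w where "w = (\<lambda>l. f' (scaled_root \<gamma> l) * jeffreys_prior l * indicator pos_orthant l)"
  have [measurable]: "w \<in> borel_measurable borel" unfolding w_def by measurable
  define \<nu> where "\<nu> = density lborel w"
  have nn: "(\<integral>\<^sup>+ l. h l \<partial>\<nu>) = (\<integral>\<^sup>+ l\<in>pos_orthant. weighted_prior f \<gamma> l * h l \<partial>lebesgue)"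
    if [measurable]: "h \<in> borel_measurable borel" for h :: "real ^ 'n \<Rightarrow> ennreal"
  proof -
    have "(\<integral>\<^sup>+ l. h l \<partial>\<nu>) = (\<integral>\<^sup>+ l. w l * h l \<partial>lborel)"
      unfolding \<nu>_def by (rule nn_integral_density) auto
    also have "\<dots> = (\<integral>\<^sup>+ l\<in>pos_orthant. weighted_prior f \<gamma> l * h l \<partial>lborel)"
    proof (rule nn_integral_cong_AE)
      show "AE l in lborel. w l * h l = weighted_prior f \<gamma> l * h l * indicator pos_orthant l"
        using AE_scaled_root[OF g ff']
        by eventually_elim (auto simp: w_def weighted_prior_def indicator_def)
    qed
    finally show ?thesis by (simp add: nn_integral_completion)
  qed
  have "prior_path r s \<gamma> \<nu> (weighted_prior f \<gamma>)"
  proof (unfold_locales; (fact assms)?)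
    show "sets \<nu> = sets borel" by (simp add: \<nu>_def)
    show "AE l in \<nu>. l \<in> pos_orthant"
      unfolding \<nu>_def by (subst AE_density) (auto simp: w_def indicator_def intro!: AE_I2 split: if_splits)
    \<comment> \<open>If the mass were 0, the change of variables would carry this back to theta;
      the Jacobian and the Jeffreys factor are positive there, so f would vanish almost
      everywhere.\<close>
    show "emeasure \<nu> UNIV \<noteq> 0"
    proof
      assume "emeasure \<nu> UNIV = 0"
      then have "(\<integral>\<^sup>+ l\<in>pos_orthant. f' (scaled_root \<gamma> l) * jeffreys_prior l \<partial>lborel) = 0"
        unfolding \<nu>_def by (simp add: emeasure_density w_def)
      then have "(\<integral>\<^sup>+ x\<in>pos_orthant. (f' (scaled_root \<gamma> (signed_square \<gamma> x)) * jeffreys_prior (signed_square \<gamma> x))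
          * (\<Prod>i\<in>UNIV. ennreal (2 * \<gamma> $ i * \<bar>x $ i\<bar>)) \<partial>lborel) = 0"
        by (subst (asm) nn_integral_signed_square_vec[OF g]) auto
      then have "AE x in lborel. (f' (scaled_root \<gamma> (signed_square \<gamma> x)) * jeffreys_prior (signed_square \<gamma> x))
          * (\<Prod>i\<in>UNIV. ennreal (2 * \<gamma> $ i * \<bar>x $ i\<bar>)) * indicator pos_orthant x = 0"
        by (subst (asm) nn_integral_0_iff_AE) auto
      then have "AE x in lborel. x \<in> pos_orthant \<longrightarrow> f' x = 0"
      proof eventually_elim
        fix x :: "real ^ 'n"
        assume 0: "(f' (scaled_root \<gamma> (signed_square \<gamma> x)) * jeffreys_prior (signed_square \<gamma> x))
          * (\<Prod>i\<in>UNIV. ennreal (2 * \<gamma> $ i * \<bar>x $ i\<bar>)) * indicator pos_orthant x = 0"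
        show "x \<in> pos_orthant \<longrightarrow> f' x = 0"
        proof
          assume x: "x \<in> pos_orthant"
          then have "signed_square \<gamma> x \<in> pos_orthant" by (simp add: signed_square_pos[OF g])
          then have "0 < (\<Prod>i\<in>UNIV. signed_square \<gamma> x $ i powr (- 1 / 2))"
            by (intro prod_pos) (auto simp: pos_orthant_def less_imp_neq[symmetric])
          then have "jeffreys_prior (signed_square \<gamma> x) \<noteq> 0"
            unfolding jeffreys_prior_def by (metis ennreal_eq_0_iff not_le)
          moreover have "(\<Prod>i\<in>UNIV. ennreal (2 * \<gamma> $ i * \<bar>x $ i\<bar>)) \<noteq> 0"
          proof -
            have "0 < 2 * \<gamma> $ i * \<bar>x $ i\<bar>" for i using g[of i] x by (simp add: pos_orthant_def less_imp_neq[symmetric])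
            then have "ennreal (2 * \<gamma> $ i * \<bar>x $ i\<bar>) \<noteq> 0" for i by (metis ennreal_eq_0_iff not_le)
            then show ?thesis by (simp add: prod_zero_iff)
          qed
          ultimately show "f' x = 0" using 0 x by (simp add: scaled_root_signed_square[OF g])
        qed
      qed
      with ff' AE_orthant_pos have "AE x in lborel. x \<in> orthant \<longrightarrow> f x = 0"
        by eventually_elim auto
      then have "AE x in lebesgue. x \<in> orthant \<longrightarrow> f x = 0" by (rule AE_completion)
      then have "AE x in lebesgue_on orthant. f x = 0"
        by (subst AE_restrict_space_iff[OF orth]) auto
      then show False using f_nonzero by blast
    qed
    fix z and t :: "real ^ 'n" assume t: "t \<in> pos_orthant"
    \<comment> \<open>The normalised moment is F(z, t), which is finite by assumption; dividing by
      the positive normalisation gives integrability.\<close>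
    have "ennreal (gamma_norm z t) * (\<integral>\<^sup>+ l. ennreal (kern z t l) \<partial>\<nu>) = (\<integral>\<^sup>+ l. ennreal (gamma_norm z t) * ennreal (kern z t l) \<partial>\<nu>)"
      by (rule nn_integral_cmult[symmetric]) (simp add: \<nu>_def)
    also have "\<dots> = (\<integral>\<^sup>+ l\<in>pos_orthant. weighted_prior f \<gamma> l * (ennreal (gamma_norm z t) * ennreal (kern z t l)) \<partial>lebesgue)"
      by (rule nn) simp
    also have "\<dots> = gamma_mean f \<gamma> z t"
      by (rule gamma_mean_weighted_prior[symmetric])
    also have "\<dots> < \<infinity>" by (rule F_finite[OF t])
    finally have "(\<integral>\<^sup>+ l. ennreal (kern z t l) \<partial>\<nu>) < \<infinity>"
      using gamma_norm_pos[OF t, of z] by (auto simp: ennreal_mult_less_top)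
    then show "integrable \<nu> (kern z t)"
      by (intro integrableI_nonneg) (auto simp: kern_nonneg \<nu>_def)
  qed (rule nn)
  then show ?thesis by blast
qed

text \<open>For the weight 1 the integrand is a product of gamma probability densities. This makes F
  constant for the Jeffreys prior.\<close>

lemma gamma_mean_const_1:
  fixes t :: "real ^ 'n::finite"
  assumes t: "t \<in> pos_orthant"
  shows "gamma_mean (\<lambda>_. 1) \<gamma> z t = 1"
proof -
  define h where "h i u = ennreal (t $ i powr (real (z i) + 1 / 2) * u powr (real (z i) - 1 / 2)
     * exp (- (t $ i * u)) / Gamma (real (z i) + 1 / 2)) * indicator {0<..} u" for i u
  have [measurable]: "h i \<in> borel_measurable borel" for i unfolding h_def by measurable
  have G: "0 < Gamma (real (z i) + 1 / 2)" for i by (intro Gamma_real_pos) auto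
  have one: "(\<integral>\<^sup>+ u. h i u \<partial>lborel) = 1" for i
  proof -
    define a where "a = real (z i) + 1 / 2"
    have a: "0 < a" "0 < Gamma a" using G[of i] by (auto simp: a_def)
    have ti: "0 < t $ i" using t by (simp add: pos_orthant_def)
    \<comment> \<open>Prepares the substitution v = t_i u in Euler's integral; the summand 0 is the
      offset of that affine map. The point u = 0 is left out because one indicator is open there and
      the other closed.\<close>
    have e: "h i u = ennreal (t $ i / Gamma a) * ennreal (indicator {0..} (0 + t $ i * u) * (0 + t $ i * u) powr (a - 1) / exp (0 + t $ i * u))"
      if "u \<noteq> 0" for u
    proof (cases "0 < u")
      case True
      have "t $ i powr a * u powr (a - 1) = t $ i * (t $ i * u) powr (a - 1)"
        using ti True powr_add[of "t $ i" 1 "a - 1"] by (simp add: powr_mult)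
      moreover have ea: "real (z i) - 1 / 2 = a - 1" "real (z i) + 1 / 2 = a" by (simp_all add: a_def)
      ultimately show ?thesis
        using ti True a unfolding h_def ea by (simp add: ennreal_mult[symmetric] exp_minus field_simps)
    next
      case False
      then have "t $ i * u < 0" using ti that by (simp add: mult_pos_neg)
      then show ?thesis using False by (simp add: h_def)
    qed
    have "(\<integral>\<^sup>+ u. h i u \<partial>lborel) = (\<integral>\<^sup>+ u. ennreal (t $ i / Gamma a) *
        ennreal (indicator {0..} (0 + t $ i * u) * (0 + t $ i * u) powr (a - 1) / exp (0 + t $ i * u)) \<partial>lborel)"
    proof (rule nn_integral_cong_AE)
      have "AE u in lborel. u \<noteq> (0 :: real)" by (rule AE_lborel_singleton)
      then show "AE u in lborel. h i u = ennreal (t $ i / Gamma a) *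
        ennreal (indicator {0..} (0 + t $ i * u) * (0 + t $ i * u) powr (a - 1) / exp (0 + t $ i * u))"
        by eventually_elim (rule e)
    qed
    also have "\<dots> = ennreal (t $ i / Gamma a) * (\<integral>\<^sup>+ u. ennreal (indicator {0..} (0 + t $ i * u) * (0 + t $ i * u) powr (a - 1) / exp (0 + t $ i * u)) \<partial>lborel)"
      by (rule nn_integral_cmult) simp
    also have "\<dots> = ennreal (1 / Gamma a) * (ennreal \<bar>t $ i\<bar> * (\<integral>\<^sup>+ u. ennreal (indicator {0..} (0 + t $ i * u) * (0 + t $ i * u) powr (a - 1) / exp (0 + t $ i * u)) \<partial>lborel))"
    proof -
      have "ennreal (t $ i / Gamma a) = ennreal (1 / Gamma a) * ennreal \<bar>t $ i\<bar>"
        using ti a by (simp add: ennreal_mult[symmetric])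
      then show ?thesis by (simp only: mult.assoc)
    qed
    also have "ennreal \<bar>t $ i\<bar> * (\<integral>\<^sup>+ u. ennreal (indicator {0..} (0 + t $ i * u) * (0 + t $ i * u) powr (a - 1) / exp (0 + t $ i * u)) \<partial>lborel)
      = (\<integral>\<^sup>+ v. ennreal (indicator {0..} v * v powr (a - 1) / exp v) \<partial>lborel)"
      by (rule nn_integral_real_affine[symmetric]) (use ti in auto)
    also have "\<dots> = ennreal (Gamma a)" using Gamma_conv_nn_integral_real[OF a(1)] by simp
    also have "ennreal (1 / Gamma a) * ennreal (Gamma a) = 1"
      using a less_imp_neq[OF a(2)] by (simp add: ennreal_mult[symmetric])
    finally show ?thesis .
  qed
  have "gamma_mean (\<lambda>_. 1) \<gamma> z t = (\<integral>\<^sup>+ l. (\<Prod>i\<in>UNIV. h i (l $ i)) \<partial>lborel)"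
    unfolding gamma_mean_def nn_integral_completion
  proof (intro nn_integral_cong)
    fix l :: "real ^ 'n"
    have "indicator pos_orthant l = (\<Prod>i\<in>UNIV. indicator {0<..} (l $ i) :: ennreal)"
      by (auto simp: indicator_def pos_orthant_def prod_zero_iff intro!: prod.neutral)
    then show "1 * ennreal (\<Prod>i\<in>UNIV. t $ i powr (real (z i) + 1 / 2) * l $ i powr (real (z i) - 1 / 2)
         * exp (- (t $ i * l $ i)) / Gamma (real (z i) + 1 / 2)) * indicator pos_orthant l = (\<Prod>i\<in>UNIV. h i (l $ i))"
      unfolding h_def prod.distrib using G
      by (simp add: prod_ennreal[symmetric] less_imp_le)
  qed
  also have "\<dots> = 1" by (subst nn_integral_lborel_vec_prod) (auto simp: one)
  finally show ?thesis .
qed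

text \<open>Absolute summability turns the nested extended sums into real ones and merges them into
  one sum over pairs, which can then be rearranged along x + y.\<close>

lemma kl_risk_eq_infsetsum:
  fixes r s l :: "real ^ 'n::finite"
  assumes r: "\<And>i. 0 < r $ i" and s: "\<And>i. 0 < s $ i" and l: "l \<in> pos_orthant"
    and q: "\<And>x y. 0 < q y x"
    and h: "\<And>x y. h (x, y) = ln (poisson_prob s l y / q y x)"
    and eb: "exp_bounded total_count2 UNIV h"
  shows "kl_risk r s q l
    = ereal (infsetsum (\<lambda>(x, y). poisson_prob r l x * (poisson_prob s l y * h (x, y))) (UNIV \<times> UNIV))"
proof -
  let ?p = "poisson_prob r l" and ?q = "poisson_prob s l"
  have sum: "(\<lambda>(x, y). ?p x * (?q y * h (x, y))) abs_summable_on (UNIV \<times> UNIV)"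
    by (rule poisson_pair_abs_summable[OF eb])
  have inner: "(\<lambda>y. ?q y * h (x, y)) abs_summable_on UNIV" for x
    by (intro poisson_abs_summable exp_bounded_compose[OF eb, where c = "total_count x"])
      (auto simp: total_count2_def)
  have kl: "kl_term (?q y) (q y x) = ereal (?q y * h (x, y))" for x y
    using poisson_prob_pos[OF s l, of y] q[of y x] by (simp add: kl_term_def h)
  have outer: "(\<lambda>x. infsetsum (\<lambda>y. ?p x * (?q y * h (x, y))) UNIV) abs_summable_on UNIV"
    by (rule abs_summable_on_Sigma_project1'[OF sum]) auto
  have e: "infsetsum (\<lambda>y. ?p x * (?q y * h (x, y))) UNIV = ?p x * infsetsum (\<lambda>y. ?q y * h (x, y)) UNIV" for x
    by (rule infsetsum_cmult_right) (rule inner)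
  have "kl_risk r s q l = ext_sum (\<lambda>x. ereal (?p x * infsetsum (\<lambda>y. ?q y * h (x, y)) UNIV))"
    unfolding kl_risk_def kl by (simp add: ext_sum_ereal[OF inner])
  also have "\<dots> = ereal (infsetsum (\<lambda>x. ?p x * infsetsum (\<lambda>y. ?q y * h (x, y)) UNIV) UNIV)"
    by (rule ext_sum_ereal) (use outer in \<open>simp add: e\<close>)
  also have "infsetsum (\<lambda>x. ?p x * infsetsum (\<lambda>y. ?q y * h (x, y)) UNIV) UNIV
    = infsetsum (\<lambda>(x, y). ?p x * (?q y * h (x, y))) (UNIV \<times> UNIV)"
    unfolding e[symmetric] by (subst infsetsum_Times) (use sum in auto)
  finally show ?thesis .
qed

text \<open>The factor left in \<open>predictive_eq\<close> when F is 1: a product of negative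
  binomial probabilities with shapes x_i + 1/2.\<close>

definition jeffreys_predictive :: "real ^ 'n \<Rightarrow> real ^ 'n \<Rightarrow> ('n::finite \<Rightarrow> nat) \<Rightarrow> ('n \<Rightarrow> nat) \<Rightarrow> real" where
  "jeffreys_predictive r s y x =
    (\<Prod>i\<in>UNIV. (s $ i) ^ y i / fact (y i)) * (gamma_norm x r / gamma_norm (\<lambda>i. x i + y i) (r + s))"

definition log_ratio :: "real ^ 'n \<Rightarrow> real ^ 'n \<Rightarrow> real ^ 'n \<Rightarrow> ('n::finite \<Rightarrow> nat) \<times> ('n \<Rightarrow> nat) \<Rightarrow> real" where
  "log_ratio r s l p = ln (poisson_prob s l (snd p) / jeffreys_predictive r s (snd p) (fst p))"

lemma jeffreys_predictive_pos:
  assumes "\<And>i. 0 < r $ i" "\<And>i. 0 < s $ i"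
  shows "0 < jeffreys_predictive r s y x"
  unfolding jeffreys_predictive_def
  by (intro mult_pos_pos prod_pos divide_pos_pos gamma_norm_pos) (auto simp: pos_orthant_def assms add_pos_pos)

text \<open>The factors s_i^(y_i) / y_i! cancel between numerator and denominator. There remain a
  constant, a term linear in y and logarithms of gamma normalisations.\<close>

lemma exp_bounded_log_ratio:
  assumes r: "\<And>i. 0 < r $ i" and s: "\<And>i. 0 < s $ i" and l: "l \<in> pos_orthant"
  shows "exp_bounded total_count2 UNIV (log_ratio r s l)"
proof -
  have r_in: "r \<in> pos_orthant" and rs_in: "r + s \<in> pos_orthant"
    using r s by (auto simp: pos_orthant_def intro: add_pos_pos)
  have li: "0 < l $ i" for i using l by (simp add: pos_orthant_def)
  have eq: "log_ratio r s l (x, y) = - (\<Sum>i\<in>UNIV. s $ i * l $ i) + (\<Sum>i\<in>UNIV. real (y i) * ln (l $ i))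
      - ln (gamma_norm x r) + ln (gamma_norm (\<lambda>i. x i + y i) (r + s))" for x y
  proof -
    define P where "P = (\<Prod>i\<in>UNIV. (s $ i) ^ y i / fact (y i))"
    define L where "L = (\<Prod>i\<in>UNIV. (l $ i) ^ y i)"
    have pos: "0 < P" "0 < L" "0 < gamma_norm x r" "0 < gamma_norm (\<lambda>i. x i + y i) (r + s)"
      unfolding P_def L_def using s li by (auto intro!: prod_pos gamma_norm_pos r_in rs_in)
    have pp: "poisson_prob s l y = exp (- (\<Sum>i\<in>UNIV. s $ i * l $ i)) * (P * L)"
      unfolding poisson_prob_alt P_def L_def prod.distrib[symmetric] by (simp add: power_mult_distrib)
    have "poisson_prob s l y / jeffreys_predictive r s y x
      = exp (- (\<Sum>i\<in>UNIV. s $ i * l $ i)) * L / gamma_norm x r * gamma_norm (\<lambda>i. x i + y i) (r + s)"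
      unfolding jeffreys_predictive_def pp P_def[symmetric] using pos by (simp add: field_simps)
    then have "log_ratio r s l (x, y) = ln (exp (- (\<Sum>i\<in>UNIV. s $ i * l $ i)) * L / gamma_norm x r * gamma_norm (\<lambda>i. x i + y i) (r + s))"
      by (simp add: log_ratio_def)
    also have "\<dots> = - (\<Sum>i\<in>UNIV. s $ i * l $ i) + ln L - ln (gamma_norm x r) + ln (gamma_norm (\<lambda>i. x i + y i) (r + s))"
      using pos by (simp add: ln_mult_pos ln_divide_pos)
    also have "ln L = (\<Sum>i\<in>UNIV. real (y i) * ln (l $ i))"
      unfolding L_def by (subst ln_prod) (auto simp: li less_imp_neq[OF li, symmetric] ln_realpow)
    finally show ?thesis .
  qed
  have le: "fst p i \<le> total_count2 p" "snd p i \<le> total_count2 p" "fst p i + snd p i \<le> total_count2 p"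
    for p :: "('a \<Rightarrow> nat) \<times> ('a \<Rightarrow> nat)" and i
    using le_total[of "fst p" i] le_total[of "snd p" i] by (auto simp: total_count2_def)
  have "exp_bounded total_count2 UNIV (\<lambda>p. - (\<Sum>i\<in>UNIV. s $ i * l $ i) + (\<Sum>i\<in>UNIV. real (snd p i) * ln (l $ i))
      - ln (gamma_norm (fst p) r) + ln (gamma_norm (\<lambda>i. fst p i + snd p i) (r + s)))"
    unfolding ln_gamma_norm[OF r_in] ln_gamma_norm[OF rs_in]
    by (intro exp_bounded_add exp_bounded_diff exp_bounded_sum exp_bounded_mult exp_bounded_const
        exp_bounded_of_nat exp_bounded_ln_Gamma le)
  then show ?thesis by (rule exp_bounded_mono) (simp add: eq[of "fst p" "snd p" for p, simplified])
qed

context poisson_path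
begin

text \<open>The log loss is that of the Jeffreys predictive minus ln F(x + y, r + s) plus ln F(x,
  r). The former depends on the total count only, which is Poisson with rates \<open>r + s\<close>,
  the end of the path; the latter on x only, at its start.\<close>

lemma kl_risk_weighted:
  assumes l: "l \<in> pos_orthant"
    and q: "\<And>x y. q y x = jeffreys_predictive r s y x * (F (\<lambda>i. x i + y i) (r + s) / F x r)"
  shows "kl_risk r s q l = ereal (infsetsum (\<lambda>(x, y). poisson_prob r l x * (poisson_prob s l y * log_ratio r s l (x, y))) (UNIV \<times> UNIV)
    - (exp_log l 1 - exp_log l 0))"
proof -
  let ?p = "poisson_prob r l" and ?q = "poisson_prob s l"
  define h1 :: "('n \<Rightarrow> nat) \<times> ('n \<Rightarrow> nat) \<Rightarrow> real" where "h1 = (\<lambda>p. ln (F (fst p) r))"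
  define h2 :: "('n \<Rightarrow> nat) \<times> ('n \<Rightarrow> nat) \<Rightarrow> real" where "h2 = (\<lambda>p. ln (F (\<lambda>i. fst p i + snd p i) (r + s)))"
  have e1: "exp_bounded total_count2 UNIV h1" unfolding h1_def
    by (rule exp_bounded_compose[OF exp_bounded_ln_F[OF r_in], where c = 0]) (auto simp: total_count2_def)
  have e2: "exp_bounded total_count2 UNIV h2" unfolding h2_def
    by (rule exp_bounded_compose[OF exp_bounded_ln_F[OF rs_in], where c = 0])
      (auto simp: total_count2_def total_count_def sum.distrib)
  have Fp: "0 < F z r" "0 < F z (r + s)" for z by (intro F_pos r_in rs_in)+
  have jp: "0 < jeffreys_predictive r s y x" for x y by (rule jeffreys_predictive_pos[OF r_pos s_pos])
  have pp: "0 < ?q y" for y by (rule poisson_prob_pos[OF s_pos l])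
  define h where "h = (\<lambda>p. log_ratio r s l p - h2 p + h1 p)"
  have h: "h (x, y) = ln (?q y / q y x)" for x y
    unfolding h_def h1_def h2_def log_ratio_def q using Fp jp pp by (simp add: ln_mult_pos ln_divide_pos)
  have eb: "exp_bounded total_count2 UNIV (log_ratio r s l)"
    by (rule exp_bounded_log_ratio[OF r_pos s_pos l])
  have eh: "exp_bounded total_count2 UNIV h"
    unfolding h_def by (intro exp_bounded_add exp_bounded_diff eb e1 e2)
  define I where "I = (\<lambda>h. infsetsum (\<lambda>(x, y). ?p x * (?q y * h (x, y))) (UNIV \<times> UNIV))"
  have "kl_risk r s q l = ereal (I h)"
    unfolding I_def
    by (rule kl_risk_eq_infsetsum[OF r_pos s_pos l _ h eh]) (auto simp: q Fp jp)
  also have "I h = I (log_ratio r s l) - I h2 + I h1"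
  proof -
    have s: "(\<lambda>(x, y). ?p x * (?q y * h (x, y))) abs_summable_on (UNIV \<times> UNIV)" if "exp_bounded total_count2 UNIV h" for h
      by (rule poisson_pair_abs_summable[OF that])
    have "I h = infsetsum (\<lambda>z. (case z of (x, y) \<Rightarrow> ?p x * (?q y * log_ratio r s l (x, y)))
        - (case z of (x, y) \<Rightarrow> ?p x * (?q y * h2 (x, y))) + (case z of (x, y) \<Rightarrow> ?p x * (?q y * h1 (x, y)))) (UNIV \<times> UNIV)"
      unfolding I_def h_def by (intro infsetsum_cong) (auto simp: algebra_simps)
    also have "\<dots> = I (log_ratio r s l) - I h2 + I h1"
      unfolding I_def by (simp only: infsetsum_add infsetsum_diff s eb e1 e2 abs_summable_on_diff)
    finally show ?thesis .
  qed
  also have "I h2 = exp_log l 1"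
  proof -
    have "I h2 = infsetsum (\<lambda>z. poisson_prob (r + s) l z * ln (F z (r + s))) UNIV"
      unfolding I_def h2_def fst_conv snd_conv by (rule poisson_convolution[OF exp_bounded_ln_F[OF rs_in]])
    then show ?thesis by (simp add: exp_log_def curve_1)
  qed
  also have "I h1 = exp_log l 0"
  proof -
    have "I h1 = infsetsum (\<lambda>x. infsetsum (\<lambda>y. ?p x * (?q y * h1 (x, y))) UNIV) UNIV"
      unfolding I_def by (subst infsetsum_Times) (use poisson_pair_abs_summable[OF e1] in auto)
    also have "\<dots> = infsetsum (\<lambda>x. ?p x * ln (F x r)) UNIV"
    proof (rule infsetsum_cong)
      fix x
      have "infsetsum (\<lambda>y. ?p x * (?q y * h1 (x, y))) UNIV = infsetsum (\<lambda>y. (?p x * ln (F x r)) * ?q y) UNIV"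
        by (rule infsetsum_cong) (auto simp: h1_def)
      also have "\<dots> = ?p x * ln (F x r)"
        \<comment> \<open>Here y is summed out, its probabilities having total 1.\<close>
        by (subst infsetsum_cmult_right) (auto simp: poisson_sum_1)
      finally show "infsetsum (\<lambda>y. ?p x * (?q y * h1 (x, y))) UNIV = ?p x * ln (F x r)" .
    qed simp
    finally show ?thesis by (simp add: exp_log_def curve_0)
  qed
  finally show ?thesis unfolding I_def by simp
qed

end

text \<open>The path locale is interpreted for the weight f and for the weight 1. Both risks then
  contain the same term \<open>R\<close>, and their difference is the increment of
  \<open>A.exp_log\<close>.\<close>

lemma star_condition_imp_dominates:
  fixes r s \<gamma> :: "real ^ 'n::finite" and f :: "real ^ 'n \<Rightarrow> ennreal"
  assumes r_pos: "\<And>i. 0 < r $ i" and s_pos: "\<And>i. 0 < s $ i"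
    and gamma: "\<And>i. \<gamma> $ i = 1 / r $ i - 1 / (r $ i + s $ i)"
    and f_meas: "f \<in> borel_measurable (lebesgue_on orthant)"
    and f_nonzero: "\<not> (AE \<theta> in lebesgue_on orthant. f \<theta> = 0)"
    and F_finite: "\<And>z t. t \<in> pos_orthant \<Longrightarrow> gamma_mean f \<gamma> z t < \<infinity>"
    and star: "star_condition f \<gamma>"
  shows "weakly_dominates r s (predictive r s (weighted_prior f \<gamma>)) (predictive r s jeffreys_prior)"
    and "gamma_mean f \<gamma> z r \<noteq> gamma_mean f \<gamma> z' r \<Longrightarrow>
      dominates r s (predictive r s (weighted_prior f \<gamma>)) (predictive r s jeffreys_prior)"
proof -
  have jeffreys: "weighted_prior (\<lambda>_. 1) \<gamma> = jeffreys_prior"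
    by (simp add: weighted_prior_def fun_eq_iff)
  obtain \<nu> where "prior_path r s \<gamma> \<nu> (weighted_prior f \<gamma>)"
    using weight_measure_exists[OF r_pos s_pos gamma f_meas f_nonzero F_finite] by blast
  then interpret A: prior_path r s \<gamma> \<nu> "weighted_prior f \<gamma>" .
  \<comment> \<open>The constant weight 1 is not almost everywhere 0 because the positive orthant is
    open and nonempty, hence not negligible.\<close>
  have nz: "\<not> (AE \<theta> in lebesgue_on (orthant :: (real ^ 'n) set). (1 :: ennreal) = 0)"
  proof
    assume "AE \<theta> in lebesgue_on (orthant :: (real ^ 'n) set). (1 :: ennreal) = 0"
    then have "AE \<theta> in lebesgue. \<theta> \<in> (orthant :: (real ^ 'n) set) \<longrightarrow> (1 :: ennreal) = 0"
      by (subst (asm) AE_restrict_space_iff) auto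
    then have "AE \<theta> in lebesgue. \<theta> \<notin> (pos_orthant :: (real ^ 'n) set)"
      by eventually_elim (simp add: orthant_def pos_orthant_def, metis less_imp_le)
    then have "negligible (pos_orthant :: (real ^ 'n) set)"
      by (subst negligible_iff_null_sets) (simp add: AE_iff_null_sets)
    moreover have "(\<chi> i. (1 :: real)) \<in> (pos_orthant :: (real ^ 'n) set)" by (simp add: pos_orthant_def)
    ultimately show False using open_not_negligible[OF open_pos_orthant] by blast
  qed
  obtain \<nu>J where "prior_path r s \<gamma> \<nu>J (weighted_prior (\<lambda>_. 1) \<gamma>)"
    using weight_measure_exists[OF r_pos s_pos gamma borel_measurable_const nz] gamma_mean_const_1
    by (metis ennreal_one_less_top infinity_ennreal_def)
  then interpret J: prior_path r s \<gamma> \<nu>J jeffreys_prior unfolding jeffreys .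
  have FJ: "J.F z t = 1" if "t \<in> pos_orthant" for z t
    using J.gamma_mean_eq[OF jeffreys[symmetric] that] gamma_mean_const_1[OF that] J.F_pos[OF that] by simp
  have FA: "gamma_mean f \<gamma> z t = ennreal (A.F z t)" if "t \<in> pos_orthant" for z t
    by (rule A.gamma_mean_eq[OF refl that])
  have FA': "enn2real (gamma_mean f \<gamma> z t) = A.F z t" if "t \<in> pos_orthant" for z t
    using FA[OF that] A.F_pos[OF that, of z] by simp
  have star': "0 \<le> A.star z t" if "t \<in> pos_orthant" for z t
    using star[unfolded star_condition_def Let_def, rule_format, OF that, of z]
    unfolding A.star_def FA'[OF that] .
  define R where "R l = infsetsum (\<lambda>(x, y). poisson_prob r l x * (poisson_prob s l y * log_ratio r s l (x, y))) (UNIV \<times> UNIV)" for l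
  have riskA: "kl_risk r s (predictive r s (weighted_prior f \<gamma>)) l = ereal (R l - (A.exp_log l 1 - A.exp_log l 0))"
    if "l \<in> pos_orthant" for l
    unfolding R_def by (rule A.kl_risk_weighted[OF that]) (simp add: A.predictive_eq jeffreys_predictive_def)
  have riskJ: "kl_risk r s (predictive r s jeffreys_prior) l = ereal (R l)"
    if "l \<in> pos_orthant" for l
  proof -
    have "J.exp_log l 0 = 0" "J.exp_log l 1 = 0"
      unfolding J.exp_log_def J.curve_0 J.curve_1 by (simp_all add: FJ J.r_in J.rs_in)
    moreover have "kl_risk r s (predictive r s jeffreys_prior) l = ereal (R l - (J.exp_log l 1 - J.exp_log l 0))"
      unfolding R_def by (rule J.kl_risk_weighted[OF that]) (simp add: J.predictive_eq jeffreys_predictive_def)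
    ultimately show ?thesis by simp
  qed
  show wd: "weakly_dominates r s (predictive r s (weighted_prior f \<gamma>)) (predictive r s jeffreys_prior)"
    unfolding weakly_dominates_def
    using A.exp_log_mono[OF star', of _ 0 1] by (simp add: riskA riskJ)
  assume "gamma_mean f \<gamma> z r \<noteq> gamma_mean f \<gamma> z' r"
  then have "A.F z r \<noteq> A.F z' r" using FA[OF A.r_in] by metis
  note strict = A.exp_log_strict[OF star' A.r_in this]
  show "dominates r s (predictive r s (weighted_prior f \<gamma>)) (predictive r s jeffreys_prior)"
    unfolding dominates_def
    \<comment> \<open>The inequality is strict at every rate vector; \<open>r\<close> is a
      convenient witness.\<close>
    using wd strict A.r_in by (intro conjI bexI[of _ r]) (simp_all add: riskA riskJ)
qed

section \<open>Integration by parts on the orthant\<close>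

text \<open>The integral of the derivative is the limit of \<open>\<phi> b - \<phi> 0\<close>. Were
  it positive, \<open>\<phi>\<close> would eventually exceed a positive constant, against its
  integrability; so integrability replaces a decay assumption at infinity.\<close>

lemma integral_derivative_nonpos:
  fixes \<phi> \<phi>' :: "real \<Rightarrow> real"
  assumes der: "\<And>u. 0 \<le> u \<Longrightarrow> (\<phi> has_real_derivative \<phi>' u) (at u within {0..})"
    and int: "set_integrable lborel {0..} \<phi>"
    and int': "set_integrable lborel {0..} \<phi>'"
    and zero: "0 \<le> \<phi> 0"
  shows "(LINT u:{0..}|lborel. \<phi>' u) \<le> 0"
proof (rule ccontr)
  define I where "I = (LINT u:{0..}|lborel. \<phi>' u)"
  assume "\<not> ?thesis"
  then have I: "0 < I" unfolding I_def by simp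
  have ftc: "(LINT u:{0..b}|lborel. \<phi>' u) = \<phi> b - \<phi> 0" if b: "0 \<le> b" for b
  proof -
    have "set_integrable lborel {0..b} \<phi>'" by (rule set_integrable_subset[OF int']) auto
    then have "(LINT u:{0..b}|lborel. \<phi>' u) = integral {0..b} \<phi>'"
      by (rule set_borel_integral_eq_integral)
    also have "(\<phi>' has_integral \<phi> b - \<phi> 0) {0..b}"
    proof (rule fundamental_theorem_of_calculus[OF b])
      fix x assume "x \<in> {0..b}"
      then have "(\<phi> has_real_derivative \<phi>' x) (at x within {0..b})"
        using has_field_derivative_subset[OF der[of x], of "{0..b}"] by auto
      then show "(\<phi> has_vector_derivative \<phi>' x) (at x within {0..b})"
        by (simp add: has_real_derivative_iff_has_vector_derivative)
    qed
    then have "integral {0..b} \<phi>' = \<phi> b - \<phi> 0" by (rule integral_unique)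
    finally show ?thesis .
  qed
  have "((\<lambda>b. LINT u:{0..b}|lborel. \<phi>' u) \<longlongrightarrow> I) at_top"
    unfolding I_def by (rule tendsto_set_lebesgue_integral_at_top) (use int' in auto)
  then have "eventually (\<lambda>b. I / 2 < (LINT u:{0..b}|lborel. \<phi>' u)) at_top"
    by (rule order_tendstoD) (use I in simp)
  then obtain B where B: "\<And>b. B \<le> b \<Longrightarrow> I / 2 < (LINT u:{0..b}|lborel. \<phi>' u)"
    by (auto simp: eventually_at_top_linorder)
  define B' where "B' = max B 0"
  have phi: "I / 2 \<le> \<phi> b" if "B' \<le> b" for b
    using B[of b] ftc[of b] zero that by (auto simp: B'_def)
  define S where "S = (\<integral>u. indicator {0..} u *\<^sub>R \<bar>\<phi> u\<bar> \<partial>lborel)"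
  have S: "integrable lborel (\<lambda>u. indicator {0..} u *\<^sub>R \<bar>\<phi> u\<bar>)"
    using set_integrable_norm[OF int] by (simp add: set_integrable_def)
  \<comment> \<open>An interval of length n beyond \<open>B'\<close> alone contributes this much to
    the integral of the modulus.\<close>
  have "I / 2 * real n \<le> S" for n
  proof -
    have "(\<integral>u. indicator {B'..B' + real n} u * (I / 2) \<partial>lborel) \<le> S"
      unfolding S_def
    proof (rule integral_mono)
      fix u :: real
      show "indicator {B'..B' + real n} u * (I / 2) \<le> indicator {0..} u *\<^sub>R \<bar>\<phi> u\<bar>"
        using phi[of u] by (auto simp: indicator_def B'_def)
    qed (use S in \<open>auto intro!: integrable_mult_left\<close>)
    then show ?thesis by (simp add: mult.commute)
  qed
  moreover obtain n where "S / (I / 2) < real n" using reals_Archimedean2 by blast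
  ultimately show False using I by (metis divide_pos_pos mult.commute not_less pos_divide_less_eq zero_less_numeral)
qed

definition replace_coord :: "real ^ 'n \<Rightarrow> 'n \<Rightarrow> real \<Rightarrow> real ^ 'n::finite" where
  "replace_coord x i u = (\<chi> j. if j = i then u else x $ j)"

text \<open>Fubini with the i-th coordinate innermost: on almost every line the flux is integrable,
  and the half-line lemma bounds the inner integral.\<close>

lemma divergence_orthant_nonpos:
  fixes \<Phi> \<Phi>' :: "real ^ 'n::finite \<Rightarrow> real" and i :: 'n
  assumes der: "\<And>x u. x \<in> orthant \<Longrightarrow> 0 \<le> u \<Longrightarrow>
      ((\<lambda>u. \<Phi> (replace_coord x i u)) has_real_derivative \<Phi>' (replace_coord x i u)) (at u within {0..})"
    and int: "set_integrable lborel orthant \<Phi>" and int': "set_integrable lborel orthant \<Phi>'"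
    and zero: "\<And>x. x \<in> orthant \<Longrightarrow> x $ i = 0 \<Longrightarrow> 0 \<le> \<Phi> x"
  shows "(LINT x:orthant|lborel. \<Phi>' x) \<le> 0"
proof -
  let ?L = "\<lambda>_ :: 'n. lborel :: real measure"
  let ?J = "UNIV - {i}"
  define G where "G h f = (indicator orthant (\<chi> j. f j) * h (\<chi> j. f j) :: real)" for h :: "real ^ 'n \<Rightarrow> real" and f :: "'n \<Rightarrow> real"
  have ins: "insert i ?J = UNIV" by auto
  have Gint: "integrable (PiM UNIV ?L) (G h)" and Geq: "(LINT x:orthant|lborel. h x) = (\<integral>f. G h f \<partial>PiM UNIV ?L)"
    if h: "set_integrable lborel orthant h" for h
  proof -
    have m: "(\<lambda>x. indicator orthant x *\<^sub>R h x) \<in> borel_measurable borel"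
      using h by (auto simp: set_integrable_def)
    have "integrable (distr (PiM UNIV ?L) borel (\<lambda>f. \<chi> j. f j)) (\<lambda>x. indicator orthant x *\<^sub>R h x)"
      using h unfolding set_integrable_def lborel_vec[symmetric] .
    then have "integrable (PiM UNIV ?L) (\<lambda>f. indicator orthant (\<chi> j. f j) *\<^sub>R h (\<chi> j. f j))"
      by (rule integrable_distr[OF measurable_vec_lambda_PiM])
    moreover have "G h = (\<lambda>f. indicator orthant (\<chi> j. f j) *\<^sub>R h (\<chi> j. f j))"
      by (simp add: G_def fun_eq_iff)
    ultimately show "integrable (PiM UNIV ?L) (G h)" by (simp only:)
    show "(LINT x:orthant|lborel. h x) = (\<integral>f. G h f \<partial>PiM UNIV ?L)"
      unfolding set_lebesgue_integral_def G_def
      by (subst lborel_vec, subst integral_distr) (use m in auto)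
  qed
  have GP: "G h \<in> borel_measurable (PiM (insert i ?J) ?L)" if "set_integrable lborel orthant h" for h
    using Gint[OF that] unfolding ins by auto
  have slice: "G h (f(i := u)) = indicator {0..} u *\<^sub>R h (replace_coord (\<chi> j. if j = i then 0 else f j) i u)"
    if "\<forall>j\<in>?J. 0 \<le> f j" for h f u
  proof -
    have e: "vec_lambda (f(i := u)) = replace_coord (\<chi> j. if j = i then 0 else f j) i u"
      by (auto simp: replace_coord_def vec_eq_iff)
    have "replace_coord (\<chi> j. if j = i then 0 else f j) i u \<in> orthant \<longleftrightarrow> 0 \<le> u"
      using that by (auto simp: orthant_def replace_coord_def)
    then show ?thesis unfolding G_def e by (simp add: indicator_def)
  qed
  have slice0: "G h (f(i := u)) = 0" if "\<not> (\<forall>j\<in>?J. 0 \<le> f j)" for h f u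
    using that by (auto simp: G_def orthant_def indicator_def)
  have "(\<integral>\<^sup>+ f. (\<integral>\<^sup>+ u. ennreal \<bar>G \<Phi> (f(i := u))\<bar> \<partial>lborel) \<partial>PiM ?J ?L) = (\<integral>\<^sup>+ f. ennreal \<bar>G \<Phi> f\<bar> \<partial>PiM UNIV ?L)"
    using lborel_prod.product_nn_integral_insert[of ?J i "\<lambda>f. ennreal \<bar>G \<Phi> f\<bar>"] GP[OF int] by (simp add: ins)
  also have "\<dots> < \<infinity>" using Gint[OF int] by (simp add: integrable_iff_bounded)
  finally have fin: "(\<integral>\<^sup>+ f. (\<integral>\<^sup>+ u. ennreal \<bar>G \<Phi> (f(i := u))\<bar> \<partial>lborel) \<partial>PiM ?J ?L) \<noteq> \<infinity>" by auto
  have meas2: "(\<lambda>(f, u). G h (f(i := u))) \<in> borel_measurable (PiM ?J ?L \<Otimes>\<^sub>M lborel)" if "set_integrable lborel orthant h" for h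
    using measurable_compose[OF measurable_add_dim GP[OF that]] by (simp add: split_beta')
  have "AE f in PiM ?J ?L. (\<integral>\<^sup>+ u. ennreal \<bar>G \<Phi> (f(i := u))\<bar> \<partial>lborel) \<noteq> \<infinity>"
  proof (rule nn_integral_PInf_AE[OF _ fin])
    have "(\<lambda>(f, u). ennreal \<bar>G \<Phi> (f(i := u))\<bar>) \<in> borel_measurable (PiM ?J ?L \<Otimes>\<^sub>M lborel)"
      using meas2[OF int] by (simp add: split_beta')
    then show "(\<lambda>f. \<integral>\<^sup>+ u. ennreal \<bar>G \<Phi> (f(i := u))\<bar> \<partial>lborel) \<in> borel_measurable (PiM ?J ?L)"
      by (rule lborel.borel_measurable_nn_integral)
  qed
  then have AE: "AE f in PiM ?J ?L. (\<integral>u. G \<Phi>' (f(i := u)) \<partial>lborel) \<le> 0"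
    using AE_space
  proof eventually_elim
    fix f assume fi: "(\<integral>\<^sup>+ u. ennreal \<bar>G \<Phi> (f(i := u))\<bar> \<partial>lborel) \<noteq> \<infinity>" and f: "f \<in> space (PiM ?J ?L)"
    show "(\<integral>u. G \<Phi>' (f(i := u)) \<partial>lborel) \<le> 0"
    proof (cases "(\<forall>j\<in>?J. 0 \<le> f j) \<and> integrable lborel (\<lambda>u. G \<Phi>' (f(i := u)))")
      case True
      define x where "x = (\<chi> j. if j = i then 0 else f j)"
      have x: "x \<in> orthant" using True by (auto simp: x_def orthant_def)
      have sl: "G h (f(i := u)) = indicator {0..} u *\<^sub>R h (replace_coord x i u)" for h u
        using slice True unfolding x_def by blast
      have m: "(\<lambda>u. G \<Phi> (f(i := u))) \<in> borel_measurable lborel"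
        using measurable_compose[OF measurable_Pair1'[OF f] meas2[OF int]] by simp
      have "(LINT u:{0..}|lborel. \<Phi>' (replace_coord x i u)) \<le> 0"
      proof (rule integral_derivative_nonpos)
        show "((\<lambda>u. \<Phi> (replace_coord x i u)) has_real_derivative \<Phi>' (replace_coord x i u)) (at u within {0..})" if "0 \<le> u" for u
          by (rule der[OF x that])
        show "set_integrable lborel {0..} (\<lambda>u. \<Phi> (replace_coord x i u))"
          unfolding set_integrable_def sl[symmetric] using m fi
          by (simp add: integrable_iff_bounded less_top)
        show "set_integrable lborel {0..} (\<lambda>u. \<Phi>' (replace_coord x i u))"
          unfolding set_integrable_def sl[symmetric] using True by blast
        show "0 \<le> \<Phi> (replace_coord x i 0)"
          by (rule zero) (use x in \<open>auto simp: replace_coord_def orthant_def\<close>)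
      qed
      then show ?thesis unfolding sl set_lebesgue_integral_def .
    next
      case False
      show ?thesis
      proof (cases "\<forall>j\<in>?J. 0 \<le> f j")
        case True
        \<comment> \<open>On such a line the inner integral is 0 by convention, which satisfies the
          bound.\<close>
        then have "\<not> integrable lborel (\<lambda>u. G \<Phi>' (f(i := u)))" using False by blast
        then show ?thesis by (simp add: not_integrable_integral_eq)
      next
        case False
        have "G \<Phi>' (f(i := u)) = 0" for u by (rule slice0[OF False])
        then show ?thesis by simp
      qed
    qed
  qed
  have "(LINT x:orthant|lborel. \<Phi>' x) = (\<integral>f. G \<Phi>' f \<partial>PiM (insert i ?J) ?L)"
    unfolding ins by (rule Geq[OF int'])
  also have "\<dots> = (\<integral>f. (\<integral>u. G \<Phi>' (f(i := u)) \<partial>lborel) \<partial>PiM ?J ?L)"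
    by (rule lborel_prod.product_integral_insert) (use Gint[OF int'] in \<open>auto simp: ins\<close>)
  also have "\<dots> \<le> 0"
    using Bochner_Integration.integral_nonneg_AE[of "\<lambda>f. - (\<integral>u. G \<Phi>' (f(i := u)) \<partial>lborel)" "PiM ?J ?L"] AE by simp
  finally show ?thesis .
qed


section \<open>Gaussian monomials, their derivatives and Green's identity\<close>

definition mon :: "real ^ 'n \<Rightarrow> ('n \<Rightarrow> nat) \<Rightarrow> real ^ 'n::finite \<Rightarrow> real" where
  "mon b n x = (\<Prod>j\<in>UNIV. (x $ j) ^ n j * exp (- (b $ j * (x $ j)\<^sup>2)))"

lemma mon_borel [measurable]: "mon b n \<in> borel_measurable borel"
  unfolding mon_def by measurable

lemma mon_nonneg: "x \<in> orthant \<Longrightarrow> 0 \<le> mon b n x"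
  unfolding mon_def orthant_def by (intro prod_nonneg) auto

definition mon_deriv :: "real ^ 'n \<Rightarrow> 'n \<Rightarrow> ('n \<Rightarrow> nat) \<Rightarrow> real ^ 'n::finite \<Rightarrow> real" where
  "mon_deriv b i n x = real (n i) * mon b (n(i := n i - 1)) x - 2 * b $ i * mon b (n(i := n i + 1)) x"

text \<open>For n_i below 2 the exponent n_i - 2 is truncated, but then its coefficient n_i (n_i -
  1) is 0.\<close>

definition mon_deriv2 :: "real ^ 'n \<Rightarrow> 'n \<Rightarrow> ('n \<Rightarrow> nat) \<Rightarrow> real ^ 'n::finite \<Rightarrow> real" where
  "mon_deriv2 b i n x = real (n i * (n i - 1)) * mon b (n(i := n i - 2)) x
    - 2 * b $ i * (2 * real (n i) + 1) * mon b n x + 4 * (b $ i)\<^sup>2 * mon b (n(i := n i + 2)) x"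

lemma mon_has_derivative:
  fixes x :: "real ^ 'n::finite"
  shows "((\<lambda>u. mon b n (replace_coord x i u)) has_real_derivative mon_deriv b i n (replace_coord x i u)) (at u within S)"
proof -
  define R where "R = (\<Prod>j\<in>UNIV - {i}. (x $ j) ^ n j * exp (- (b $ j * (x $ j)\<^sup>2)))"
  have m: "mon b (n(i := k)) (replace_coord x i u) = u ^ k * exp (- (b $ i * u\<^sup>2)) * R" for k u
    unfolding mon_def R_def by (subst prod.remove[of _ i]) (auto simp: replace_coord_def)
  have m0: "mon b n (replace_coord x i u) = u ^ n i * exp (- (b $ i * u\<^sup>2)) * R" for u
    using m[of "n i"] by simp
  have "((\<lambda>u. u ^ n i * exp (- (b $ i * u\<^sup>2)) * R) has_real_derivative
    (real (n i) * u ^ (n i - 1) * exp (- (b $ i * u\<^sup>2)) + u ^ n i * (exp (- (b $ i * u\<^sup>2)) * - (b $ i * (2 * u)))) * R) (at u within S)"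
    by (rule derivative_eq_intros refl | simp add: mult_ac)+
  also have "(real (n i) * u ^ (n i - 1) * exp (- (b $ i * u\<^sup>2)) + u ^ n i * (exp (- (b $ i * u\<^sup>2)) * - (b $ i * (2 * u)))) * R
    = mon_deriv b i n (replace_coord x i u)"
    unfolding mon_deriv_def m by (simp add: algebra_simps)
  finally show ?thesis unfolding m0 .
qed

lemma mon_deriv_has_derivative:
  fixes x :: "real ^ 'n::finite"
  shows "((\<lambda>u. mon_deriv b i n (replace_coord x i u)) has_real_derivative mon_deriv2 b i n (replace_coord x i u)) (at u within S)"
proof -
  let ?y = "replace_coord x i u"
  have "((\<lambda>u. mon_deriv b i n (replace_coord x i u)) has_real_derivative
    real (n i) * mon_deriv b i (n(i := n i - 1)) ?y - 2 * b $ i * mon_deriv b i (n(i := n i + 1)) ?y) (at u within S)"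
    unfolding mon_deriv_def[of b i n] by (intro DERIV_diff DERIV_cmult mon_has_derivative)
  also have "real (n i) * mon_deriv b i (n(i := n i - 1)) ?y - 2 * b $ i * mon_deriv b i (n(i := n i + 1)) ?y
    = mon_deriv2 b i n ?y"
  proof (cases "n i")
    case 0
    then have "n(i := 0) = n" by (metis fun_upd_triv)
    then show ?thesis using 0 unfolding mon_deriv_def mon_deriv2_def
      by (simp add: algebra_simps power2_eq_square numeral_2_eq_2)
  next
    case (Suc k)
    then have "n(i := Suc k) = n" by (metis fun_upd_triv)
    then show ?thesis using Suc unfolding mon_deriv_def mon_deriv2_def
      by (simp add: algebra_simps power2_eq_square numeral_2_eq_2)
  qed
  finally show ?thesis .
qed

text \<open>On the face every monomial with a positive i-th exponent vanishes. The exponent n_i - 1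
  could be 0 with a nonzero coefficient only for n_i = 1, which the even exponents of the
  application avoid.\<close>

lemma mon_deriv_boundary:
  assumes "x $ i = 0" "n i \<noteq> 1"
  shows "mon_deriv b i n x = 0"
proof -
  have "mon b (n(i := k)) x = 0" if "k \<noteq> 0" for k
    unfolding mon_def by (rule prod_zero) (use assms that in \<open>auto intro!: bexI[of _ i]\<close>)
  then show ?thesis using assms(2) unfolding mon_deriv_def by (cases "n i = 0") auto
qed

text \<open>The regularity conditions offer one common rate and even powers only. The rate is met by
  the smallest b_i. For an arbitrary monomial p one has p <= 1 + p^2, which involves the exponents 0
  and 2 n.\<close>

lemma set_integrable_mon:
  fixes h :: "real ^ 'n::finite \<Rightarrow> real"
  assumes h: "continuous_on orthant h" and w: "weighted_integrable h" and b: "\<And>i. 0 < b $ i"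
  shows "set_integrable lborel orthant (\<lambda>x. h x * mon b n x)"
proof -
  define \<rho> where "\<rho> = Min (range (\<lambda>i. b $ i))"
  have \<rho>: "0 < \<rho>" "\<And>i. \<rho> \<le> b $ i" unfolding \<rho>_def using b by auto
  define W where "W z x = \<bar>h x\<bar> * (\<Prod>j\<in>UNIV. (x $ j) ^ (2 * z j) * exp (- \<rho> * (x $ j)\<^sup>2))" for z x
  have hm: "(\<lambda>x. indicator orthant x *\<^sub>R h x) \<in> borel_measurable borel"
    by (rule borel_measurable_continuous_on_indicator[OF orthant_borel h])
  have ah: "\<bar>indicator orthant x *\<^sub>R h x\<bar> = indicator orthant x * \<bar>h x\<bar>" for x
    by (simp add: indicator_def)
  have Wint: "integrable lborel (\<lambda>x. indicator orthant x * W z x)" for z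
  proof (rule integrableI_nonneg)
    have "(\<lambda>x. \<bar>indicator orthant x *\<^sub>R h x\<bar> * (\<Prod>j\<in>UNIV. (x $ j) ^ (2 * z j) * exp (- \<rho> * (x $ j)\<^sup>2))) \<in> borel_measurable borel"
      using hm by measurable
    then show "(\<lambda>x. indicator orthant x * W z x) \<in> borel_measurable lborel"
      unfolding ah W_def by (simp add: mult_ac)
    show "AE x in lborel. 0 \<le> indicator orthant x * W z x"
      by (rule AE_I2) (auto simp: W_def indicator_def orthant_def intro!: mult_nonneg_nonneg prod_nonneg)
    have "(\<integral>\<^sup>+ x\<in>orthant. ennreal (W z x) \<partial>lebesgue) < \<infinity>"
      using w \<rho>(1) unfolding weighted_integrable_def W_def by blast
    then show "(\<integral>\<^sup>+ x. ennreal (indicator orthant x * W z x) \<partial>lborel) < \<infinity>"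
      unfolding nn_integral_completion by (simp add: mult.commute indicator_mult_ennreal)
  qed
  show ?thesis
    unfolding set_integrable_def
  proof (rule Bochner_Integration.integrable_bound)
    show "integrable lborel (\<lambda>x. indicator orthant x * W (\<lambda>_. 0) x + indicator orthant x * W n x)"
      by (intro Bochner_Integration.integrable_add Wint)
    have "(\<lambda>x. (indicator orthant x *\<^sub>R h x) * mon b n x) \<in> borel_measurable lborel"
      using hm by measurable
    then show "(\<lambda>x. indicator orthant x *\<^sub>R (h x * mon b n x)) \<in> borel_measurable lborel"
      by (simp add: mult.assoc)
    show "AE x in lborel. norm (indicator orthant x *\<^sub>R (h x * mon b n x))
      \<le> norm (indicator orthant x * W (\<lambda>_. 0) x + indicator orthant x * W n x)"
    proof (rule AE_I2)
      fix x :: "real ^ 'n"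
      show "norm (indicator orthant x *\<^sub>R (h x * mon b n x)) \<le> norm (indicator orthant x * W (\<lambda>_. 0) x + indicator orthant x * W n x)"
      proof (cases "x \<in> orthant")
        case True
        then have x: "0 \<le> x $ j" for j by (simp add: orthant_def)
        define p where "p = (\<Prod>j\<in>UNIV. (x $ j) ^ n j)"
        define E where "E = (\<Prod>j\<in>UNIV. exp (- \<rho> * (x $ j)\<^sup>2))"
        have E: "0 \<le> E" unfolding E_def by (intro prod_nonneg) auto
        have p: "0 \<le> p" unfolding p_def by (intro prod_nonneg) (use x in auto)
        have "mon b n x \<le> p * E"
          unfolding mon_def p_def E_def prod.distrib[symmetric]
          using x \<rho> by (intro prod_mono) (auto intro!: mult_left_mono mult_right_mono)
        also have "\<dots> \<le> (1 + p * p) * E"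
        proof (rule mult_right_mono[OF _ E])
          have "0 \<le> (p - 1) * (p - 1)" by simp
          then have "2 * p \<le> 1 + p * p" by (simp add: algebra_simps)
          then show "p \<le> 1 + p * p" using p by linarith
        qed
        finally have "mon b n x \<le> (1 + p * p) * E" .
        then have "\<bar>h x\<bar> * mon b n x \<le> \<bar>h x\<bar> * ((1 + p * p) * E)" by (intro mult_left_mono) auto
        also have "\<dots> = W (\<lambda>_. 0) x + W n x"
          unfolding W_def prod.distrib E_def[symmetric] p_def
          by (simp add: prod.distrib[symmetric] power_add[symmetric] mult_2 mult_2_right algebra_simps)
        finally show ?thesis
          using True mon_nonneg[OF True, of b n] by (simp add: abs_mult)
      qed simp
    qed
  qed
qed

lemma mon_deriv_integrable:
  fixes h :: "real ^ 'n::finite \<Rightarrow> real"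
  assumes h: "continuous_on orthant h" and w: "weighted_integrable h" and b: "\<And>i. 0 < b $ i"
  shows "set_integrable lborel orthant (\<lambda>x. h x * mon_deriv b i n x)"
    and "set_integrable lborel orthant (\<lambda>x. h x * mon_deriv2 b i n x)"
proof -
  note I = set_integrable_mon[OF h w b]
  have e1: "h x * mon_deriv b i n x = real (n i) * (h x * mon b (n(i := n i - 1)) x) - 2 * b $ i * (h x * mon b (n(i := n i + 1)) x)" for x
    unfolding mon_deriv_def by (simp add: algebra_simps)
  have e2: "h x * mon_deriv2 b i n x = real (n i * (n i - 1)) * (h x * mon b (n(i := n i - 2)) x)
    - 2 * b $ i * (2 * real (n i) + 1) * (h x * mon b n x) + 4 * (b $ i)\<^sup>2 * (h x * mon b (n(i := n i + 2)) x)" for x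
    unfolding mon_deriv2_def by (simp add: algebra_simps)
  show "set_integrable lborel orthant (\<lambda>x. h x * mon_deriv b i n x)"
    unfolding e1 by (intro set_integral_diff set_integrable_mult_right I)
  show "set_integrable lborel orthant (\<lambda>x. h x * mon_deriv2 b i n x)"
    unfolding e2 by (intro set_integral_diff set_integral_add set_integrable_mult_right I)
qed

lemma integral_mon_deriv2:
  fixes h :: "real ^ 'n::finite \<Rightarrow> real"
  assumes h: "continuous_on orthant h" and w: "weighted_integrable h" and b: "\<And>i. 0 < b $ i"
  shows "(LINT x:orthant|lborel. h x * mon_deriv2 b i n x)
    = real (n i * (n i - 1)) * (LINT x:orthant|lborel. h x * mon b (n(i := n i - 2)) x)
    - 2 * b $ i * (2 * real (n i) + 1) * (LINT x:orthant|lborel. h x * mon b n x)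
    + 4 * (b $ i)\<^sup>2 * (LINT x:orthant|lborel. h x * mon b (n(i := n i + 2)) x)"
proof -
  note I = set_integrable_mon[OF h w b]
  have e2: "h x * mon_deriv2 b i n x = real (n i * (n i - 1)) * (h x * mon b (n(i := n i - 2)) x)
    - 2 * b $ i * (2 * real (n i) + 1) * (h x * mon b n x) + 4 * (b $ i)\<^sup>2 * (h x * mon b (n(i := n i + 2)) x)" for x
    unfolding mon_deriv2_def by (simp add: algebra_simps)
  show ?thesis
    unfolding e2 by (simp only: set_integral_add set_integral_diff set_integral_mult_right set_integrable_mult_right I)
qed

lemma partial_has_derivative:
  fixes h :: "real ^ 'n::finite \<Rightarrow> real"
  assumes C1: "C1_orthant h" and x: "x \<in> orthant" and u: "0 \<le> u"
  shows "((\<lambda>u. h (replace_coord x i u)) has_real_derivative partial i h (replace_coord x i u)) (at u within {0..})"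
proof -
  let ?y = "replace_coord x i u"
  have y: "?y \<in> orthant" using x u by (auto simp: orthant_def replace_coord_def)
  have yi: "?y $ i = u" by (simp add: replace_coord_def)
  have l: "coord_line h i ?y = (\<lambda>u. h (replace_coord x i u))"
    unfolding coord_line_def replace_coord_def by (intro ext arg_cong[where f = h]) (simp add: vec_eq_iff)
  have "coord_line h i ?y differentiable (at (?y $ i) within {0..})"
    using C1 y unfolding C1_orthant_def by blast
  then have "(coord_line h i ?y has_vector_derivative partial i h ?y) (at (?y $ i) within {0..})"
    unfolding partial_def by (simp add: vector_derivative_works)
  then show ?thesis unfolding l yi by (simp add: has_real_derivative_iff_has_vector_derivative)
qed

text \<open>Green's second identity in one coordinate; the flux \<open>g \<partial>K - K \<partial>g\<close> through the face
  \<open>\<theta>\<^sub>i = 0\<close> has a sign because \<open>\<partial>K\<close> vanishes there.\<close>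

lemma integral_mon_deriv2_le:
  fixes g :: "real ^ 'n::finite \<Rightarrow> real"
  assumes C2: "C2_orthant g" and w0: "weighted_integrable g" and w1: "weighted_integrable (partial i g)"
    and w2: "weighted_integrable (partial i (partial i g))" and b: "\<And>i. 0 < b $ i" and n: "n i \<noteq> 1"
    and bd: "\<And>x. x \<in> orthant \<Longrightarrow> x $ i = 0 \<Longrightarrow> partial i g x \<le> 0"
  shows "(LINT x:orthant|lborel. g x * mon_deriv2 b i n x) \<le> (LINT x:orthant|lborel. partial i (partial i g) x * mon b n x)"
proof -
  have C1: "C1_orthant g" "C1_orthant (partial i g)" using C2 by (auto simp: C2_orthant_def)
  have c: "continuous_on orthant g" "continuous_on orthant (partial i g)" "continuous_on orthant (partial i (partial i g))"
    using C1 by (auto simp: C1_orthant_def)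
  define \<Phi> where "\<Phi> x = g x * mon_deriv b i n x - partial i g x * mon b n x" for x
  define \<Phi>' where "\<Phi>' x = g x * mon_deriv2 b i n x - partial i (partial i g) x * mon b n x" for x
  have "(LINT x:orthant|lborel. \<Phi>' x) \<le> 0"
  proof (rule divergence_orthant_nonpos[where \<Phi> = \<Phi> and i = i])
    fix x :: "real ^ 'n" and u :: real assume x: "x \<in> orthant" "0 \<le> u"
    let ?y = "replace_coord x i u"
    have "((\<lambda>u. \<Phi> (replace_coord x i u)) has_real_derivative
      (partial i g ?y * mon_deriv b i n ?y + mon_deriv2 b i n ?y * g ?y)
      - (partial i (partial i g) ?y * mon b n ?y + mon_deriv b i n ?y * partial i g ?y)) (at u within {0..})"
      unfolding \<Phi>_def
      by (intro DERIV_diff DERIV_mult partial_has_derivative mon_has_derivative mon_deriv_has_derivative C1 x)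
    then show "((\<lambda>u. \<Phi> (replace_coord x i u)) has_real_derivative \<Phi>' ?y) (at u within {0..})"
      by (simp add: \<Phi>'_def mult_ac)
  next
    show "set_integrable lborel orthant \<Phi>"
      unfolding \<Phi>_def by (intro set_integral_diff mon_deriv_integrable set_integrable_mon c w0 w1 b)
    show "set_integrable lborel orthant \<Phi>'"
      unfolding \<Phi>'_def by (intro set_integral_diff mon_deriv_integrable set_integrable_mon c w0 w2 b)
    fix x :: "real ^ 'n" assume x: "x \<in> orthant" "x $ i = 0"
    have "partial i g x * mon b n x \<le> 0" using bd[OF x] mon_nonneg[OF x(1)] by (simp add: mult_nonpos_nonneg)
    then show "0 \<le> \<Phi> x" unfolding \<Phi>_def mon_deriv_boundary[of x i n b, OF x(2) n] by simp
  qed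
  also have "(LINT x:orthant|lborel. \<Phi>' x) = (LINT x:orthant|lborel. g x * mon_deriv2 b i n x)
      - (LINT x:orthant|lborel. partial i (partial i g) x * mon b n x)"
    unfolding \<Phi>'_def by (intro set_integral_diff mon_deriv_integrable set_integrable_mon c w0 w2 b)
  finally show ?thesis by simp
qed

section \<open>The condition as an integral against second derivatives\<close>

definition mon_norm :: "real ^ 'n \<Rightarrow> ('n::finite \<Rightarrow> nat) \<Rightarrow> real" where
  "mon_norm b z = 2 ^ CARD('n) * gamma_norm z b"

lemma mon_norm_prod:
  fixes b :: "real ^ 'n::finite"
  shows "mon_norm b z = (\<Prod>i\<in>UNIV. 2 * b $ i powr (real (z i) + 1 / 2) / Gamma (real (z i) + 1 / 2))"
proof -
  have "(2 :: real) ^ CARD('n) = (\<Prod>i\<in>(UNIV :: 'n set). 2)" by simp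
  then show ?thesis unfolding mon_norm_def gamma_norm_def by (simp only: prod.distrib[symmetric] times_divide_eq_right)
qed

lemma mon_norm_pos:
  assumes "\<And>i. 0 < b $ i"
  shows "0 < mon_norm b z"
  unfolding mon_norm_def using gamma_norm_pos[of b z] assms by (simp add: pos_orthant_def)

lemma mon_norm_Suc:
  fixes b :: "real ^ 'n::finite"
  assumes "\<And>i. 0 < b $ i"
  shows "(real (z i) + 1 / 2) * mon_norm b (z(i := z i + 1)) = b $ i * mon_norm b z"
proof -
  have "b \<in> pos_orthant" using assms by (simp add: pos_orthant_def)
  from gamma_norm_Suc[OF this, of z i] show ?thesis
    unfolding mon_norm_def by (simp only: mult.left_commute[of _ "2 ^ CARD('n)"])
qed

text \<open>One coordinate under the substitution l = g x^2 with Jacobian 2 g x. The Jacobian raises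
  the power x^(2z - 1) to x^(2z) and the power of g from z - 1/2 to z + 1/2, so the Jeffreys prior
  becomes flat in x; the 2 accounts for the power of 2 in \<open>mon_norm\<close>.\<close>

lemma gamma_factor_signed_square:
  assumes g: "0 < (g :: real)" and t: "0 < t" and x: "0 < x"
  shows "t powr (real z + 1 / 2) * (g * (x * \<bar>x\<bar>)) powr (real z - 1 / 2) * exp (- (t * (g * (x * \<bar>x\<bar>)))) / Gamma (real z + 1 / 2)
      * (2 * g * \<bar>x\<bar>)
    = 2 * (t * g) powr (real z + 1 / 2) / Gamma (real z + 1 / 2) * (x ^ (2 * z) * exp (- (t * g * x\<^sup>2)))"
proof -
  have a: "(g * (x * x)) powr (real z - 1 / 2) = g powr (real z - 1 / 2) * (x powr (real z - 1 / 2) * x powr (real z - 1 / 2))"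
    using g x by (simp add: powr_mult)
  have "x powr (real z - 1 / 2) * x powr (real z - 1 / 2) * x = x powr (real (2 * z) - 1) * x powr 1"
    using x by (simp add: powr_add[symmetric])
  also have "\<dots> = x powr real (2 * z)" by (simp only: powr_add[symmetric]) simp
  also have "\<dots> = x ^ (2 * z)" using x by (rule powr_realpow)
  finally have b: "x powr (real z - 1 / 2) * x powr (real z - 1 / 2) * x = x ^ (2 * z)" .
  have c: "g powr (real z - 1 / 2) * g = g powr (real z + 1 / 2)"
    using g powr_add[of g "real z - 1 / 2" 1] by (simp add: add.commute)
  have d: "(t * g) powr (real z + 1 / 2) = t powr (real z + 1 / 2) * g powr (real z + 1 / 2)"
    using g t by (simp add: powr_mult)
  have e: "A * (B * (C * C)) * E / G * (2 * g * x) = 2 * (A * (B * g)) / G * ((C * C * x) * E)" for A B C E G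
    by simp
  show ?thesis
    unfolding d b[symmetric] c[symmetric] abs_of_pos[OF x] a e by (simp add: power2_eq_square mult_ac)
qed

text \<open>In the coordinates theta the exponent t_i l_i becomes t_i gamma_i theta_i^2, whence the
  Gaussian rates \<open>b\<close>.\<close>

lemma gamma_mean_mon:
  fixes g :: "real ^ 'n::finite \<Rightarrow> real" and \<gamma> t :: "real ^ 'n"
  assumes gamma: "\<And>i. 0 < \<gamma> $ i" and t: "t \<in> pos_orthant"
    and fg: "\<And>x. x \<in> orthant \<Longrightarrow> 0 \<le> g x \<and> f x = ennreal (g x)"
    and c: "continuous_on orthant g" and w: "weighted_integrable g"
    and b: "b = (\<chi> i. t $ i * \<gamma> $ i)"
  shows "gamma_mean f \<gamma> z t = ennreal (mon_norm b z * (LINT x:orthant|lborel. g x * mon b (\<lambda>j. 2 * z j) x))"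
proof -
  have ti: "0 < t $ i" for i using t by (simp add: pos_orthant_def)
  have bpos: "0 < b $ i" for i using gamma ti by (simp add: b)
  have G: "0 < Gamma (real (z i) + 1 / 2)" for i by (intro Gamma_real_pos) auto
  have gm [measurable]: "(\<lambda>x. indicator orthant x *\<^sub>R g x) \<in> borel_measurable borel"
    by (rule borel_measurable_continuous_on_indicator[OF orthant_borel c])
  define D where "D l = (\<Prod>i\<in>UNIV. (t $ i) powr (real (z i) + 1 / 2) * (l $ i) powr (real (z i) - 1 / 2)
                   * exp (- (t $ i * l $ i)) / Gamma (real (z i) + 1 / 2))" for l
  have [measurable]: "D \<in> borel_measurable borel" unfolding D_def[abs_def] by measurable
  have D0: "0 \<le> D l" for l unfolding D_def using G
    by (intro prod_nonneg ballI divide_nonneg_nonneg) (auto intro: less_imp_le)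
  \<comment> \<open>\<open>g\<close> is controlled on the closed orthant only, so the indicator is
    built in to obtain a Borel function on the whole space.\<close>
  define H where "H l = ennreal (indicator orthant (scaled_root \<gamma> l) *\<^sub>R g (scaled_root \<gamma> l)) * ennreal (D l)" for l
  have [measurable]: "H \<in> borel_measurable borel"
    unfolding H_def[abs_def] using measurable_compose[OF scaled_root_borel gm] by measurable
  have pos_orth: "x \<in> orthant" if "x \<in> pos_orthant" for x :: "real ^ 'n"
    using that by (auto simp: pos_orthant_def orthant_def less_imp_le)
  have sr: "scaled_root \<gamma> l \<in> orthant" if "l \<in> pos_orthant" for l
    using that gamma by (auto simp: pos_orthant_def orthant_def scaled_root_def less_imp_le)
  have "gamma_mean f \<gamma> z t = (\<integral>\<^sup>+ l\<in>pos_orthant. H l \<partial>lborel)"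
    unfolding gamma_mean_def nn_integral_completion D_def[symmetric] H_def
    by (intro nn_integral_cong) (use sr fg in \<open>auto simp: indicator_def\<close>)
  also have "\<dots> = (\<integral>\<^sup>+ x\<in>pos_orthant. H (signed_square \<gamma> x) * (\<Prod>i\<in>UNIV. ennreal (2 * \<gamma> $ i * \<bar>x $ i\<bar>)) \<partial>lborel)"
    by (rule nn_integral_signed_square_vec[OF gamma]) simp
  also have "\<dots> = (\<integral>\<^sup>+ x. ennreal (indicator orthant x *\<^sub>R (mon_norm b z * (g x * mon b (\<lambda>j. 2 * z j) x))) \<partial>lborel)"
  proof (rule nn_integral_cong_AE)
    show "AE x in lborel. H (signed_square \<gamma> x) * (\<Prod>i\<in>UNIV. ennreal (2 * \<gamma> $ i * \<bar>x $ i\<bar>)) * indicator pos_orthant x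
      = ennreal (indicator orthant x *\<^sub>R (mon_norm b z * (g x * mon b (\<lambda>j. 2 * z j) x)))"
      using AE_orthant_pos
    proof eventually_elim
      fix x :: "real ^ 'n" assume op: "x \<in> orthant \<longrightarrow> x \<in> pos_orthant"
      show "H (signed_square \<gamma> x) * (\<Prod>i\<in>UNIV. ennreal (2 * \<gamma> $ i * \<bar>x $ i\<bar>)) * indicator pos_orthant x
      = ennreal (indicator orthant x *\<^sub>R (mon_norm b z * (g x * mon b (\<lambda>j. 2 * z j) x)))"
      proof (cases "x \<in> orthant")
        case True
        then have x: "x \<in> pos_orthant" using op by blast
        have xi: "0 < x $ i" for i using x by (simp add: pos_orthant_def)
        have gx: "0 \<le> g x" using fg[OF True] by simp
        have "D (signed_square \<gamma> x) * (\<Prod>i\<in>UNIV. 2 * \<gamma> $ i * \<bar>x $ i\<bar>) = mon_norm b z * mon b (\<lambda>j. 2 * z j) x"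
          unfolding D_def mon_norm_prod mon_def prod.distrib[symmetric] signed_square_def b vec_lambda_beta
          by (intro prod.cong refl gamma_factor_signed_square gamma ti xi)
        moreover have "(\<Prod>i\<in>UNIV. ennreal (2 * \<gamma> $ i * \<bar>x $ i\<bar>)) = ennreal (\<Prod>i\<in>UNIV. 2 * \<gamma> $ i * \<bar>x $ i\<bar>)"
          by (rule prod_ennreal) (use gamma in \<open>auto intro!: mult_nonneg_nonneg simp: less_imp_le\<close>)
        moreover have "0 \<le> (\<Prod>i\<in>UNIV. 2 * \<gamma> $ i * \<bar>x $ i\<bar>)"
          by (intro prod_nonneg) (use gamma in \<open>auto intro!: mult_nonneg_nonneg simp: less_imp_le\<close>)
        ultimately have "H (signed_square \<gamma> x) * (\<Prod>i\<in>UNIV. ennreal (2 * \<gamma> $ i * \<bar>x $ i\<bar>))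
          = ennreal (g x * (mon_norm b z * mon b (\<lambda>j. 2 * z j) x))"
          unfolding H_def scaled_root_signed_square[OF gamma x]
          using True gx D0[of "signed_square \<gamma> x"] by (simp add: ennreal_mult[symmetric] mult.assoc)
        then show ?thesis using True x by (simp add: mult_ac)
      next
        case False
        then have "x \<notin> pos_orthant" using pos_orth by blast
        then show ?thesis using False by simp
      qed
    qed
  qed
  also have "\<dots> = ennreal (\<integral>x. indicator orthant x *\<^sub>R (mon_norm b z * (g x * mon b (\<lambda>j. 2 * z j) x)) \<partial>lborel)"
  proof (rule nn_integral_eq_integral)
    show "integrable lborel (\<lambda>x. indicator orthant x *\<^sub>R (mon_norm b z * (g x * mon b (\<lambda>j. 2 * z j) x)))"
      unfolding set_integrable_def[symmetric] by (intro set_integrable_mult_right set_integrable_mon c w bpos)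
    show "AE x in lborel. 0 \<le> indicator orthant x *\<^sub>R (mon_norm b z * (g x * mon b (\<lambda>j. 2 * z j) x))"
      using mon_nonneg fg less_imp_le[OF mon_norm_pos[OF bpos]] by (intro AE_I2) (auto simp: indicator_def intro!: mult_nonneg_nonneg)
  qed
  also have "(\<integral>x. indicator orthant x *\<^sub>R (mon_norm b z * (g x * mon b (\<lambda>j. 2 * z j) x)) \<partial>lborel)
    = mon_norm b z * (LINT x:orthant|lborel. g x * mon b (\<lambda>j. 2 * z j) x)"
    unfolding set_lebesgue_integral_def[symmetric] by (rule set_integral_mult_right)
  finally show ?thesis .
qed

text \<open>Up to a negative factor, the left-hand side of the condition is the integral of g
  against the Laplacian of a Gaussian monomial. Green's inequality bounds that integral by the one
  of the Laplacian of g against the nonnegative monomial.\<close>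

lemma superharmonic_imp_star_condition:
  fixes \<gamma> :: "real ^ 'n::finite" and f :: "real ^ 'n \<Rightarrow> ennreal" and g :: "real ^ 'n \<Rightarrow> real"
  assumes gamma: "\<And>i. 0 < \<gamma> $ i"
    and fg: "\<And>x. x \<in> orthant \<Longrightarrow> 0 \<le> g x \<and> f x = ennreal (g x)"
    and C2: "C2_orthant g" and w0: "weighted_integrable g" and w1: "\<And>i. weighted_integrable (partial i g)"
    and w2: "\<And>i. weighted_integrable (partial i (partial i g))"
    and super: "\<And>x. x \<in> orthant \<Longrightarrow> (\<Sum>i\<in>UNIV. partial i (partial i g) x) \<le> 0"
    and bd: "\<And>i x. x \<in> orthant \<Longrightarrow> x $ i = 0 \<Longrightarrow> partial i g x \<le> 0"
  shows "star_condition f \<gamma>"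
  unfolding star_condition_def Let_def
proof (intro allI ballI)
  fix z :: "'n \<Rightarrow> nat" and t :: "real ^ 'n" assume t: "t \<in> pos_orthant"
  have c: "continuous_on orthant g" "continuous_on orthant (partial i (partial i g))" for i
    using C2 by (auto simp: C2_orthant_def C1_orthant_def)
  define b where "b = (\<chi> i. t $ i * \<gamma> $ i)"
  have b: "0 < b $ i" "\<gamma> $ i * t $ i = b $ i" for i
    using gamma t by (auto simp: b_def pos_orthant_def)
  define J where "J n = (LINT x:orthant|lborel. g x * mon b n x)" for n
  define n where "n = (\<lambda>j. 2 * z j)"
  let ?C = "mon_norm b"
  have C: "0 < ?C z" for z by (rule mon_norm_pos[OF b(1)])
  have J0: "0 \<le> J n" for n
    unfolding J_def set_lebesgue_integral_def using fg mon_nonneg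
    by (intro Bochner_Integration.integral_nonneg) (auto simp: indicator_def intro!: mult_nonneg_nonneg)
  define F where "F z = enn2real (gamma_mean f \<gamma> z t)" for z
  have F: "F z = ?C z * J (\<lambda>j. 2 * z j)" for z
  proof -
    have "gamma_mean f \<gamma> z t = ennreal (?C z * J (\<lambda>j. 2 * z j))"
      unfolding J_def by (rule gamma_mean_mon[OF gamma t _ c(1) w0 b_def]) (rule fg)
    then show ?thesis unfolding F_def using C[of z] J0 by simp
  qed
  define K where "K i = (LINT x:orthant|lborel. g x * mon_deriv2 b i n x)" for i
  \<comment> \<open>The factor 1/4 comes from the doubled exponents n = 2 z: a quarter of n_i (n_i -
    1) is z_i (z_i - 1/2), and a quarter of 2 (2 n_i + 1) is z_i + (z_i + 1/2), the total weight of
    F(z).\<close>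
  have summand: "b $ i * real (z i) * (F z - (if z i = 0 then 1 else F (z(i := z i - 1))))
     + b $ i * (real (z i) + 1 / 2) * (F z - F (z(i := z i + 1))) = - (1 / 4) * ?C z * K i" for i
  proof -
    have up: "(\<lambda>j. 2 * (z(i := k)) j) = n(i := 2 * k)" for k by (auto simp: n_def)
    have 1: "b $ i * (real (z i) + 1 / 2) * F (z(i := z i + 1)) = (b $ i)\<^sup>2 * ?C z * J (n(i := n i + 2))"
    proof -
      have "b $ i * (real (z i) + 1 / 2) * F (z(i := z i + 1))
        = b $ i * ((real (z i) + 1 / 2) * ?C (z(i := z i + 1))) * J (n(i := n i + 2))"
        unfolding F up by (simp add: n_def mult_ac)
      then show ?thesis unfolding mon_norm_Suc[OF b(1)] by (simp add: power2_eq_square mult_ac)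
    qed
    have 2: "b $ i * real (z i) * (if z i = 0 then 1 else F (z(i := z i - 1)))
      = 1 / 4 * real (n i * (n i - 1)) * ?C z * J (n(i := n i - 2))"
    proof (cases "z i")
      case (Suc k)
      \<comment> \<open>The recurrence of the normalisation is read downwards, from z to its lower
        neighbour.\<close>
      have "(real k + 1 / 2) * ?C (z(i := k + 1)) = b $ i * ?C (z(i := k))"
        using mon_norm_Suc[OF b(1), of "z(i := k)" i] by simp
      then have "b $ i * ?C (z(i := k)) = (real k + 1 / 2) * ?C z"
        using Suc by (metis Suc_eq_plus1 fun_upd_triv)
      moreover have "F (z(i := z i - 1)) = ?C (z(i := k)) * J (n(i := n i - 2))"
        unfolding F up using Suc by (simp add: n_def)
      ultimately have "b $ i * real (z i) * F (z(i := z i - 1)) = real (z i) * ((real k + 1 / 2) * ?C z) * J (n(i := n i - 2))"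
        by (simp add: mult_ac)
      also have "real (z i) * (real k + 1 / 2) = 1 / 4 * real (n i * (n i - 1))"
        using Suc by (simp add: n_def field_simps)
      then have "real (z i) * ((real k + 1 / 2) * ?C z) * J (n(i := n i - 2)) = 1 / 4 * real (n i * (n i - 1)) * ?C z * J (n(i := n i - 2))"
        by (simp only: mult.assoc[symmetric])
      finally show ?thesis using Suc by simp
    qed (simp add: n_def)
    have 3: "K i = real (n i * (n i - 1)) * J (n(i := n i - 2)) - 2 * b $ i * (2 * real (n i) + 1) * J n + 4 * (b $ i)\<^sup>2 * J (n(i := n i + 2))"
      unfolding K_def J_def by (rule integral_mon_deriv2[OF c(1) w0 b(1)])
    have 4: "F z = ?C z * J n" unfolding F n_def ..
    have ni: "real (n i) = 2 * real (z i)" by (simp add: n_def)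
    show ?thesis
      unfolding right_diff_distrib 1 2 unfolding 3 4 ni by (simp add: algebra_simps)
  qed
  have "(\<Sum>i\<in>UNIV. K i) \<le> (\<Sum>i\<in>UNIV. LINT x:orthant|lborel. partial i (partial i g) x * mon b n x)"
  proof (rule sum_mono)
    fix i
    \<comment> \<open>The exponents are even, so the derivative of the monomial vanishes on the
      face.\<close>
    have "n i \<noteq> 1" unfolding n_def by presburger
    then show "K i \<le> (LINT x:orthant|lborel. partial i (partial i g) x * mon b n x)"
      unfolding K_def by (intro integral_mon_deriv2_le C2 w0 w1 w2 b(1) bd)
  qed
  also have "\<dots> = (\<integral>x. (\<Sum>i\<in>UNIV. indicator orthant x *\<^sub>R (partial i (partial i g) x * mon b n x)) \<partial>lborel)"
    unfolding set_lebesgue_integral_def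
    by (rule Bochner_Integration.integral_sum[symmetric])
      (use set_integrable_mon[OF c(2) w2 b(1)] in \<open>simp add: set_integrable_def\<close>)
  also have "\<dots> \<le> 0"
  proof -
    have "0 \<le> (\<integral>x. - (\<Sum>i\<in>UNIV. indicator orthant x *\<^sub>R (partial i (partial i g) x * mon b n x)) \<partial>lborel)"
    proof (rule Bochner_Integration.integral_nonneg)
      fix x :: "real ^ 'n"
      have "(\<Sum>i\<in>UNIV. partial i (partial i g) x * mon b n x) \<le> 0" if "x \<in> orthant"
        using super[OF that] mon_nonneg[OF that, of b n]
        by (simp add: sum_distrib_right[symmetric] mult_nonpos_nonneg)
      then show "0 \<le> - (\<Sum>i\<in>UNIV. indicator orthant x *\<^sub>R (partial i (partial i g) x * mon b n x))"
        by (simp add: indicator_def)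
    qed
    then show ?thesis by simp
  qed
  finally have "(\<Sum>i\<in>UNIV. K i) \<le> 0" .
  then have "0 \<le> - (1 / 4) * ?C z * (\<Sum>i\<in>UNIV. K i)"
    using C[of z] by (simp add: mult_nonneg_nonpos)
  also have "\<dots> = (\<Sum>i\<in>UNIV. b $ i * real (z i) * (F z - (if z i = 0 then 1 else F (z(i := z i - 1)))))
     + (\<Sum>i\<in>UNIV. b $ i * (real (z i) + 1 / 2) * (F z - F (z(i := z i + 1))))"
    unfolding sum_distrib_left sum.distrib[symmetric] summand ..
  finally show "0 \<le> (\<Sum>i\<in>UNIV. \<gamma> $ i * t $ i * real (z i) *
      (enn2real (gamma_mean f \<gamma> z t) - (if z i = 0 then 1 else enn2real (gamma_mean f \<gamma> (z(i := z i - 1)) t))))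
    + (\<Sum>i\<in>UNIV. \<gamma> $ i * t $ i * (real (z i) + 1 / 2) *
      (enn2real (gamma_mean f \<gamma> z t) - enn2real (gamma_mean f \<gamma> (z(i := z i + 1)) t)))"
    unfolding b(2) F_def .
qed

theorem theorem2:
  fixes r s \<gamma> :: "real ^ 'n::finite" and f :: "real ^ 'n \<Rightarrow> ennreal"
  assumes r_pos: "\<And>i. 0 < r $ i" and s_pos: "\<And>i. 0 < s $ i"
    and gamma: "\<And>i. \<gamma> $ i = 1 / r $ i - 1 / (r $ i + s $ i)"
    and f_meas: "f \<in> borel_measurable (lebesgue_on orthant)"
    and f_nonzero: "\<not> (AE \<theta> in lebesgue_on orthant. f \<theta> = 0)"
    and F_finite: "\<And>z t. t \<in> pos_orthant \<Longrightarrow> gamma_mean f \<gamma> z t < \<infinity>"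
  shows
    "(star_condition f \<gamma> \<longrightarrow>
        weakly_dominates r s (predictive r s (weighted_prior f \<gamma>)) (predictive r s jeffreys_prior) \<and>
        ((\<exists>z z'. gamma_mean f \<gamma> z r \<noteq> gamma_mean f \<gamma> z' r) \<longrightarrow>
          dominates r s (predictive r s (weighted_prior f \<gamma>)) (predictive r s jeffreys_prior)))
     \<and>
     (\<forall>g :: real ^ 'n \<Rightarrow> real.
        (\<forall>\<theta>\<in>orthant. 0 \<le> g \<theta> \<and> f \<theta> = ennreal (g \<theta>)) \<and>
        C2_orthant g \<and>
        weighted_integrable g \<and>
        (\<forall>i. weighted_integrable (partial i g)) \<and>
        (\<forall>i. weighted_integrable (partial i (partial i g))) \<and>
        (\<forall>\<theta>\<in>orthant. (\<Sum>i\<in>UNIV. partial i (partial i g) \<theta>) \<le> 0) \<and>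
        (\<forall>i. \<forall>\<theta>\<in>orthant. \<theta> $ i = 0 \<longrightarrow> partial i g \<theta> \<le> 0)
        \<longrightarrow> star_condition f \<gamma>)"
proof (intro conjI impI allI)
  assume star: "star_condition f \<gamma>"
  show "weakly_dominates r s (predictive r s (weighted_prior f \<gamma>)) (predictive r s jeffreys_prior)"
    by (rule star_condition_imp_dominates(1)[OF r_pos s_pos gamma f_meas f_nonzero F_finite star])
  assume "\<exists>z z'. gamma_mean f \<gamma> z r \<noteq> gamma_mean f \<gamma> z' r"
  then show "dominates r s (predictive r s (weighted_prior f \<gamma>)) (predictive r s jeffreys_prior)"
    using star_condition_imp_dominates(2)[OF r_pos s_pos gamma f_meas f_nonzero F_finite star] by blast
next
  fix g :: "real ^ 'n \<Rightarrow> real"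
  assume g: "(\<forall>\<theta>\<in>orthant. 0 \<le> g \<theta> \<and> f \<theta> = ennreal (g \<theta>)) \<and>
        C2_orthant g \<and>
        weighted_integrable g \<and>
        (\<forall>i. weighted_integrable (partial i g)) \<and>
        (\<forall>i. weighted_integrable (partial i (partial i g))) \<and>
        (\<forall>\<theta>\<in>orthant. (\<Sum>i\<in>UNIV. partial i (partial i g) \<theta>) \<le> 0) \<and>
        (\<forall>i. \<forall>\<theta>\<in>orthant. \<theta> $ i = 0 \<longrightarrow> partial i g \<theta> \<le> 0)"
  have "0 < \<gamma> $ i" for i
    unfolding gamma using r_pos[of i] s_pos[of i] by (simp add: frac_less2)
  then show "star_condition f \<gamma>"
    by (rule superharmonic_imp_star_condition[where g = g]) (use g in auto)
qed

end
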